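(* Let $(A,\rho_A,[\![\cdot,\cdot]\!]_A)$ be a Lie algebroid over a smooth manifold $M$. For every natural number $k\ge 1$ the following identity of operators from $\mathcal{A}lt^{\bullet}_{\mathbb{R}}(\Gamma(T\mathbb{R}^k\times A);C^\infty(\mathbb{R}^k\times M))$ to $\mathcal{A}lt^{\bullet-k+1}_{\mathbb{R}}(\Gamma(A);C^\infty(M))$ holds: $$\int_{\Delta^k}\circ\, d_{T\mathbb{R}^k\times A,\mathbb{R}}+(-1)^{k+1}\,d_{A,\mathbb{R}}\circ\int_{\Delta^k}=\sum_{j=0}^{k}(-1)^j\int_{\Delta^{k-1}}\circ\,(d\sigma_j^{k-1}\times \mathrm{id}_A)^{*}.$$ Here the operators on the right-hand side are the composite operators defined as single symbols as follows, for an $\mathbb{R}$-linear $n$-form $\omega\in\mathcal{A}lt^n_{\mathbb{R}}(\Gamma(T\mathbb{R}^k\times A);C^\infty(\mathbb{R}^k\times M))$. If $k\ge 2$, $0\le j\le k$, and $a_1,\dots,a_{n-k+1}\in\Gamma(A)$, $$\Big(\big(\textstyle\int_{\Delta^{k-1}}\circ(d\sigma_j^{k-1}\times\mathrm{id}_A)^*\big)\omega\Big)(a_1,\dots,a_{n-k+1})=\int_{\Delta^{k-1}}\omega\Big(d\sigma_j^{k-1}\big(\tfrac{\partial}{\partial t^1}\big),\dots,d\sigma_j^{k-1}\big(\tfrac{\partial}{\partial t^{k-1}}\big),a_1,\dots,a_{n-k+1}\Big)\Big|_{(\sigma_j^{k-1}(t_1,\dots,t_{k-1}),\,\bullet)}dt_1\cdots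 dt_{k-1},$$ and if $k=1$, $j\in\{0,1\}$, and $a_1,\dots,a_n\in\Gamma(A)$, $$\Big(\big(\textstyle\int_{\Delta^{0}}\circ(d\sigma_j^{0}\times\mathrm{id}_A)^*\big)\omega\Big)(a_1,\dots,a_n)=\omega(a_1,\dots,a_n)\big|_{(\sigma_j^0(0),\,\bullet)}\in C^\infty(M).$$
   Context: **Lie algebroids.** A Lie algebroid over $M$ is a triple $(A,\rho_A,[\![\cdot,\cdot]\!]_A)$ with $A\to M$ a real vector bundle, $\rho_A:A\to TM$ a vector bundle homomorphism (the anchor), and $[\![\cdot,\cdot]\!]_A$ an $\mathbb{R}$-Lie algebra bracket on $\Gamma(A)$ with $[\![a,fb]\!]_A=f[\![a,b]\!]_A+\rho_A(a)(f)\,b$ for $a,b\in\Gamma(A)$, $f\in C^\infty(M)$. **$\mathbb{R}$-linear forms.** For a Lie algebroid $A$ over $M$, $\mathcal{A}lt^n_{\mathbb{R}}(\Gamma(A);C^\infty(M))$ is the space of $\mathbb{R}$-multilinear (not necessarily $C^\infty(M)$-multilinear, possibly non-local) antisymmetric maps $\Gamma(A)^n\to C^\infty(M)$; for $n=0$ it is $C^\infty(M)$, and for $n<0$ it is $0$. The operator $d_{A,\mathbb{R}}:\mathcal{A}lt^n_{\mathbb{R}}\to\mathcal{A}lt^{n+1}_{\mathbb{R}}$ is $$(d_{A,\mathbb{R}}\eta)(a_1,\dots,a_{n+1})=\sum_{i=1}^{n+1}(-1)^{i+1}(\rho_A\circ a_i)\big(\eta(a_1,\dots\widehat{i}\dots,a_{n+1})\big)+\sum_{i<j}(-1)^{i+j}\eta([\![a_i,a_j]\!]_A,a_1,\dots\widehat{i}\dots\widehat{j}\dots,a_{n+1}),$$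 with $(d_{A,\mathbb{R}}f)(a)=(\rho_A\circ a)(f)$ for $n=0$. **The Lie algebroid $T\mathbb{R}^k\times A$.** This is the Cartesian product Lie algebroid over $\mathbb{R}^k\times M$, with anchor $\mathrm{id}\times\rho_A$ and, for sections $\sigma=(\sigma^1,\sigma^2)$, $\eta=(\eta^1,\eta^2)$, bracket whose two components at $(t,x)$ are $$[\sigma^1(\cdot,x),\eta^1(\cdot,x)](t)+(\rho_A\circ\sigma^2)_{(t,x)}(\eta^1(t,\cdot))-(\rho_A\circ\eta^2)_{(t,x)}(\sigma^1(t,\cdot)),$$ $$[\![\sigma^2(t,\cdot),\eta^2(t,\cdot)]\!]_A(x)+\sigma^1_{(t,x)}(\eta^2(\cdot,x))-\eta^1_{(t,x)}(\sigma^2(\cdot,x)),$$ where tangent vectors act on vector-valued functions by directional derivative. The operator $d_{T\mathbb{R}^k\times A,\mathbb{R}}$ is the operator above for this Lie algebroid. A section $a\in\Gamma(A)$ is regarded as the section $(0,a)$, $(t,x)\mapsto(0_t,a(x))$, of $T\mathbb{R}^k\times A$, and $\frac{\partial}{\partial t^j}$ denotes the section $(\frac{\partial}{\partial t^j},0)$. **Simplices and integration.** $\Delta^k=\{(t_1,\dots,t_k)\in\mathbb{R}^k: t_i\ge0\ \forall i,\ \sum_i t_i\le1\}$ for $k\ge1$, and $\Delta^0=\{0\}$. For $k\ge1$, $\omega\in\mathcal{A}lt^n_{\mathbb{R}}(\Gamma(T\mathbb{R}^k\times A);C^\infty(\mathbb{R}^k\times M))$ with $n\ge k$, and $a_1,\dots,a_{n-k}\in\Gamma(A)$,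 $$\Big(\int_{\Delta^k}\omega\Big)(a_1,\dots,a_{n-k})=\int_{\Delta^k}\omega\Big(\tfrac{\partial}{\partial t^1},\dots,\tfrac{\partial}{\partial t^k},a_1,\dots,a_{n-k}\Big)\Big|_{(t_1,\dots,t_k,\bullet)}dt_1\cdots dt_k\in C^\infty(M),$$ where for $F\in C^\infty(\mathbb{R}^k\times M)$, $F|_{(t,\bullet)}$ denotes the function $x\mapsto F(t,x)$; for $n<k$, $\int_{\Delta^k}\omega=0$. Similarly, the right-hand-side operators are $0$ when $n<k-1$. **Face maps.** $\sigma_j^k:\mathbb{R}^k\to\mathbb{R}^{k+1}$, $0\le j\le k+1$, are given by $\sigma_0^0(0)=1$, $\sigma_1^0(0)=0$, and for $k\ge1$ by $\sigma_0^k(t_1,\dots,t_k)=(1-\sum_{i=1}^kt_i,t_1,\dots,t_k)$ and $\sigma_j^k(t_1,\dots,t_k)=(t_1,\dots,t_{j-1},0,t_j,\dots,t_k)$ for $1\le j\le k+1$. In the claim, $d\sigma_j^{k-1}(\frac{\partial}{\partial t^s})$ denotes the constant-coefficient vector field on $\mathbb{R}^k$ (viewed as a section of $T\mathbb{R}^k\times A$) determined by the differential of the affine map $\sigma_j^{k-1}$: for $j=0$ it is $-\frac{\partial}{\partial t^1}+\frac{\partial}{\partial t^{s+1}}$; for $1\le j\le k$ it is $\frac{\partial}{\partial t^s}$ if $s<j$ and $\frac{\partial}{\partial t^{s+1}}$ if $s\ge j$. *)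

theory Defs
  imports "HOL-Analysis.Analysis"
begin

section \<open>Coordinate space and smooth functions\<close>

text \<open>
  The space R^n is the set of functions on the index set {1..n} (extended by undefined), i.e. the
  carrier of both the product topology and the product measure over {1..n}. In this way the
  dimension is a natural number, and dimension 0 is included (one point).
\<close>

definition RT :: "nat \<Rightarrow> (nat \<Rightarrow> real) topology" where
  "RT n = product_topology (\<lambda>_. euclideanreal) {1..n}"

abbreviation RR :: "nat \<Rightarrow> (nat \<Rightarrow> real) set" where
  "RR n \<equiv> {1..n} \<rightarrow>\<^sub>E UNIV"

definition eadd :: "nat \<Rightarrow> (nat \<Rightarrow> real) \<Rightarrow> (nat \<Rightarrow> real) \<Rightarrow> nat \<Rightarrow> real" where
  "eadd n u v = (\<lambda>l\<in>{1..n}. u l + v l)"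

definition escale :: "nat \<Rightarrow> real \<Rightarrow> (nat \<Rightarrow> real) \<Rightarrow> nat \<Rightarrow> real" where
  "escale n c u = (\<lambda>l\<in>{1..n}. c * u l)"

definition ezero :: "nat \<Rightarrow> nat \<Rightarrow> real" where
  "ezero n = (\<lambda>l\<in>{1..n}. 0)"

definition eunit :: "nat \<Rightarrow> nat \<Rightarrow> nat \<Rightarrow> real" where
  "eunit n i = (\<lambda>l\<in>{1..n}. if l = i then 1 else 0)"

text \<open>The point (u, v) of R^(p+n) = R^p x R^n.\<close>

definition econcat :: "nat \<Rightarrow> nat \<Rightarrow> (nat \<Rightarrow> real) \<Rightarrow> (nat \<Rightarrow> real) \<Rightarrow> nat \<Rightarrow> real" where
  "econcat p n u v = (\<lambda>l\<in>{1..p + n}. if l \<le> p then u l else v (l - p))"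

definition partial :: "nat \<Rightarrow> ((nat \<Rightarrow> real) \<Rightarrow> real) \<Rightarrow> (nat \<Rightarrow> real) \<Rightarrow> real" where
  "partial i f v = deriv (\<lambda>s. f (v(i := s))) (v i)"

text \<open>Continuous differentiability of order r on U, to be used for U open in R^n only.\<close>

primrec Ck_on :: "nat \<Rightarrow> nat \<Rightarrow> (nat \<Rightarrow> real) set \<Rightarrow> ((nat \<Rightarrow> real) \<Rightarrow> real) \<Rightarrow> bool" where
  "Ck_on n 0 U f \<longleftrightarrow> continuous_map (subtopology (RT n) U) euclideanreal f"
| "Ck_on n (Suc r) U f \<longleftrightarrow>
     continuous_map (subtopology (RT n) U) euclideanreal f \<and>
     (\<forall>i\<in>{1..n}. (\<forall>v\<in>U. (\<lambda>s. f (v(i := s))) differentiable (at (v i))) \<and>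
                 Ck_on n r U (partial i f))"

definition smooth_on :: "nat \<Rightarrow> (nat \<Rightarrow> real) set \<Rightarrow> ((nat \<Rightarrow> real) \<Rightarrow> real) \<Rightarrow> bool" where
  "smooth_on n U f \<longleftrightarrow> (\<forall>r. Ck_on n r U f)"


section \<open>Smooth manifolds\<close>

text \<open>
  A manifold is given by a topology and an atlas, written as an indexed family of charts
  (an atlas that is a set of charts is indexed by itself). The atlas need not be maximal: adding
  compatible charts changes the notions below at most up to canonical isomorphism.
\<close>

record ('m, 'i) manifold =
  mtop :: "'m topology"
  mdim :: nat
  charts :: "'i set"
  cdom :: "'i \<Rightarrow> 'm set"
  chart :: "'i \<Rightarrow> 'm \<Rightarrow> nat \<Rightarrow> real"

abbreviation pts :: "('m, 'i, 'z) manifold_scheme \<Rightarrow> 'm set" where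
  "pts M \<equiv> topspace (mtop M)"

definition charts_at :: "('m, 'i) manifold \<Rightarrow> 'm \<Rightarrow> 'i set" where
  "charts_at M x = {i \<in> charts M. x \<in> cdom M i}"

definition in_chart :: "('m, 'i) manifold \<Rightarrow> 'i \<Rightarrow> ('m \<Rightarrow> real) \<Rightarrow> (nat \<Rightarrow> real) \<Rightarrow> real" where
  "in_chart M i f = f \<circ> inv_into (cdom M i) (chart M i)"

definition smooth_manifold :: "('m, 'i) manifold \<Rightarrow> bool" where
  "smooth_manifold M \<longleftrightarrow>
     Hausdorff_space (mtop M) \<and> second_countable (mtop M) \<and>
     (\<Union>i\<in>charts M. cdom M i) = pts M \<and>
     (\<forall>i\<in>charts M.
        openin (mtop M) (cdom M i) \<and>
        openin (RT (mdim M)) (chart M i ` cdom M i) \<and>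
        homeomorphic_map (subtopology (mtop M) (cdom M i))
          (subtopology (RT (mdim M)) (chart M i ` cdom M i)) (chart M i)) \<and>
     (\<forall>i\<in>charts M. \<forall>j\<in>charts M. \<forall>l\<in>{1..mdim M}.
        smooth_on (mdim M) (chart M i ` (cdom M i \<inter> cdom M j))
          (in_chart M i (\<lambda>x. chart M j x l)))"

text \<open>Smoothness on an open subset W.\<close>

definition smooth_fun_on :: "('m, 'i) manifold \<Rightarrow> 'm set \<Rightarrow> ('m \<Rightarrow> real) \<Rightarrow> bool" where
  "smooth_fun_on M W f \<longleftrightarrow>
     (\<forall>i\<in>charts M. smooth_on (mdim M) (chart M i ` (cdom M i \<inter> W)) (in_chart M i f))"

text \<open>Functions vanish off the carrier, so that equality of functions is equality on the manifold.\<close>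

definition C_inf :: "('m, 'i) manifold \<Rightarrow> ('m \<Rightarrow> real) set" where
  "C_inf M = {f. smooth_fun_on M (pts M) f \<and> (\<forall>x. x \<notin> pts M \<longrightarrow> f x = 0)}"

text \<open>
  The product manifold of R^p (with its identity chart) and M. Its charts are the maps id x phi,
  where phi is a chart of M; hence they have the same index set as the charts of M.
\<close>

definition Rtimes :: "nat \<Rightarrow> ('m, 'i) manifold \<Rightarrow> ((nat \<Rightarrow> real) \<times> 'm, 'i) manifold" where
  "Rtimes p M = \<lparr>
     mtop = prod_topology (RT p) (mtop M),
     mdim = p + mdim M,
     charts = charts M,
     cdom = (\<lambda>i. RR p \<times> cdom M i),
     chart = (\<lambda>i (t, x). econcat p (mdim M) t (chart M i x)) \<rparr>"


section \<open>Vector bundles\<close>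

text \<open>
  The fibre over x is a set with operations. A local trivialisation over tdom j is a
  family, for x in tdom j, of linear bijections of the fibres onto R^r (so the vector space axioms
  of the fibres are inherited from R^r), and the matrices of the changes of trivialisation depend
  smoothly on x. The total space is the disjoint union of the fibres, with the unique smooth
  structure making the trivialisations diffeomorphisms.
\<close>

record ('m, 'i, 'e, 'j) vbundle =
  base :: "('m, 'i) manifold"
  rank :: nat
  fib :: "'m \<Rightarrow> 'e set"
  vadd :: "'m \<Rightarrow> 'e \<Rightarrow> 'e \<Rightarrow> 'e"
  vscale :: "'m \<Rightarrow> real \<Rightarrow> 'e \<Rightarrow> 'e"
  vzero :: "'m \<Rightarrow> 'e"
  trivs :: "'j set"
  tdom :: "'j \<Rightarrow> 'm set"
  triv :: "'j \<Rightarrow> 'm \<Rightarrow> 'e \<Rightarrow> nat \<Rightarrow> real"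

definition frame :: "('m, 'i, 'e, 'j, 'z) vbundle_scheme \<Rightarrow> 'j \<Rightarrow> nat \<Rightarrow> 'm \<Rightarrow> 'e" where
  "frame E j l x = inv_into (fib E x) (triv E j x) (eunit (rank E) l)"

definition vector_bundle :: "('m, 'i, 'e, 'j, 'z) vbundle_scheme \<Rightarrow> bool" where
  "vector_bundle E \<longleftrightarrow>
     smooth_manifold (base E) \<and>
     (\<forall>x\<in>pts (base E).
        vzero E x \<in> fib E x \<and>
        (\<forall>u\<in>fib E x. \<forall>v\<in>fib E x. vadd E x u v \<in> fib E x) \<and>
        (\<forall>c. \<forall>u\<in>fib E x. vscale E x c u \<in> fib E x)) \<and>
     (\<Union>j\<in>trivs E. tdom E j) = pts (base E) \<and>
     (\<forall>j\<in>trivs E. openin (mtop (base E)) (tdom E j) \<and>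
        (\<forall>x\<in>tdom E j.
           bij_betw (triv E j x) (fib E x) (RR (rank E)) \<and>
           triv E j x (vzero E x) = ezero (rank E) \<and>
           (\<forall>u\<in>fib E x. \<forall>v\<in>fib E x.
              triv E j x (vadd E x u v) = eadd (rank E) (triv E j x u) (triv E j x v)) \<and>
           (\<forall>c. \<forall>u\<in>fib E x. triv E j x (vscale E x c u) = escale (rank E) c (triv E j x u)))) \<and>
     (\<forall>i\<in>trivs E. \<forall>j\<in>trivs E. \<forall>m\<in>{1..rank E}. \<forall>l\<in>{1..rank E}.
        smooth_fun_on (base E) (tdom E i \<inter> tdom E j) (\<lambda>x. triv E j x (frame E i m x) l))"

definition sections :: "('m, 'i, 'e, 'j, 'z) vbundle_scheme \<Rightarrow> ('m \<Rightarrow> 'e) set" where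
  "sections E = {a \<in> (\<Pi>\<^sub>E x\<in>pts (base E). fib E x).
     \<forall>j\<in>trivs E. \<forall>l\<in>{1..rank E}. smooth_fun_on (base E) (tdom E j) (\<lambda>x. triv E j x (a x) l)}"

definition sec_add ::
    "('m, 'i, 'e, 'j, 'z) vbundle_scheme \<Rightarrow> ('m \<Rightarrow> 'e) \<Rightarrow> ('m \<Rightarrow> 'e) \<Rightarrow> 'm \<Rightarrow> 'e" where
  "sec_add E a b = (\<lambda>x\<in>pts (base E). vadd E x (a x) (b x))"

definition sec_mult ::
    "('m, 'i, 'e, 'j, 'z) vbundle_scheme \<Rightarrow> ('m \<Rightarrow> real) \<Rightarrow> ('m \<Rightarrow> 'e) \<Rightarrow> 'm \<Rightarrow> 'e" where
  "sec_mult E f a = (\<lambda>x\<in>pts (base E). vscale E x (f x) (a x))"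

abbreviation sec_scale ::
    "('m, 'i, 'e, 'j, 'z) vbundle_scheme \<Rightarrow> real \<Rightarrow> ('m \<Rightarrow> 'e) \<Rightarrow> 'm \<Rightarrow> 'e" where
  "sec_scale E c \<equiv> sec_mult E (\<lambda>_. c)"

definition sec_zero :: "('m, 'i, 'e, 'j, 'z) vbundle_scheme \<Rightarrow> 'm \<Rightarrow> 'e" where
  "sec_zero E = (\<lambda>x\<in>pts (base E). vzero E x)"

text \<open>
  Homomorphisms over the identity of the base: fibrewise linear maps that are smooth, i.e. whose
  matrices in local trivialisations are smooth.
\<close>

definition bundle_hom ::
    "('m, 'i, 'e, 'j, 'y) vbundle_scheme \<Rightarrow> ('m, 'i, 'f, 'k, 'z) vbundle_scheme \<Rightarrow>
     ('m \<Rightarrow> 'e \<Rightarrow> 'f) \<Rightarrow> bool" where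
  "bundle_hom E F h \<longleftrightarrow>
     (\<forall>x\<in>pts (base E).
        (\<forall>u\<in>fib E x. h x u \<in> fib F x) \<and>
        (\<forall>u\<in>fib E x. \<forall>v\<in>fib E x. h x (vadd E x u v) = vadd F x (h x u) (h x v)) \<and>
        (\<forall>c. \<forall>u\<in>fib E x. h x (vscale E x c u) = vscale F x c (h x u))) \<and>
     (\<forall>i\<in>trivs E. \<forall>j\<in>trivs F. \<forall>m\<in>{1..rank E}. \<forall>l\<in>{1..rank F}.
        smooth_fun_on (base E) (tdom E i \<inter> tdom F j) (\<lambda>x. triv F j x (h x (frame E i m x)) l))"


section \<open>The tangent bundle\<close>

text \<open>
  A tangent vector at x assigns to each chart around x its coordinate vector, these being related
  by the Jacobian matrices of the transition maps.
\<close>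

definition tangent_space :: "('m, 'i) manifold \<Rightarrow> 'm \<Rightarrow> ('i \<Rightarrow> nat \<Rightarrow> real) set" where
  "tangent_space M x = {v \<in> charts_at M x \<rightarrow>\<^sub>E RR (mdim M).
     \<forall>i\<in>charts_at M x. \<forall>j\<in>charts_at M x. \<forall>l\<in>{1..mdim M}.
       v j l = (\<Sum>m\<in>{1..mdim M}. partial m (in_chart M i (\<lambda>y. chart M j y l)) (chart M i x) * v i m)}"

definition tangent_bundle :: "('m, 'i) manifold \<Rightarrow> ('m, 'i, 'i \<Rightarrow> nat \<Rightarrow> real, 'i) vbundle" where
  "tangent_bundle M = \<lparr>
     base = M,
     rank = mdim M,
     fib = tangent_space M,
     vadd = (\<lambda>x u v. \<lambda>i\<in>charts_at M x. eadd (mdim M) (u i) (v i)),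
     vscale = (\<lambda>x c u. \<lambda>i\<in>charts_at M x. escale (mdim M) c (u i)),
     vzero = (\<lambda>x. \<lambda>i\<in>charts_at M x. ezero (mdim M)),
     trivs = charts M,
     tdom = cdom M,
     triv = (\<lambda>i x v. v i) \<rparr>"

text \<open>
  The derivative v(f) of a smooth function f along a tangent vector v at x. By the chain rule the
  value does not depend on the chosen chart.
\<close>

definition tangent_apply ::
    "('m, 'i) manifold \<Rightarrow> 'm \<Rightarrow> ('i \<Rightarrow> nat \<Rightarrow> real) \<Rightarrow> ('m \<Rightarrow> real) \<Rightarrow> real" where
  "tangent_apply M x v f =
     (let i = (SOME i. i \<in> charts_at M x)
      in \<Sum>m\<in>{1..mdim M}. v i m * partial m (in_chart M i f) (chart M i x))"


section \<open>Lie algebroids\<close>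

record ('m, 'i, 'e, 'j) algebroid = "('m, 'i, 'e, 'j) vbundle" +
  anchor :: "'m \<Rightarrow> 'e \<Rightarrow> 'i \<Rightarrow> nat \<Rightarrow> real"
  bracket :: "('m \<Rightarrow> 'e) \<Rightarrow> ('m \<Rightarrow> 'e) \<Rightarrow> 'm \<Rightarrow> 'e"

text \<open>The function (anchor o a)(f).\<close>

definition act :: "('m, 'i, 'e, 'j) algebroid \<Rightarrow> ('m \<Rightarrow> 'e) \<Rightarrow> ('m \<Rightarrow> real) \<Rightarrow> 'm \<Rightarrow> real" where
  "act A a f x = (if x \<in> pts (base A) then tangent_apply (base A) x (anchor A x (a x)) f else 0)"

definition lie_algebroid :: "('m, 'i, 'e, 'j) algebroid \<Rightarrow> bool" where
  "lie_algebroid A \<longleftrightarrow>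
     vector_bundle A \<and>
     bundle_hom A (tangent_bundle (base A)) (anchor A) \<and>
     (\<forall>a\<in>sections A. \<forall>b\<in>sections A. bracket A a b \<in> sections A) \<and>
     (\<forall>a\<in>sections A. \<forall>b\<in>sections A. \<forall>c\<in>sections A.
        bracket A (sec_add A a b) c = sec_add A (bracket A a c) (bracket A b c) \<and>
        bracket A a (sec_add A b c) = sec_add A (bracket A a b) (bracket A a c)) \<and>
     (\<forall>r. \<forall>a\<in>sections A. \<forall>b\<in>sections A.
        bracket A (sec_scale A r a) b = sec_scale A r (bracket A a b) \<and>
        bracket A a (sec_scale A r b) = sec_scale A r (bracket A a b)) \<and>
     (\<forall>a\<in>sections A. bracket A a a = sec_zero A) \<and>
     (\<forall>a\<in>sections A. \<forall>b\<in>sections A. \<forall>c\<in>sections A.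
        sec_add A (bracket A a (bracket A b c))
          (sec_add A (bracket A b (bracket A c a)) (bracket A c (bracket A a b))) = sec_zero A) \<and>
     (\<forall>a\<in>sections A. \<forall>b\<in>sections A. \<forall>f\<in>C_inf (base A).
        bracket A a (sec_mult A f b) =
          sec_add A (sec_mult A f (bracket A a b)) (sec_mult A (act A a f) b))"


section \<open>Forms that are linear over the real numbers\<close>

text \<open>
  A form takes the list of its arguments. Forms of degree n vanish on every list that is not a
  list of n sections. In degree 0 the only relevant argument list is empty, so the forms are
  the smooth functions; in negative degree there is only the zero form.
\<close>

type_synonym ('m, 'e) form = "('m \<Rightarrow> 'e) list \<Rightarrow> 'm \<Rightarrow> real"

definition Alt_forms :: "('m, 'i, 'e, 'j) algebroid \<Rightarrow> int \<Rightarrow> ('m, 'e) form set" where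
  "Alt_forms A n = {\<eta>.
     (\<forall>as. \<not> (as \<in> lists (sections A) \<and> int (length as) = n) \<longrightarrow> \<eta> as = (\<lambda>x. 0)) \<and>
     (\<forall>as\<in>lists (sections A). int (length as) = n \<longrightarrow>
        \<eta> as \<in> C_inf (base A) \<and>
        (\<forall>p<length as. \<forall>a\<in>sections A. \<forall>b\<in>sections A.
           \<eta> (as[p := sec_add A a b]) = (\<lambda>x. \<eta> (as[p := a]) x + \<eta> (as[p := b]) x)) \<and>
        (\<forall>p<length as. \<forall>c. \<forall>a\<in>sections A.
           \<eta> (as[p := sec_scale A c a]) = (\<lambda>x. c * \<eta> (as[p := a]) x)) \<and>
        (\<forall>p<length as. \<forall>q<length as. p \<noteq> q \<longrightarrow>
           \<eta> (as[p := as ! q, q := as ! p]) = (\<lambda>x. - \<eta> as x)))}"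

text \<open>Positions are counted from 1 here and in the differential.\<close>

definition omit :: "nat \<Rightarrow> 'a list \<Rightarrow> 'a list" where
  "omit i as = take (i - 1) as @ drop i as"

text \<open>
  The differential. As a form of degree n vanishes on argument lists of any other length, the result
  vanishes on lists whose length is not n + 1, and the formula need not mention the degree.
\<close>

definition dR :: "('m, 'i, 'e, 'j) algebroid \<Rightarrow> ('m, 'e) form \<Rightarrow> ('m, 'e) form" where
  "dR A \<eta> as x =
     (if as \<in> lists (sections A) then
        (\<Sum>i\<in>{1..length as}. (-1) ^ (i + 1) * act A (as ! (i - 1)) (\<eta> (omit i as)) x) +
        (\<Sum>i\<in>{1..length as}. \<Sum>j\<in>{i<..length as}.
           (-1) ^ (i + j) *
           \<eta> (bracket A (as ! (i - 1)) (as ! (j - 1)) # omit i (omit j as)) x)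
      else 0)"


section \<open>The Lie algebroid T R^k x A\<close>

text \<open>Derivative at t, in direction u, of a real-valued function on R^k.\<close>

definition dir_deriv :: "nat \<Rightarrow> ((nat \<Rightarrow> real) \<Rightarrow> real) \<Rightarrow> (nat \<Rightarrow> real) \<Rightarrow> (nat \<Rightarrow> real) \<Rightarrow> real" where
  "dir_deriv k f t u = (\<Sum>m\<in>{1..k}. u m * partial m f t)"

text \<open>
  Derivative at t, in direction u, of a function h on R^k with values in the fibre over x. It is
  computed by coordinates of the fibre, in any linear isomorphism of the fibre with R^r.
\<close>

definition fib_deriv ::
    "nat \<Rightarrow> ('m, 'i, 'e, 'j) algebroid \<Rightarrow> 'm \<Rightarrow> ((nat \<Rightarrow> real) \<Rightarrow> 'e) \<Rightarrow> (nat \<Rightarrow> real) \<Rightarrow>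
     (nat \<Rightarrow> real) \<Rightarrow> 'e" where
  "fib_deriv k A x h t u =
     (THE w. w \<in> fib A x \<and>
        (\<forall>j\<in>trivs A. x \<in> tdom A j \<longrightarrow>
           (\<forall>l\<in>{1..rank A}. triv A j x w l = dir_deriv k (\<lambda>s. triv A j x (h s) l) t u)))"

definition TR_bracket_fst ::
    "nat \<Rightarrow> ('m, 'i, 'e, 'j) algebroid \<Rightarrow> ((nat \<Rightarrow> real) \<times> 'm \<Rightarrow> (nat \<Rightarrow> real) \<times> 'e) \<Rightarrow>
     ((nat \<Rightarrow> real) \<times> 'm \<Rightarrow> (nat \<Rightarrow> real) \<times> 'e) \<Rightarrow> (nat \<Rightarrow> real) \<Rightarrow> 'm \<Rightarrow> nat \<Rightarrow> real" where
  "TR_bracket_fst k A \<sigma> \<eta> t x = (\<lambda>l\<in>{1..k}.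
       (dir_deriv k (\<lambda>s. fst (\<eta> (s, x)) l) t (fst (\<sigma> (t, x))) -
        dir_deriv k (\<lambda>s. fst (\<sigma> (s, x)) l) t (fst (\<eta> (t, x)))) +
       tangent_apply (base A) x (anchor A x (snd (\<sigma> (t, x)))) (\<lambda>y. fst (\<eta> (t, y)) l) -
       tangent_apply (base A) x (anchor A x (snd (\<eta> (t, x)))) (\<lambda>y. fst (\<sigma> (t, y)) l))"

definition TR_bracket_snd ::
    "nat \<Rightarrow> ('m, 'i, 'e, 'j) algebroid \<Rightarrow> ((nat \<Rightarrow> real) \<times> 'm \<Rightarrow> (nat \<Rightarrow> real) \<times> 'e) \<Rightarrow>
     ((nat \<Rightarrow> real) \<times> 'm \<Rightarrow> (nat \<Rightarrow> real) \<times> 'e) \<Rightarrow> (nat \<Rightarrow> real) \<Rightarrow> 'm \<Rightarrow> 'e" where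
  "TR_bracket_snd k A \<sigma> \<eta> t x =
     vadd A x
       (vadd A x
         (bracket A (\<lambda>y\<in>pts (base A). snd (\<sigma> (t, y))) (\<lambda>y\<in>pts (base A). snd (\<eta> (t, y))) x)
         (fib_deriv k A x (\<lambda>s. snd (\<eta> (s, x))) t (fst (\<sigma> (t, x)))))
       (vscale A x (-1) (fib_deriv k A x (\<lambda>s. snd (\<sigma> (s, x))) t (fst (\<eta> (t, x)))))"

text \<open>
  The fibre of T R^k at t is identified with R^k. The anchor id x rho sends (u, e) to the
  tangent vector with coordinates (u, v) in the chart id x phi, where v are the coordinates of
  rho(e) in the chart phi.
\<close>

definition TR_times ::
    "nat \<Rightarrow> ('m, 'i, 'e, 'j) algebroid \<Rightarrow>
     ((nat \<Rightarrow> real) \<times> 'm, 'i, (nat \<Rightarrow> real) \<times> 'e, 'j) algebroid" where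
  "TR_times k A = \<lparr>
     base = Rtimes k (base A),
     rank = k + rank A,
     fib = (\<lambda>(t, x). RR k \<times> fib A x),
     vadd = (\<lambda>(t, x) (u, e) (u', e'). (eadd k u u', vadd A x e e')),
     vscale = (\<lambda>(t, x) c (u, e). (escale k c u, vscale A x c e)),
     vzero = (\<lambda>(t, x). (ezero k, vzero A x)),
     trivs = trivs A,
     tdom = (\<lambda>j. RR k \<times> tdom A j),
     triv = (\<lambda>j (t, x) (u, e). econcat k (rank A) u (triv A j x e)),
     anchor = (\<lambda>(t, x) (u, e). \<lambda>i\<in>charts_at (base A) x.
                 econcat k (mdim (base A)) u (anchor A x e i)),
     bracket = (\<lambda>\<sigma> \<eta>. \<lambda>(t, x)\<in>pts (Rtimes k (base A)).
                 (TR_bracket_fst k A \<sigma> \<eta> t x, TR_bracket_snd k A \<sigma> \<eta> t x)) \<rparr>"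

text \<open>The section (u, 0) for a constant vector field u on R^k, and the section (0, a).\<close>

definition const_sec ::
    "nat \<Rightarrow> ('m, 'i, 'e, 'j) algebroid \<Rightarrow> (nat \<Rightarrow> real) \<Rightarrow> (nat \<Rightarrow> real) \<times> 'm \<Rightarrow> (nat \<Rightarrow> real) \<times> 'e"
  where
  "const_sec k A u = (\<lambda>(t, x)\<in>pts (Rtimes k (base A)). (u, vzero A x))"

definition lift_sec ::
    "nat \<Rightarrow> ('m, 'i, 'e, 'j) algebroid \<Rightarrow> ('m \<Rightarrow> 'e) \<Rightarrow> (nat \<Rightarrow> real) \<times> 'm \<Rightarrow> (nat \<Rightarrow> real) \<times> 'e"
  where
  "lift_sec k A a = (\<lambda>(t, x)\<in>pts (Rtimes k (base A)). (ezero k, a x))"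


section \<open>Integration over simplices\<close>

definition std_simplex :: "nat \<Rightarrow> (nat \<Rightarrow> real) set" where
  "std_simplex k = {t \<in> RR k. (\<forall>i\<in>{1..k}. 0 \<le> t i) \<and> (\<Sum>i\<in>{1..k}. t i) \<le> 1}"

definition integral_simplex :: "nat \<Rightarrow> ((nat \<Rightarrow> real) \<Rightarrow> real) \<Rightarrow> real" where
  "integral_simplex k F = (LINT t:std_simplex k|(\<Pi>\<^sub>M i\<in>{1..k}. lborel). F t)"

text \<open>Integration over the 0-simplex is evaluation at the unique point of R^0.\<close>

lemma integral_simplex_0: "integral_simplex 0 F = F (\<lambda>_. undefined)"
  by (simp add: integral_simplex_def std_simplex_def set_lebesgue_integral_def PiM_empty
      lebesgue_integral_count_space_finite)

text \<open>
  Fibre integration of forms. For a form of degree n < k the result is zero, since the argument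
  list then has more than n entries; for the same reason the composites with faces below vanish
  on forms of degree n < k - 1.
\<close>

definition int_simplex ::
    "nat \<Rightarrow> ('m, 'i, 'e, 'j) algebroid \<Rightarrow> ((nat \<Rightarrow> real) \<times> 'm, (nat \<Rightarrow> real) \<times> 'e) form \<Rightarrow>
     ('m, 'e) form" where
  "int_simplex k A \<omega> as x =
     (if as \<in> lists (sections A) then
        integral_simplex k (\<lambda>t.
          \<omega> (map (\<lambda>s. const_sec k A (eunit k s)) [1..<k+1] @ map (lift_sec k A) as) (t, x))
      else 0)"

text \<open>The face map with index j from R^k to R^(k+1), and its differential on coordinate fields.\<close>

definition face_map :: "nat \<Rightarrow> nat \<Rightarrow> (nat \<Rightarrow> real) \<Rightarrow> nat \<Rightarrow> real" where
  "face_map k j t = (\<lambda>l\<in>{1..k+1}.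
     if j = 0 then (if l = 1 then 1 - (\<Sum>i\<in>{1..k}. t i) else t (l - 1))
     else (if l < j then t l else if l = j then 0 else t (l - 1)))"

definition face_vec :: "nat \<Rightarrow> nat \<Rightarrow> nat \<Rightarrow> nat \<Rightarrow> real" where
  "face_vec k j s =
     (if j = 0 then eadd (k+1) (escale (k+1) (-1) (eunit (k+1) 1)) (eunit (k+1) (s+1))
      else if s < j then eunit (k+1) s else eunit (k+1) (s+1))"

text \<open>
  The composite of integration over the simplex of dimension k and pull-back along the face j, on
  forms on T R^(k+1) x A. For k = 0 the integral is evaluation at the vertex.
\<close>

definition int_face ::
    "nat \<Rightarrow> nat \<Rightarrow> ('m, 'i, 'e, 'j) algebroid \<Rightarrow>
     ((nat \<Rightarrow> real) \<times> 'm, (nat \<Rightarrow> real) \<times> 'e) form \<Rightarrow> ('m, 'e) form" where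
  "int_face k j A \<omega> as x =
     (if as \<in> lists (sections A) then
        integral_simplex k (\<lambda>t.
          \<omega> (map (\<lambda>s. const_sec (k+1) A (face_vec k j s)) [1..<k+1] @ map (lift_sec (k+1) A) as)
            (face_map k j t, x))
      else 0)"

end

theory Submission
  imports Defs
begin

text \<open>
  Insert the coordinate fields and the lifts of a_1, ..., a_m into the differential of the form. All
  brackets with a coordinate field vanish, so the terms that do not differentiate along a coordinate
  field add up to (-1)^k times the differential of A applied to fibrewise evaluation, and
  differentiation under the integral sign lets them cancel against the second operator on the left.
  What remains is the integral of a divergence. Fubini and the fundamental theorem of calculus turn
  each partial derivative into the difference of the integrals over the slanted face and over a
  coordinate face. The slanted face gives the same integral whichever coordinate is eliminated, and
  its contributions are collected by expanding the form multilinearly in the differences of the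
  coordinate fields.
\<close>

section \<open>Integration over simplices\<close>

text \<open>A form here may be non-local and is only linear over the reals, so it has no expression
  in coordinates. It enters the argument through the smooth functions \<open>\<omega> as\<close> on
  R^k x M, through alternation and through real multilinearity. This suffices on the slanted face
  because the fields \<open>face_vec\<close> have constant coefficients, and it suffices for the
  bracket terms because a bracket with a coordinate field is exactly the zero section. Integrals are
  set up over simplices indexed by an arbitrary finite set, since deleting a coordinate from {1..k}
  does not leave an initial segment. Only at the end are the coordinates relabelled to reach the
  form of \<open>face_map\<close>. Linearity and alternation pass through each face integral, so the
  right-hand side is a form of the expected degree; the left-hand side is one because the two sides
  are equal.\<close>

abbreviation coord_top :: "'a set \<Rightarrow> ('a \<Rightarrow> real) topology" where
  "coord_top I \<equiv> product_topology (\<lambda>_. euclideanreal) I"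

abbreviation leb :: "'a set \<Rightarrow> ('a \<Rightarrow> real) measure" where
  "leb I \<equiv> \<Pi>\<^sub>M i\<in>I. lborel"

definition simplex_on :: "'a set \<Rightarrow> ('a \<Rightarrow> real) set" where
  "simplex_on I = {t \<in> I \<rightarrow>\<^sub>E UNIV. (\<forall>i\<in>I. 0 \<le> t i) \<and> (\<Sum>i\<in>I. t i) \<le> 1}"

lemma std_simplex_eq: "std_simplex k = simplex_on {1..k}"
  by (simp add: std_simplex_def simplex_on_def)

interpretation lebesgue_product: product_sigma_finite "\<lambda>_::'a. lborel :: real measure"
  by standard

text \<open>An open set is a union of open boxes, but a sigma-algebra admits only countable unions.
  Taking the sides of the boxes from a countable base of the real line leaves countably many boxes,
  because the index set is finite.\<close>

lemma openin_coord_top_sets: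
  assumes fin: "finite I" and U: "openin (coord_top I) U"
  shows "U \<in> sets (leb I)"
proof -
  obtain B :: "real set set" where B: "countable B" "topological_basis B"
    using ex_countable_basis by blast
  define C where "C = {c \<in> Pi\<^sub>E I ` (I \<rightarrow>\<^sub>E B). c \<subseteq> U}"
  have "C \<subseteq> Pi\<^sub>E I ` (I \<rightarrow>\<^sub>E B)" by (auto simp: C_def)
  then have count: "countable C"
    by (meson B(1) countable_PiE countable_image countable_subset fin)
  have meas: "c \<in> sets (leb I)" if "c \<in> C" for c
  proof -
    have "c \<in> Pi\<^sub>E I ` (I \<rightarrow>\<^sub>E B)" using that by (simp add: C_def)
    then obtain V where V: "c = Pi\<^sub>E I V" "V \<in> I \<rightarrow>\<^sub>E B" by (rule imageE)
    have "V i \<in> sets lborel" if "i \<in> I" for i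
      using V(2) that topological_basis_open[OF B(2)] by (simp add: PiE_iff)
    then show ?thesis unfolding V(1) by (intro sets_PiM_I_finite fin) auto
  qed
  have "U \<subseteq> \<Union>C"
  proof
    fix t assume t: "t \<in> U"
    then obtain W where W: "\<forall>i\<in>I. openin euclideanreal (W i)" "t \<in> Pi\<^sub>E I W" "Pi\<^sub>E I W \<subseteq> U"
      using U unfolding openin_product_topology_alt by meson
    have "\<exists>b\<in>B. t i \<in> b \<and> b \<subseteq> W i" if "i \<in> I" for i
    proof -
      have "open (W i)" "t i \<in> W i" using W that by (auto simp: PiE_iff)
      then show ?thesis using B(2) topological_basisE by metis
    qed
    then obtain b where b: "\<And>i. i \<in> I \<Longrightarrow> b i \<in> B \<and> t i \<in> b i \<and> b i \<subseteq> W i" by metis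
    \<comment> \<open>Restricting the choice function places it in the countable set of extensional
      functions and does not change the box.\<close>
    have eq: "Pi\<^sub>E I (restrict b I) = Pi\<^sub>E I b" by (auto simp: PiE_iff)
    have "Pi\<^sub>E I (restrict b I) \<in> Pi\<^sub>E I ` (I \<rightarrow>\<^sub>E B)" using b by (intro imageI PiE_I) auto
    moreover have "Pi\<^sub>E I b \<subseteq> U"
      using W(3) PiE_mono[of I b W] b by (meson order_trans)
    ultimately have "Pi\<^sub>E I (restrict b I) \<in> C" unfolding C_def eq by simp
    moreover have "t \<in> Pi\<^sub>E I (restrict b I)"
      using b W(2) by (auto simp: eq PiE_iff)
    ultimately show "t \<in> \<Union>C" by blast
  qed
  then have "U = \<Union>C" by (auto simp: C_def)
  then show ?thesis using count meas by (metis sets.countable_Union subsetI)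
qed

lemma continuous_map_coord_top_measurable:
  assumes "finite I" "continuous_map (coord_top I) euclideanreal f"
  shows "f \<in> borel_measurable (leb I)"
proof (rule borel_measurableI)
  fix S :: "real set" assume "open S"
  then have "openin (coord_top I) {t \<in> topspace (coord_top I). f t \<in> S}"
    using openin_continuous_map_preimage[OF assms(2), of S] \<open>open S\<close> by simp
  moreover have "{t \<in> topspace (coord_top I). f t \<in> S} = f -` S \<inter> space (leb I)"
    by (auto simp: space_PiM)
  ultimately show "f -` S \<inter> space (leb I) \<in> sets (leb I)"
    using openin_coord_top_sets[OF assms(1)] by metis
qed

lemma continuous_map_coord [continuous_intros]:
  "i \<in> I \<Longrightarrow> continuous_map (coord_top I) euclideanreal (\<lambda>t. t i)"
  by (rule continuous_map_product_projection)

lemma simplex_on_subset: "finite I \<Longrightarrow> simplex_on I \<subseteq> I \<rightarrow>\<^sub>E {0..1}"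
proof
  fix t :: "'a \<Rightarrow> real" assume I: "finite I" and t: "t \<in> simplex_on I"
  have "t i \<le> 1" if "i \<in> I" for i
  proof -
    have "t i \<le> sum t I"
      using t that I by (intro member_le_sum) (auto simp: simplex_on_def)
    with t show ?thesis by (simp add: simplex_on_def)
  qed
  with t show "t \<in> I \<rightarrow>\<^sub>E {0..1}" by (auto simp: simplex_on_def PiE_iff)
qed

lemma closedin_simplex_on:
  assumes "finite I"
  shows "closedin (coord_top I) (simplex_on I)"
proof -
  have c: "closedin (coord_top I) {t \<in> topspace (coord_top I). t i \<in> {0..}}" if "i \<in> I" for i
    using closedin_continuous_map_preimage[OF continuous_map_coord[OF that], of "{0..}"] by simp
  have d: "closedin (coord_top I) {t \<in> topspace (coord_top I). sum t I \<in> {..1}}"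
    using assms by (intro closedin_continuous_map_preimage[where Y = euclideanreal]
        continuous_map_sum continuous_map_coord) auto
  have "closedin (coord_top I) (\<Inter>(insert {t \<in> topspace (coord_top I). sum t I \<in> {..1}}
      ((\<lambda>i. {t \<in> topspace (coord_top I). t i \<in> {0..}}) ` I)))"
    using c d by (intro closedin_Inter) auto
  also have "\<Inter>(insert {t \<in> topspace (coord_top I). sum t I \<in> {..1}}
      ((\<lambda>i. {t \<in> topspace (coord_top I). t i \<in> {0..}}) ` I)) = simplex_on I"
    by (auto simp: simplex_on_def)
  finally show ?thesis .
qed

lemma compactin_simplex_on:
  assumes "finite I"
  shows "compactin (coord_top I) (simplex_on I)"
proof (rule closed_compactin[OF _ simplex_on_subset[OF assms] closedin_simplex_on[OF assms]])
  show "compactin (coord_top I) (I \<rightarrow>\<^sub>E {0..1})"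
    by (simp add: compactin_PiE)
qed

lemma sets_simplex_on:
  assumes "finite I"
  shows "simplex_on I \<in> sets (leb I)"
proof -
  have "topspace (coord_top I) - simplex_on I \<in> sets (leb I)"
    using closedin_simplex_on[OF assms] openin_coord_top_sets[OF assms] by blast
  then have "space (leb I) - (topspace (coord_top I) - simplex_on I) \<in> sets (leb I)" by blast
  moreover have "space (leb I) - (topspace (coord_top I) - simplex_on I) = simplex_on I"
    by (auto simp: space_PiM simplex_on_def)
  ultimately show ?thesis by simp
qed

lemma emeasure_simplex_on:
  assumes "finite I"
  shows "emeasure (leb I) (simplex_on I) \<le> 1"
proof -
  have "emeasure (leb I) (simplex_on I) \<le> emeasure (leb I) (I \<rightarrow>\<^sub>E {0..1})"
    using assms by (intro emeasure_mono simplex_on_subset sets_PiM_I_finite) auto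
  also have "\<dots> = (\<Prod>i\<in>I. emeasure lborel {0..1::real})"
    using assms by (intro lebesgue_product.emeasure_PiM) auto
  also have "\<dots> = 1" by simp
  finally show ?thesis .
qed

lemma emeasure_simplex_on_finite: "finite I \<Longrightarrow> emeasure (leb I) (simplex_on I) < \<infinity>"
  using emeasure_simplex_on[of I] by (metis ennreal_one_less_top infinity_ennreal_def order_le_less_trans)

lemma measure_simplex_on_le: "finite I \<Longrightarrow> measure (leb I) (simplex_on I) \<le> 1"
  using emeasure_simplex_on[of I]
  by (metis enn2real_leI ennreal_1 measure_def zero_le_one)

text \<open>The simplex is compact and of finite measure, so a continuous function is bounded on it
  and therefore integrable.\<close>

lemma set_integrable_simplex_on:
  assumes I: "finite I" and f: "continuous_map (coord_top I) euclideanreal f"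
  shows "set_integrable (leb I) (simplex_on I) f"
proof -
  have "compactin euclideanreal (f ` simplex_on I)"
    using image_compactin compactin_simplex_on[OF I] f by blast
  then have "bounded (f ` simplex_on I)" by (simp add: compact_imp_bounded)
  then obtain B where B: "\<And>t. t \<in> simplex_on I \<Longrightarrow> norm (f t) \<le> B" by (auto simp: bounded_iff)
  show ?thesis unfolding set_integrable_def
  proof (rule integrableI_bounded_set[where A = "simplex_on I" and B = B])
    show "(\<lambda>x. indicat_real (simplex_on I) x *\<^sub>R f x) \<in> borel_measurable (leb I)"
      using sets_simplex_on[OF I] continuous_map_coord_top_measurable[OF I f]
      by (intro borel_measurable_scaleR borel_measurable_indicator)
    show "AE x in leb I. x \<in> simplex_on I \<longrightarrow> norm (indicat_real (simplex_on I) x *\<^sub>R f x) \<le> B"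
      using B by auto
  qed (use I emeasure_simplex_on_finite sets_simplex_on in auto)
qed

section \<open>The integral over a simplex with arbitrary finite index set\<close>

definition simplex_integral :: "'a set \<Rightarrow> (('a \<Rightarrow> real) \<Rightarrow> real) \<Rightarrow> real" where
  "simplex_integral I f = (LINT t:simplex_on I|leb I. f t)"

lemma integral_simplex_eq: "integral_simplex k = simplex_integral {1..k}"
  by (simp add: fun_eq_iff integral_simplex_def simplex_integral_def std_simplex_eq)

lemma simplex_integral_cong:
  "(\<And>t. t \<in> simplex_on I \<Longrightarrow> f t = g t) \<Longrightarrow> simplex_integral I f = simplex_integral I g"
  unfolding simplex_integral_def set_lebesgue_integral_def
  by (intro Bochner_Integration.integral_cong) (auto simp: indicator_def)

lemma simplex_integral_cong_RR:
  "(\<And>t. t \<in> I \<rightarrow>\<^sub>E UNIV \<Longrightarrow> f t = g t) \<Longrightarrow> simplex_integral I f = simplex_integral I g"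
  by (intro simplex_integral_cong) (auto simp: simplex_on_def)

lemma simplex_integral_add:
  assumes "finite I" "continuous_map (coord_top I) euclideanreal f"
    "continuous_map (coord_top I) euclideanreal g"
  shows "simplex_integral I (\<lambda>t. f t + g t) = simplex_integral I f + simplex_integral I g"
  unfolding simplex_integral_def using assms by (intro set_integral_add set_integrable_simplex_on)

lemma simplex_integral_diff:
  assumes "finite I" "continuous_map (coord_top I) euclideanreal f"
    "continuous_map (coord_top I) euclideanreal g"
  shows "simplex_integral I (\<lambda>t. f t - g t) = simplex_integral I f - simplex_integral I g"
  unfolding simplex_integral_def using assms by (intro set_integral_diff set_integrable_simplex_on)

lemma simplex_integral_cmult:
  "simplex_integral I (\<lambda>t. c * f t) = c * simplex_integral I f"
  unfolding simplex_integral_def by simp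

lemma simplex_integral_uminus:
  "simplex_integral I (\<lambda>t. - f t) = - simplex_integral I f"
  using simplex_integral_cmult[of I "-1" f] by simp

lemma simplex_integral_zero [simp]: "simplex_integral I (\<lambda>t. 0) = 0"
  using simplex_integral_cmult[of I 0 "\<lambda>_. 0"] by simp

lemma simplex_integral_sum:
  assumes "finite I" "finite K" "\<And>k. k \<in> K \<Longrightarrow> continuous_map (coord_top I) euclideanreal (f k)"
  shows "simplex_integral I (\<lambda>t. \<Sum>k\<in>K. f k t) = (\<Sum>k\<in>K. simplex_integral I (f k))"
  using assms(2,3)
proof (induction K rule: finite_induct)
  case (insert k K)
  then show ?case
    by (simp add: simplex_integral_add[OF assms(1)] continuous_map_sum)
qed simp

text \<open>The bound carries no volume factor because the simplex lies in the unit cube and so has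
  measure at most 1.\<close>

lemma abs_simplex_integral_le:
  assumes I: "finite I" and f: "continuous_map (coord_top I) euclideanreal f"
    and b: "\<And>t. t \<in> simplex_on I \<Longrightarrow> \<bar>f t\<bar> \<le> e" and e: "0 \<le> e"
  shows "\<bar>simplex_integral I f\<bar> \<le> e"
proof -
  have "\<bar>simplex_integral I f\<bar> \<le> (\<integral>t. e * indicat_real (simplex_on I) t \<partial>leb I)"
    unfolding simplex_integral_def set_lebesgue_integral_def real_norm_def[symmetric]
  proof (rule order_trans[OF Bochner_Integration.integral_norm_bound Bochner_Integration.integral_mono])
    show "integrable (leb I) (\<lambda>x. norm (indicat_real (simplex_on I) x *\<^sub>R f x))"
      using set_integrable_simplex_on[OF I f] by (simp add: set_integrable_def del: real_norm_def)
    show "integrable (leb I) (\<lambda>x. e * indicat_real (simplex_on I) x)"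
      using I sets_simplex_on emeasure_simplex_on_finite
      by (intro integrable_mult_right integrable_real_indicator) auto
  qed (use b e in \<open>auto simp: indicator_def\<close>)
  also have "\<dots> = e * measure (leb I) (simplex_on I)"
    using I sets_simplex_on[OF I] sets.sets_into_space[OF sets_simplex_on[OF I]]
    by (simp add: Int_absorb2)
  also have "\<dots> \<le> e"
    using e measure_simplex_on_le[OF I] by (simp add: mult_left_le)
  finally show ?thesis .
qed

section \<open>Simplex integrals that depend on a parameter\<close>

lemma simplex_parameter_uniform:
  assumes I: "finite I" and G: "continuous_map (prod_topology (coord_top I) X) euclideanreal G"
    and y: "y \<in> topspace X" and e: "0 < e"
  shows "\<exists>N. openin X N \<and> y \<in> N \<and> (\<forall>t\<in>simplex_on I. \<forall>z\<in>N. \<bar>G (t, z) - G (t, y)\<bar> < e)"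
proof -
  define H where "H = (\<lambda>p. G p - G (fst p, y))"
  have "continuous_map (prod_topology (coord_top I) X) (prod_topology (coord_top I) X) (\<lambda>p. (fst p, y))"
    using y by (auto simp: continuous_map_pairwise o_def continuous_map_fst)
  from continuous_map_compose[OF this G]
  have H: "continuous_map (prod_topology (coord_top I) X) euclideanreal H"
    unfolding H_def using G by (auto intro!: continuous_map_diff simp: o_def)
  define W where "W = {p \<in> topspace (prod_topology (coord_top I) X). H p \<in> {-e<..<e}}"
  have W: "openin (prod_topology (coord_top I) X) W"
    unfolding W_def using H by (rule openin_continuous_map_preimage) auto
  have "simplex_on I \<times> {y} \<subseteq> W"
    using y e by (auto simp: W_def H_def simplex_on_def)
  \<comment> \<open>The tube lemma over the compact simplex takes the place of uniform continuity,
    so \<open>X\<close> can be any topological space. It is applied to an interval parameter and to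
    chart images alike.\<close>
  from tube_lemma_left[OF W compactin_simplex_on[OF I] y this] obtain U V where
    UV: "openin X V" "simplex_on I \<subseteq> U" "y \<in> V" "U \<times> V \<subseteq> W" by blast
  show ?thesis
  proof (intro exI[of _ V] conjI ballI)
    fix t z assume "t \<in> simplex_on I" "z \<in> V"
    with UV have "(t, z) \<in> W" by blast
    then show "\<bar>G (t, z) - G (t, y)\<bar> < e" by (auto simp: W_def H_def)
  qed (use UV in auto)
qed

lemma continuous_map_section:
  assumes "continuous_map (prod_topology Y X) Z G" "y \<in> topspace X"
  shows "continuous_map Y Z (\<lambda>t. G (t, y))"
proof -
  have "continuous_map Y (prod_topology Y X) (\<lambda>t. (t, y))"
    using assms(2) by (auto simp: continuous_map_pairwise o_def)
  from continuous_map_compose[OF this assms(1)] show ?thesis by (simp add: o_def)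
qed

lemma continuous_map_simplex_integral:
  assumes I: "finite I" and G: "continuous_map (prod_topology (coord_top I) X) euclideanreal G"
  shows "continuous_map X euclideanreal (\<lambda>y. simplex_integral I (\<lambda>t. G (t, y)))"
  unfolding Met_TC.continuous_map_to_metric[where X = X, unfolded mtopology_is_euclidean] mball_eq_ball
proof (intro ballI allI impI)
  fix y and e :: real assume y: "y \<in> topspace X" and e: "e > 0"
  \<comment> \<open>Half of \<open>e\<close>, because the estimate of the integral gives a weak
    inequality while the ball is open.\<close>
  obtain N where N: "openin X N" "y \<in> N"
      "\<And>t z. t \<in> simplex_on I \<Longrightarrow> z \<in> N \<Longrightarrow> \<bar>G (t, z) - G (t, y)\<bar> < e/2"
    using simplex_parameter_uniform[OF I G y, of "e/2"] e by auto
  show "\<exists>U. openin X U \<and> y \<in> U \<and> (\<forall>z\<in>U. simplex_integral I (\<lambda>t. G (t, z))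
      \<in> ball (simplex_integral I (\<lambda>t. G (t, y))) e)"
  proof (intro exI[of _ N] conjI ballI)
    fix z assume z: "z \<in> N"
    then have zX: "z \<in> topspace X" using N(1) openin_subset by blast
    note c = continuous_map_section[OF G]
    have "\<bar>simplex_integral I (\<lambda>t. G (t, z) - G (t, y))\<bar> \<le> e/2"
      using N(3)[OF _ z] e c[OF y] c[OF zX]
      by (intro abs_simplex_integral_le[OF I] continuous_map_diff) (auto intro: less_imp_le)
    with e show "simplex_integral I (\<lambda>t. G (t, z)) \<in> ball (simplex_integral I (\<lambda>t. G (t, y))) e"
      by (simp add: simplex_integral_diff[OF I c[OF zX] c[OF y]] dist_real_def abs_minus_commute)
  qed (use N in auto)
qed

text \<open>Differentiation under the integral sign by a mean value estimate: near \<open>s0\<close>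
  the function \<open>G t s - D t s0 * s\<close> of \<open>s\<close> has a derivative of size at
  most \<open>e\<close>, uniformly for \<open>t\<close> in the simplex, and this uniform bound can
  be integrated.\<close>

lemma has_real_derivative_simplex_integral:
  assumes I: "finite I" and J: "open J" and s0: "s0 \<in> J"
    and G: "\<And>s. s \<in> J \<Longrightarrow> continuous_map (coord_top I) euclideanreal (\<lambda>t. G t s)"
    and D: "continuous_map (prod_topology (coord_top I) (top_of_set J)) euclideanreal (\<lambda>(t, s). D t s)"
    and der: "\<And>t s. t \<in> simplex_on I \<Longrightarrow> s \<in> J \<Longrightarrow> ((\<lambda>s. G t s) has_real_derivative D t s) (at s)"
  shows "((\<lambda>s. simplex_integral I (\<lambda>t. G t s)) has_real_derivative simplex_integral I (\<lambda>t. D t s0)) (at s0)"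
  unfolding has_field_derivative_def has_derivative_within_alt
proof (intro conjI allI impI)
  show "bounded_linear ((*) (simplex_integral I (\<lambda>t. D t s0)))" by (rule bounded_linear_mult_right)
  fix e :: real assume e: "e > 0"
  obtain N where N: "openin (top_of_set J) N" "s0 \<in> N"
      "\<And>t z. t \<in> simplex_on I \<Longrightarrow> z \<in> N \<Longrightarrow> \<bar>D t z - D t s0\<bar> < e"
    using simplex_parameter_uniform[OF I D, of s0 e] e s0 by auto
  then have "open N" using J by (simp add: openin_open_eq)
  then obtain d where d: "d > 0" "ball s0 d \<subseteq> N" using N(2) open_contains_ball by blast
  have NJ: "N \<subseteq> J" using N(1) openin_imp_subset by blast
  have cD: "continuous_map (coord_top I) euclideanreal (\<lambda>t. D t s0)"
    using continuous_map_section[OF D, of s0] s0 by simp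
  show "\<exists>d>0. \<forall>y\<in>UNIV. norm (y - s0) < d \<longrightarrow>
      norm (simplex_integral I (\<lambda>t. G t y) - simplex_integral I (\<lambda>t. G t s0) -
        simplex_integral I (\<lambda>t. D t s0) * (y - s0)) \<le> e * norm (y - s0)"
  proof (intro exI[of _ d] conjI ballI impI)
    fix s assume s: "norm (s - s0) < d"
    \<comment> \<open>The mean value estimate runs along the segment from \<open>s0\<close> to
      \<open>s\<close>, which must stay where the uniform bound on \<open>D\<close> holds.\<close>
    have cs: "closed_segment s0 s \<subseteq> ball s0 d"
      using s d(1) by (intro closed_segment_subset) (auto simp: dist_real_def)
    have sJ: "s \<in> J" using cs d(2) NJ by auto
    have bd: "\<bar>G t s - G t s0 - D t s0 * (s - s0)\<bar> \<le> e * \<bar>s - s0\<bar>" if t: "t \<in> simplex_on I" for t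
    proof -
      have "norm ((G t s - D t s0 * s) - (G t s0 - D t s0 * s0)) \<le> e * norm (s - s0)"
      proof (rule field_differentiable_bound[where S = "closed_segment s0 s" and f' = "\<lambda>z. D t z - D t s0"])
        fix z assume z: "z \<in> closed_segment s0 s"
        then have zN: "z \<in> N" using cs d(2) by blast
        have "((\<lambda>z. G t z - D t s0 * z) has_real_derivative D t z - D t s0 * 1) (at z)"
          using zN NJ t by (intro derivative_intros der) auto
        then show "((\<lambda>z. G t z - D t s0 * z) has_real_derivative D t z - D t s0)
            (at z within closed_segment s0 s)"
          by (simp add: has_field_derivative_at_within)
        show "norm (D t z - D t s0) \<le> e" using N(3)[OF t zN] by simp
      qed auto
      then show ?thesis by (simp add: algebra_simps)
    qed
    have "\<bar>simplex_integral I (\<lambda>t. (G t s - G t s0) - (s - s0) * D t s0)\<bar> \<le> e * \<bar>s - s0\<bar>"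
      using e bd G[OF sJ] G[OF s0] cD
      by (intro abs_simplex_integral_le[OF I] continuous_map_diff continuous_map_real_mult_left)
         (auto simp: mult.commute)
    then show "norm (simplex_integral I (\<lambda>t. G t s) - simplex_integral I (\<lambda>t. G t s0) -
        simplex_integral I (\<lambda>t. D t s0) * (s - s0)) \<le> e * norm (s - s0)"
      using G[OF sJ] G[OF s0] cD
      by (simp add: simplex_integral_diff[OF I] simplex_integral_cmult continuous_map_diff
          continuous_map_real_mult_left) (simp add: mult.commute)
  qed (use d in auto)
qed


section \<open>Fubini's theorem and the boundary terms\<close>

lemma continuous_map_fun_upd:
  assumes "continuous_map X (coord_top J) f" "continuous_map X euclideanreal g"
  shows "continuous_map X (coord_top (insert i J)) (\<lambda>z. (f z)(i := g z))"
  using assms unfolding continuous_map_componentwise by (auto simp: extensional_def image_subset_iff)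

lemma continuous_map_line:
  assumes "x \<in> I \<rightarrow>\<^sub>E UNIV" "i \<in> I"
  shows "continuous_map euclideanreal (coord_top I) (\<lambda>y. x(i := y))"
  using assms unfolding continuous_map_componentwise by (auto simp: extensional_def)

text \<open>The slices for Fubini's theorem: over a point of the smaller simplex the new coordinate
  runs through a segment whose length is what the other coordinates leave of 1.\<close>

lemma fun_upd_mem_simplex_on:
  assumes K: "finite K" "j \<notin> K" and x: "x \<in> K \<rightarrow>\<^sub>E UNIV"
  shows "x(j := y) \<in> simplex_on (insert j K) \<longleftrightarrow> x \<in> simplex_on K \<and> y \<in> {0..1 - sum x K}"
proof -
  have [simp]: "(\<Sum>a\<in>K. if a = j then y else x a) = sum x K"
    using K(2) by (intro sum.cong) auto
  have "x(j := y) \<in> insert j K \<rightarrow>\<^sub>E UNIV" using x by (auto simp: PiE_iff extensional_def)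
  then show ?thesis
    using K x sum_nonneg[of K x] by (auto simp: simplex_on_def)
qed

lemma simplex_integral_insert:
  assumes K: "finite K" "j \<notin> K" and f: "continuous_map (coord_top (insert j K)) euclideanreal f"
  shows "simplex_integral (insert j K) f =
    simplex_integral K (\<lambda>x. LINT y:{0..1 - sum x K}|lborel. f (x(j := y)))"
proof -
  have "simplex_integral (insert j K) f =
      (\<integral>x. (\<integral>y. indicat_real (simplex_on (insert j K)) (x(j := y)) *\<^sub>R f (x(j := y)) \<partial>lborel) \<partial>leb K)"
    unfolding simplex_integral_def set_lebesgue_integral_def
    using set_integrable_simplex_on[OF _ f] K
    by (intro lebesgue_product.product_integral_insert) (auto simp: set_integrable_def)
  also have "\<dots> = (\<integral>x. indicat_real (simplex_on K) x *\<^sub>R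
      (\<integral>y. indicat_real {0..1 - sum x K} y *\<^sub>R f (x(j := y)) \<partial>lborel) \<partial>leb K)"
  proof (intro Bochner_Integration.integral_cong refl)
    fix x assume "x \<in> space (leb K)"
    then have "x \<in> K \<rightarrow>\<^sub>E UNIV" by (simp add: space_PiM)
    note m = fun_upd_mem_simplex_on[OF K this]
    show "(\<integral>y. indicat_real (simplex_on (insert j K)) (x(j := y)) *\<^sub>R f (x(j := y)) \<partial>lborel) =
      indicat_real (simplex_on K) x *\<^sub>R (\<integral>y. indicat_real {0..1 - sum x K} y *\<^sub>R f (x(j := y)) \<partial>lborel)"
      by (cases "x \<in> simplex_on K") (simp_all add: indicator_def m)
  qed
  finally show ?thesis by (simp add: simplex_integral_def set_lebesgue_integral_def)
qed

text \<open>With coordinate \<open>i\<close> integrated innermost, the upper end of each slice lies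
  on the slanted face, here parametrised by all coordinates other than \<open>i\<close>.\<close>

lemma simplex_integral_partial:
  assumes I: "finite I" "i \<in> I"
    and G: "continuous_map (coord_top I) euclideanreal G"
    and D: "continuous_map (coord_top I) euclideanreal D"
    and der: "\<And>t. t \<in> I \<rightarrow>\<^sub>E UNIV \<Longrightarrow> ((\<lambda>s. G (t(i := s))) has_real_derivative D t) (at (t i))"
  shows "simplex_integral I D = simplex_integral (I - {i}) (\<lambda>t. G (t(i := 1 - sum t (I - {i})))) -
           simplex_integral (I - {i}) (\<lambda>t. G (t(i := 0)))"
proof -
  define J where "J = I - {i}"
  have J: "finite J" "i \<notin> J" "I = insert i J" using I by (auto simp: J_def)
  have "simplex_integral I D = simplex_integral J (\<lambda>x. LINT y:{0..1 - sum x J}|lborel. D (x(i := y)))"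
    using simplex_integral_insert[OF J(1,2)] D J(3) by simp
  also have "\<dots> = simplex_integral J (\<lambda>t. G (t(i := 1 - sum t J)) - G (t(i := 0)))"
  proof (rule simplex_integral_cong)
    fix x assume x: "x \<in> simplex_on J"
    have upd: "x(i := y) \<in> I \<rightarrow>\<^sub>E UNIV" for y
      using x J(3) by (auto simp: simplex_on_def PiE_iff extensional_def)
    have "continuous_map euclideanreal (coord_top I) (\<lambda>y. x(i := y))"
      using continuous_map_line[OF upd[of 0] I(2)] by simp
    from continuous_map_compose[OF this D] have c: "continuous_on UNIV (\<lambda>y. D (x(i := y)))"
      by (simp add: o_def)
    \<comment> \<open>The derivative exists along the whole line, hence also within the closed slice
      and at its endpoints.\<close>
    have d: "((\<lambda>s. G (x(i := s))) has_vector_derivative D (x(i := y))) (at y within S)" for y S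
      using der[OF upd, of y]
      by (simp add: has_real_derivative_iff_has_vector_derivative has_vector_derivative_at_within)
    then have "(\<integral>y. indicator {0..1 - sum x J} y *\<^sub>R D (x(i := y)) \<partial>lborel)
        = G (x(i := 1 - sum x J)) - G (x(i := 0))"
      using x by (intro integral_FTC_atLeastAtMost[OF _ d] continuous_on_subset[OF c])
        (auto simp: simplex_on_def)
    then show "(LINT y:{0..1 - sum x J}|lborel. D (x(i := y)))
        = G (x(i := 1 - sum x J)) - G (x(i := 0))"
      by (simp add: set_lebesgue_integral_def)
  qed
  also have "\<dots> = simplex_integral J (\<lambda>t. G (t(i := 1 - sum t J))) - simplex_integral J (\<lambda>t. G (t(i := 0)))"
  proof (rule simplex_integral_diff[OF J(1)])
    have *: "continuous_map (coord_top J) euclideanreal (\<lambda>t. G (t(i := g t)))"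
      if "continuous_map (coord_top J) euclideanreal g" for g
      using continuous_map_compose[OF continuous_map_fun_upd[OF continuous_map_id that, of i]] G J(3)
      by (simp add: o_def)
    show "continuous_map (coord_top J) euclideanreal (\<lambda>t. G (t(i := 1 - sum t J)))"
      using J(1) by (intro * continuous_intros)
    show "continuous_map (coord_top J) euclideanreal (\<lambda>t. G (t(i := 0)))"
      by (intro *) auto
  qed
  finally show ?thesis by (simp add: J_def)
qed

lemma set_integral_reflect:
  fixes f :: "real \<Rightarrow> real"
  shows "(LINT y:{0..c}|lborel. f y) = (LINT y:{0..c}|lborel. f (c - y))"
proof -
  have "(\<integral>y. indicator {0..c} y *\<^sub>R f y \<partial>lborel) =
      \<bar>-1\<bar> *\<^sub>R (\<integral>y. indicator {0..c} (c + -1 * y) *\<^sub>R f (c + -1 * y) \<partial>lborel)"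
    by (rule lborel_integral_real_affine) simp
  also have "\<dots> = (\<integral>y. indicator {0..c} y *\<^sub>R f (c - y) \<partial>lborel)"
    by (simp, intro Bochner_Integration.integral_cong) (auto simp: indicator_def)
  finally show ?thesis by (simp add: set_lebesgue_integral_def)
qed

text \<open>
  Parametrising the slanted face without coordinate \<open>i\<close> or without coordinate \<open>j\<close> differs only by a
  reflection \<open>y \<mapsto> c - y\<close> in the single coordinate that is left of the two.
\<close>

lemma simplex_integral_slanted_face:
  assumes I: "finite I" "i \<in> I" "j \<in> I"
    and G: "continuous_map (coord_top I) euclideanreal G"
  shows "simplex_integral (I - {i}) (\<lambda>t. G (t(i := 1 - sum t (I - {i})))) =
         simplex_integral (I - {j}) (\<lambda>t. G (t(j := 1 - sum t (I - {j}))))"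
proof (cases "i = j")
  case False
  define K where "K = I - {i, j}"
  have K: "finite K" "i \<notin> K" "j \<notin> K" "I - {i} = insert j K" "I - {j} = insert i K"
    "I = insert i (insert j K)" "I = insert j (insert i K)"
    using False I by (auto simp: K_def)
  have c: "continuous_map (coord_top (insert a K)) euclideanreal (\<lambda>t. G (t(b := 1 - sum t (insert a K))))"
    if "I = insert b (insert a K)" for a b
  proof -
    have "continuous_map (coord_top (insert a K)) euclideanreal (\<lambda>t. 1 - sum t (insert a K))"
      using K(1) by (intro continuous_intros) auto
    from continuous_map_fun_upd[OF continuous_map_id this, of b]
    have "continuous_map (coord_top (insert a K)) (coord_top I) (\<lambda>t. t(b := 1 - sum t (insert a K)))"
      by (simp add: that)
    from continuous_map_compose[OF this G] show ?thesis by (simp add: o_def)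
  qed
  have s: "sum (x(a := y)) (insert a K) = y + sum x K" if "a \<notin> K" for a y and x :: "'a \<Rightarrow> real"
  proof -
    have "sum (x(a := y)) K = sum x K" using that by (intro sum.cong) auto
    then show ?thesis using that K(1) by simp
  qed
  have "simplex_integral (insert j K) (\<lambda>t. G (t(i := 1 - sum t (insert j K)))) =
      simplex_integral K (\<lambda>x. LINT y:{0..1 - sum x K}|lborel. G (x(j := y, i := 1 - (y + sum x K))))"
    using simplex_integral_insert[OF K(1,3) c[OF K(6)]] by (simp only: s[OF K(3)])
  also have "\<dots> = simplex_integral K (\<lambda>x. LINT y:{0..1 - sum x K}|lborel.
      G (x(i := y, j := 1 - (y + sum x K))))"
  proof (rule simplex_integral_cong)
    fix x
    show "(LINT y:{0..1 - sum x K}|lborel. G (x(j := y, i := 1 - (y + sum x K)))) =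
      (LINT y:{0..1 - sum x K}|lborel. G (x(i := y, j := 1 - (y + sum x K))))"
      by (subst set_integral_reflect) (simp add: fun_upd_twist[OF False] algebra_simps)
  qed
  also have "\<dots> = simplex_integral (insert i K) (\<lambda>t. G (t(j := 1 - sum t (insert i K))))"
    using simplex_integral_insert[OF K(1,2) c[OF K(7)]] by (simp only: s[OF K(2)])
  finally show ?thesis using K(4,5) by simp
qed simp

section \<open>Relabelling of coordinates and face maps\<close>

lemma distr_leb_reindex:
  assumes I: "finite I" and b: "bij_betw b I J"
  shows "distr (leb J) (leb I) (\<lambda>t. \<lambda>i\<in>I. t (b i)) = leb I"
\<comment> \<open>Product measures are determined by boxes, and the preimage of a box under a
  relabelling is the box with the relabelled sides.\<close>
proof (rule lebesgue_product.PiM_eqI[OF I])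
  have bJ: "b i \<in> J" if "i \<in> I" for i using b that by (auto simp: bij_betw_def)
  have T: "(\<lambda>t. \<lambda>i\<in>I. t (b i)) \<in> measurable (leb J) (leb I)"
    using bJ by (intro measurable_restrict measurable_component_singleton) auto
  have J: "finite J" using I b bij_betw_finite by blast
  fix A :: "'a \<Rightarrow> real set" assume A: "\<And>i. i \<in> I \<Longrightarrow> A i \<in> sets lborel"
  define B where "B = (\<lambda>j. A (inv_into I b j))"
  have Bb: "B (b i) = A i" if "i \<in> I" for i
    using b that by (simp add: B_def bij_betw_def)
  have "(\<lambda>t. \<lambda>i\<in>I. t (b i)) -` Pi\<^sub>E I A \<inter> space (leb J) = Pi\<^sub>E J B"
  proof -
    have J_eq: "J = b ` I" using b by (simp add: bij_betw_def)
    show ?thesis by (auto simp: space_PiM J_eq PiE_iff Bb)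
  qed
  then have "emeasure (distr (leb J) (leb I) (\<lambda>t. \<lambda>i\<in>I. t (b i))) (Pi\<^sub>E I A) = emeasure (leb J) (Pi\<^sub>E J B)"
    using A I by (subst emeasure_distr[OF T]) (auto intro: sets_PiM_I_finite)
  also have "\<dots> = (\<Prod>j\<in>J. emeasure lborel (B j))"
    using A b by (intro lebesgue_product.emeasure_PiM J)
      (auto simp: B_def bij_betw_def inv_into_into)
  also have "\<dots> = (\<Prod>i\<in>I. emeasure lborel (A i))"
    using Bb by (intro prod.reindex_bij_betw[OF b, symmetric, THEN trans] prod.cong) auto
  finally show "emeasure (distr (leb J) (leb I) (\<lambda>t. \<lambda>i\<in>I. t (b i))) (Pi\<^sub>E I A) =
      (\<Prod>i\<in>I. emeasure lborel (A i))" .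
qed simp

lemma simplex_integral_reindex:
  assumes I: "finite I" and b: "bij_betw b I J"
    and f: "continuous_map (coord_top I) euclideanreal f"
  shows "simplex_integral J (\<lambda>t. f (\<lambda>i\<in>I. t (b i))) = simplex_integral I f"
proof -
  have bJ: "b i \<in> J" if "i \<in> I" for i using b that by (auto simp: bij_betw_def)
  have T: "(\<lambda>t. \<lambda>i\<in>I. t (b i)) \<in> measurable (leb J) (leb I)"
    using bJ by (intro measurable_restrict measurable_component_singleton) auto
  have m: "(\<lambda>i\<in>I. t (b i)) \<in> simplex_on I \<longleftrightarrow> t \<in> simplex_on J" if "t \<in> J \<rightarrow>\<^sub>E UNIV" for t :: "'b \<Rightarrow> real"
  proof -
    have J_eq: "J = b ` I" using b by (simp add: bij_betw_def)
    have "sum (\<lambda>i\<in>I. t (b i)) I = sum t J"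
      using sum.reindex_bij_betw[OF b, of t] by simp
    then show ?thesis using that by (auto simp: simplex_on_def J_eq)
  qed
  have "simplex_integral I f =
      (\<integral>t. indicat_real (simplex_on I) t *\<^sub>R f t \<partial>distr (leb J) (leb I) (\<lambda>t. \<lambda>i\<in>I. t (b i)))"
    unfolding distr_leb_reindex[OF I b] by (simp add: simplex_integral_def set_lebesgue_integral_def)
  also have "\<dots> = (\<integral>t. indicat_real (simplex_on I) (\<lambda>i\<in>I. t (b i)) *\<^sub>R f (\<lambda>i\<in>I. t (b i)) \<partial>leb J)"
    using sets_simplex_on[OF I] continuous_map_coord_top_measurable[OF I f]
    by (intro integral_distr[OF T] borel_measurable_scaleR borel_measurable_indicator)
  also have "\<dots> = simplex_integral J (\<lambda>t. f (\<lambda>i\<in>I. t (b i)))"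
    unfolding simplex_integral_def set_lebesgue_integral_def
    by (intro Bochner_Integration.integral_cong) (auto simp: indicator_def m space_PiM)
  finally show ?thesis by simp
qed

lemma continuous_map_face_map: "j \<le> Suc n \<Longrightarrow> continuous_map (RT n) (RT (Suc n)) (face_map n j)"
  unfolding RT_def
proof (subst continuous_map_componentwise, intro conjI ballI)
  fix l assume l: "l \<in> {1..Suc n}"
  have [continuous_intros]: "continuous_map (coord_top {1..n}) euclideanreal (\<lambda>t. t m)" if "m \<in> {1..n}" for m
    using that by (rule continuous_map_coord)
  assume j: "j \<le> Suc n"
  show "continuous_map (coord_top {1..n}) euclideanreal (\<lambda>t. face_map n j t l)"
  proof (cases "j = 0")
    case True
    then show ?thesis using l by (cases "l = 1") (auto simp: face_map_def intro!: continuous_intros)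
  next
    case False
    show ?thesis
    proof (cases l j rule: linorder_cases)
      case less
      then show ?thesis using l False j
        by (auto simp: face_map_def intro!: continuous_intros)
    qed (use l False in \<open>auto simp: face_map_def intro!: continuous_intros\<close>)
  qed
qed (auto simp: face_map_def)

text \<open>The increasing enumeration that skips \<open>i\<close>. Relabelling along it turns the
  substitution of 0 for coordinate \<open>i\<close> into \<open>face_map n i\<close>; for
  \<open>i = 1\<close> it also leads from the slanted face to \<open>face_map n 0\<close>.\<close>

lemma bij_betw_skip:
  assumes "i \<in> {1..Suc n}"
  shows "bij_betw (\<lambda>l. if l < i then l else Suc l) {1..n} ({1..Suc n} - {i})"
  by (rule bij_betw_byWitness[where f' = "\<lambda>l. if l < i then l else l - 1"]) (use assms in auto)

text \<open>The minuend is the same for every \<open>i\<close>: the slanted face is first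
  reparametrised by eliminating coordinate 1, which is the convention built into
  \<open>face_map n 0\<close>.\<close>

lemma integral_simplex_partial:
  assumes i: "i \<in> {1..Suc n}"
    and G: "continuous_map (RT (Suc n)) euclideanreal G"
    and D: "continuous_map (RT (Suc n)) euclideanreal D"
    and der: "\<And>t. t \<in> RR (Suc n) \<Longrightarrow> ((\<lambda>s. G (t(i := s))) has_real_derivative D t) (at (t i))"
  shows "integral_simplex (Suc n) D = integral_simplex n (\<lambda>t. G (face_map n 0 t)) -
           integral_simplex n (\<lambda>t. G (face_map n i t))"
proof -
  let ?I = "{1..Suc n}"
  have c: "continuous_map (coord_top {1..n}) euclideanreal (\<lambda>t. G (face_map n j t))"
    if "j \<le> Suc n" for j
    using continuous_map_compose[OF continuous_map_face_map[OF that] G] by (simp add: RT_def o_def)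
  have "integral_simplex (Suc n) D = simplex_integral (?I - {1}) (\<lambda>t. G (t(1 := 1 - sum t (?I - {1})))) -
      simplex_integral (?I - {i}) (\<lambda>t. G (t(i := 0)))"
    using simplex_integral_partial[where G = G and i = i, OF _ i G[unfolded RT_def] D[unfolded RT_def] der]
      simplex_integral_slanted_face[OF _ i _ G[unfolded RT_def], of 1]
    by (simp add: integral_simplex_eq)
  also have "simplex_integral (?I - {i}) (\<lambda>t. G (t(i := 0))) = integral_simplex n (\<lambda>t. G (face_map n i t))"
  proof -
    let ?b = "\<lambda>l. if l < i then l else Suc l"
    have *: "face_map n i (\<lambda>l\<in>{1..n}. t (?b l)) = t(i := 0)" if t: "t \<in> (?I - {i}) \<rightarrow>\<^sub>E UNIV" for t
    proof
      fix l
      show "face_map n i (\<lambda>l\<in>{1..n}. t (?b l)) l = (t(i := 0)) l"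
      proof -
        consider "1 \<le> l" "l < i" | "l = i" | "i < l" "l \<le> Suc n" | "l \<notin> {1..Suc n}"
          by force
        then show ?thesis
        proof cases
          case 3
          then have "\<not> l - Suc 0 < i" "l - Suc 0 \<le> n" by auto
          then show ?thesis using 3 i by (simp add: face_map_def)
        next
          \<comment> \<open>Off the index set both sides take the default value
            \<open>undefined\<close> of extensional functions.\<close>
          case 4
          then have "t l = undefined" by (intro PiE_arb[OF t]) auto
          then show ?thesis using 4 i by (simp add: face_map_def)
        qed (use i in \<open>simp_all add: face_map_def\<close>)
      qed
    qed
    have "integral_simplex n (\<lambda>t. G (face_map n i t)) =
        simplex_integral (?I - {i}) (\<lambda>t. G (face_map n i (\<lambda>l\<in>{1..n}. t (?b l))))"
      unfolding integral_simplex_eq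
      using i by (intro simplex_integral_reindex[OF _ bij_betw_skip[OF i] c, symmetric]) auto
    also have "\<dots> = simplex_integral (?I - {i}) (\<lambda>t. G (t(i := 0)))"
      by (rule simplex_integral_cong_RR) (simp only: *)
    finally show ?thesis by (rule sym)
  qed
  also have "simplex_integral (?I - {1}) (\<lambda>t. G (t(1 := 1 - sum t (?I - {1})))) =
      integral_simplex n (\<lambda>t. G (face_map n 0 t))"
  proof -
    \<comment> \<open>On {1..n} this is the shift \<open>Suc\<close>, which matches the entries
      \<open>t (l - 1)\<close> of \<open>face_map n 0\<close>.\<close>
    let ?b = "\<lambda>l. if l < 1 then l else Suc l"
    have b: "bij_betw ?b {1..n} (?I - {1})" by (rule bij_betw_skip) simp
    have *: "face_map n 0 (\<lambda>l\<in>{1..n}. t (?b l)) = t(1 := 1 - sum t (?I - {1}))"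
      if t: "t \<in> (?I - {1}) \<rightarrow>\<^sub>E UNIV" for t
    proof
      fix l
      have *: "(\<Sum>i\<in>{1..n}. (\<lambda>l\<in>{1..n}. t (?b l)) i) = sum t (?I - {1})"
        using sum.reindex_bij_betw[OF b, of t] by simp
      show "face_map n 0 (\<lambda>l\<in>{1..n}. t (?b l)) l = (t(1 := 1 - sum t (?I - {1}))) l"
      proof -
        consider "l = 1" | "1 < l" "l \<le> Suc n" | "l \<notin> {1..Suc n}"
          by force
        then show ?thesis
        proof cases
          case 2
          then have "l - Suc 0 \<in> {1..n}" by auto
          then show ?thesis using 2 by (simp add: face_map_def)
        next
          case 3
          then have "t l = undefined" "l \<noteq> 1" by (auto intro: PiE_arb[OF t])
          then show ?thesis using 3 by (simp add: face_map_def)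
        qed (use * in \<open>simp_all add: face_map_def\<close>)
      qed
    qed
    have "integral_simplex n (\<lambda>t. G (face_map n 0 t)) =
        simplex_integral (?I - {1}) (\<lambda>t. G (face_map n 0 (\<lambda>l\<in>{1..n}. t (?b l))))"
      unfolding integral_simplex_eq
      by (intro simplex_integral_reindex[OF _ b c, symmetric]) auto
    also have "\<dots> = simplex_integral (?I - {1}) (\<lambda>t. G (t(1 := 1 - sum t (?I - {1}))))"
      by (rule simplex_integral_cong_RR) (simp only: *)
    finally show ?thesis by (rule sym)
  qed
  finally show ?thesis .
qed

section \<open>Smooth functions of coordinates\<close>

text \<open>Otherwise the simplifier rewrites the index set \<open>{1..n}\<close> to \<open>{Suc 0..n}\<close>, and rules about \<open>RR n\<close> no longer apply.\<close>

declare One_nat_def [simp del]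

lemma sum_1_split:
  fixes h :: "nat \<Rightarrow> real"
  shows "sum h {1..k + m} = sum h {1..k} + (\<Sum>l\<in>{1..m}. h (k + l))"
proof -
  have "sum h {1..k + m} = sum h {1..k} + sum h {k + 1..k + m}"
    by (rule sum.ub_add_nat) simp
  also have "sum h {k + 1..k + m} = (\<Sum>l\<in>{1..m}. h (k + l))"
    using sum.shift_bounds_cl_nat_ivl[of h 1 k m] by (simp add: add.commute)
  finally show ?thesis .
qed

lemma topspace_RT [simp]: "topspace (RT n) = RR n"
  by (simp add: RT_def)

lemma openin_RT_subset: "openin (RT n) U \<Longrightarrow> U \<subseteq> RR n"
  using openin_subset[of "RT n" U] by simp

lemma open_line_preimage:
  assumes U: "openin (RT n) U" and v: "v \<in> RR n" and i: "i \<in> {1..n}"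
  shows "open {s. v(i := s) \<in> U}"
proof -
  have "continuous_map euclideanreal (RT n) (\<lambda>s. v(i := s))"
    unfolding RT_def using continuous_map_line[OF v i] .
  from openin_continuous_map_preimage[OF this U] show ?thesis by simp
qed

lemma eventually_line:
  assumes U: "openin (RT n) U" and v: "v \<in> U" and i: "i \<in> {1..n}"
  shows "eventually (\<lambda>s. v(i := s) \<in> U) (nhds (v i))"
  using open_line_preimage[OF U _ i, of v] v openin_RT_subset[OF U]
  by (auto simp: eventually_nhds intro!: exI[of _ "{s. v(i := s) \<in> U}"])

lemma partial_cong:
  assumes "openin (RT n) U" "v \<in> U" "i \<in> {1..n}" "\<And>w. w \<in> U \<Longrightarrow> f w = g w"
  shows "partial i f v = partial i g v"
  unfolding partial_def
  by (intro deriv_cong_ev eventually_mono[OF eventually_line[OF assms(1-3)]] assms(4) refl)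

lemma partial_eqI: "((\<lambda>s. f (v(i := s))) has_real_derivative d) (at (v i)) \<Longrightarrow> partial i f v = d"
  unfolding partial_def by (rule DERIV_imp_deriv)

lemma partial_const [simp]: "partial i (\<lambda>_. c) = (\<lambda>_. 0)"
  by (simp add: partial_def fun_eq_iff)

lemma Ck_on_Suc_intro:
  assumes "continuous_map (subtopology (RT n) U) euclideanreal f"
    and "\<And>i v. i \<in> {1..n} \<Longrightarrow> v \<in> U \<Longrightarrow> \<exists>d. ((\<lambda>s. f (v(i := s))) has_real_derivative d) (at (v i))"
    and "\<And>i. i \<in> {1..n} \<Longrightarrow> Ck_on n r U (partial i f)"
  shows "Ck_on n (Suc r) U f"
  using assms by (auto simp: real_differentiable_def)

lemma Ck_on_continuous: "Ck_on n r U f \<Longrightarrow> continuous_map (subtopology (RT n) U) euclideanreal f"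
  by (cases r) auto

lemma Ck_on_partial: "Ck_on n (Suc r) U f \<Longrightarrow> i \<in> {1..n} \<Longrightarrow> Ck_on n r U (partial i f)"
  by simp

lemma Ck_on_has_derivative:
  assumes "Ck_on n (Suc r) U f" "v \<in> U" "i \<in> {1..n}"
  shows "((\<lambda>s. f (v(i := s))) has_real_derivative partial i f v) (at (v i))"
proof -
  have "(\<lambda>s. f (v(i := s))) differentiable (at (v i))" using assms by simp
  then show ?thesis
    unfolding partial_def by (simp only: DERIV_deriv_iff_real_differentiable)
qed

text \<open>Chart expressions are formed with \<open>inv_into\<close> and carry no information off
  the chart image, so identities between them hold only there. On an open set this is enough, since
  a partial derivative depends only on values near the point.\<close>

lemma Ck_on_cong:
  assumes U: "openin (RT n) U" and "Ck_on n r U f" "\<And>v. v \<in> U \<Longrightarrow> f v = g v"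
  shows "Ck_on n r U g"
  using assms(2,3)
proof (induction r arbitrary: f g)
  case 0
  then show ?case using continuous_map_eq[of "subtopology (RT n) U" euclideanreal f g] by simp
next
  case (Suc r)
  show ?case
  proof (rule Ck_on_Suc_intro)
    show "continuous_map (subtopology (RT n) U) euclideanreal g"
      using continuous_map_eq[OF Ck_on_continuous[OF Suc.prems(1)], of g] Suc.prems(2) by simp
    fix i assume i: "i \<in> {1..n}"
    show "Ck_on n r U (partial i g)"
      by (rule Suc.IH[OF Ck_on_partial[OF Suc.prems(1) i]]) (rule partial_cong[OF U _ i Suc.prems(2)])
    fix v assume v: "v \<in> U"
    have "((\<lambda>s. g (v(i := s))) has_real_derivative partial i f v) (at (v i))"
    proof -
      have "eventually (\<lambda>s. f (v(i := s)) = g (v(i := s))) (nhds (v i))"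
        by (rule eventually_mono[OF eventually_line[OF U v i]]) (rule Suc.prems(2))
      from DERIV_cong_ev[OF refl this refl] Ck_on_has_derivative[OF Suc.prems(1) v i]
      show ?thesis by blast
    qed
    then show "\<exists>d. ((\<lambda>s. g (v(i := s))) has_real_derivative d) (at (v i))" by blast
  qed
qed

lemma Ck_on_const: "Ck_on n r U (\<lambda>_. c)"
  by (induction r arbitrary: c) auto

lemma Ck_on_lincomb:
  assumes U: "openin (RT n) U" and "Ck_on n r U f" "Ck_on n r U g"
  shows "Ck_on n r U (\<lambda>v. c * f v + g v)"
  using assms(2,3)
proof (induction r arbitrary: f g)
  case 0
  then show ?case by (auto intro!: continuous_intros continuous_map_real_mult_left)
next
  case (Suc r)
  have d: "((\<lambda>s. c * f (v(i := s)) + g (v(i := s))) has_real_derivative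
      c * partial i f v + partial i g v) (at (v i))" if "v \<in> U" "i \<in> {1..n}" for v i
    using Suc.prems that by (intro DERIV_add DERIV_cmult Ck_on_has_derivative)
  show ?case
  proof (rule Ck_on_Suc_intro)
    show "continuous_map (subtopology (RT n) U) euclideanreal (\<lambda>v. c * f v + g v)"
      using Suc.prems by (auto intro!: continuous_intros continuous_map_real_mult_left)
    fix i assume i: "i \<in> {1..n}"
    show "Ck_on n r U (partial i (\<lambda>v. c * f v + g v))"
    proof (rule Ck_on_cong[OF U])
      show "Ck_on n r U (\<lambda>v. c * partial i f v + partial i g v)"
        using Suc.prems i by (intro Suc.IH) auto
      show "c * partial i f v + partial i g v = partial i (\<lambda>v. c * f v + g v) v" if "v \<in> U" for v
        using partial_eqI[OF d[OF that i]] by simp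
    qed
    fix v assume "v \<in> U"
    then show "\<exists>x. ((\<lambda>s. c * f (v(i := s)) + g (v(i := s))) has_real_derivative x) (at (v i))"
      using d i by blast
  qed
qed

section \<open>The splitting of R^(p+n) into R^p and R^n\<close>

definition edrop :: "nat \<Rightarrow> nat \<Rightarrow> (nat \<Rightarrow> real) \<Rightarrow> nat \<Rightarrow> real" where
  "edrop p n w = (\<lambda>l\<in>{1..n}. w (p + l))"

text \<open>This is R^p x U inside R^(p+n), the shape of the chart images of \<open>Rtimes\<close>.
  As a preimage under a continuous map it is open whenever \<open>U\<close> is.\<close>

definition cylinder :: "nat \<Rightarrow> nat \<Rightarrow> (nat \<Rightarrow> real) set \<Rightarrow> (nat \<Rightarrow> real) set" where
  "cylinder p n U = {w \<in> RR (p + n). edrop p n w \<in> U}"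

lemma edrop_econcat [simp]: "v \<in> RR n \<Longrightarrow> edrop p n (econcat p n u v) = v"
  by (auto simp: edrop_def econcat_def fun_eq_iff PiE_iff extensional_def)

lemma econcat_in_RR [simp]: "econcat p n u v \<in> RR (p + n)"
  by (simp add: econcat_def)

lemma econcat_in_cylinder: "v \<in> U \<Longrightarrow> U \<subseteq> RR n \<Longrightarrow> econcat p n u v \<in> cylinder p n U"
  by (auto simp: cylinder_def)

lemma econcat_edrop: "w \<in> RR (p + n) \<Longrightarrow> econcat p n (restrict w {1..p}) (edrop p n w) = w"
  by (auto simp: edrop_def econcat_def fun_eq_iff PiE_iff extensional_def)

lemma econcat_inject:
  assumes "u \<in> RR p" "u' \<in> RR p" "v \<in> RR n" "v' \<in> RR n" "econcat p n u v = econcat p n u' v'"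
  shows "u = u' \<and> v = v'"
proof
  show "v = v'" using edrop_econcat assms by metis
  show "u = u'"
  proof
    fix l
    show "u l = u' l"
    proof (cases "l \<in> {1..p}")
      case True
      then show ?thesis using fun_cong[OF assms(5), of l] by (simp add: econcat_def)
    next
      case False
      then show ?thesis using assms(1,2) by (simp add: PiE_iff extensional_def)
    qed
  qed
qed

lemma econcat_fun_upd_snd:
  "i \<in> {1..n} \<Longrightarrow> (econcat p n u v)(p + i := s) = econcat p n u (v(i := s))"
  by (auto simp: econcat_def fun_eq_iff)

lemma econcat_fun_upd_fst:
  "i \<in> {1..p} \<Longrightarrow> (econcat p n u v)(i := s) = econcat p n (u(i := s)) v"
  by (auto simp: econcat_def fun_eq_iff)

lemma cylinder_eq_image:
  assumes "U \<subseteq> RR n"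
  shows "cylinder p n U = (\<lambda>(u, v). econcat p n u v) ` (RR p \<times> U)"
proof
  show "cylinder p n U \<subseteq> (\<lambda>(u, v). econcat p n u v) ` (RR p \<times> U)"
  proof
    fix w assume w: "w \<in> cylinder p n U"
    then have "w = econcat p n (restrict w {1..p}) (edrop p n w)"
      by (simp add: cylinder_def econcat_edrop)
    then show "w \<in> (\<lambda>(u, v). econcat p n u v) ` (RR p \<times> U)"
      using w by (intro image_eqI[of _ _ "(restrict w {1..p}, edrop p n w)"]) (auto simp: cylinder_def)
  qed
  show "(\<lambda>(u, v). econcat p n u v) ` (RR p \<times> U) \<subseteq> cylinder p n U"
    using econcat_in_cylinder[OF _ assms] by auto
qed

lemma continuous_map_RT_coord: "i \<in> {1..n} \<Longrightarrow> continuous_map (RT n) euclideanreal (\<lambda>t. t i)"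
  unfolding RT_def by (rule continuous_map_coord)

lemma continuous_map_edrop: "continuous_map (RT (p + n)) (RT n) (edrop p n)"
  unfolding RT_def
  by (subst continuous_map_componentwise)
     (auto simp: edrop_def image_subset_iff intro!: continuous_map_coord)

lemma continuous_map_econcat: "continuous_map (prod_topology (RT p) (RT n)) (RT (p + n)) (\<lambda>(u, v). econcat p n u v)"
proof -
  have "continuous_map (prod_topology (RT p) (RT n)) euclideanreal (\<lambda>(u, v). econcat p n u v l)"
    if l: "l \<in> {1..p + n}" for l
  proof (cases "l \<le> p")
    case True
    then have "continuous_map (prod_topology (RT p) (RT n)) euclideanreal (\<lambda>z. fst z l)"
      using l continuous_map_compose[OF continuous_map_fst[of "RT p" "RT n"] continuous_map_RT_coord[of l]]
      by (simp add: o_def)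
    then show ?thesis using True l by (simp add: econcat_def case_prod_unfold)
  next
    case False
    then have "l - p \<in> {1..n}" using l by auto
    from continuous_map_compose[OF continuous_map_snd continuous_map_RT_coord[OF this]]
    have "continuous_map (prod_topology (RT p) (RT n)) euclideanreal (\<lambda>z. snd z (l - p))"
      by (simp add: o_def)
    then show ?thesis using False l by (simp add: econcat_def case_prod_unfold)
  qed
  then show ?thesis
    unfolding RT_def[of "p + n"]
    by (subst continuous_map_componentwise) (auto simp: econcat_def case_prod_unfold)
qed

text \<open>The map \<open>\<phi>\<close> stands for the identity in integrals over the full simplex
  and for a face map in integrals over its faces, so both kinds of integral share one
  theory.\<close>

lemma continuous_map_econcat_cylinder:
  assumes \<phi>: "continuous_map (RT q) (RT p) \<phi>" and U: "U \<subseteq> RR n"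
  shows "continuous_map (prod_topology (RT q) (subtopology (RT n) U))
    (subtopology (RT (p + n)) (cylinder p n U)) (\<lambda>(t, v). econcat p n (\<phi> t) v)"
proof -
  have 1: "continuous_map (prod_topology (RT q) (subtopology (RT n) U)) (prod_topology (RT p) (RT n))
      (\<lambda>z. (\<phi> (fst z), snd z))"
    using continuous_map_compose[OF continuous_map_fst \<phi>, of "subtopology (RT n) U"]
      continuous_map_into_fulltopology[OF continuous_map_snd, of "RT q" "RT n" U]
    by (intro continuous_map_pairedI) (simp_all add: o_def)
  from continuous_map_compose[OF this continuous_map_econcat]
  show ?thesis
    using econcat_in_cylinder[OF _ U]
    by (auto simp: continuous_map_in_subtopology o_def case_prod_unfold)
qed

text \<open>The first \<open>p\<close> partial derivatives of such a pull-back vanish and the others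
  are again pull-backs, so the induction closes. This is what makes sections that do not depend on t
  smooth.\<close>

lemma Ck_on_edrop:
  assumes "Ck_on n r U f"
  shows "Ck_on (p + n) r (cylinder p n U) (\<lambda>w. f (edrop p n w))"
  using assms
proof (induction r arbitrary: f)
  have c: "continuous_map (subtopology (RT (p + n)) (cylinder p n U)) euclideanreal (\<lambda>w. f (edrop p n w))"
    if "continuous_map (subtopology (RT n) U) euclideanreal f" for f
  proof -
    have "continuous_map (subtopology (RT (p + n)) (cylinder p n U)) (subtopology (RT n) U) (edrop p n)"
      by (auto simp: continuous_map_in_subtopology cylinder_def
          intro: continuous_map_from_subtopology continuous_map_edrop)
    from continuous_map_compose[OF this that] show ?thesis by (simp add: o_def)
  qed
  {
    case 0
    then show ?case using c by simp
  next
    case (Suc r)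
    have e1: "edrop p n (w(i := s)) = edrop p n w" if "i \<le> p" for w i s
      using that by (auto simp: edrop_def fun_eq_iff)
    have e2: "edrop p n (w(i := s)) = (edrop p n w)(i - p := s)" "edrop p n w (i - p) = w i"
      if "i \<in> {p<..p + n}" for w i s
      using that by (auto simp: edrop_def fun_eq_iff)
    have p1: "partial i (\<lambda>w. f (edrop p n w)) = (\<lambda>_. 0)" if "i \<le> p" for i
      by (rule ext) (simp add: that partial_def e1)
    have p2: "partial i (\<lambda>w. f (edrop p n w)) = (\<lambda>w. partial (i - p) f (edrop p n w))"
      if "i \<in> {p<..p + n}" for i
      by (rule ext) (simp add: partial_def e2[OF that])
    show ?case
    proof (rule Ck_on_Suc_intro)
      show "continuous_map (subtopology (RT (p + n)) (cylinder p n U)) euclideanreal (\<lambda>w. f (edrop p n w))"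
        using c Suc.prems by simp
      fix i assume i: "i \<in> {1..p + n}"
      show "Ck_on (p + n) r (cylinder p n U) (partial i (\<lambda>w. f (edrop p n w)))"
      proof (cases "i \<le> p")
        case True
        then show ?thesis by (simp add: p1 Ck_on_const)
      next
        case False
        then have i': "i \<in> {p<..p + n}" "i - p \<in> {1..n}" using i by auto
        show ?thesis unfolding p2[OF i'(1)]
          using Suc.IH Ck_on_partial[OF Suc.prems i'(2)] by blast
      qed
      fix w assume w: "w \<in> cylinder p n U"
      show "\<exists>d. ((\<lambda>s. f (edrop p n (w(i := s)))) has_real_derivative d) (at (w i))"
      proof (cases "i \<le> p")
        case True
        then show ?thesis by (auto simp: e1 intro!: exI[of _ 0])
      next
        case False
        then have i': "i \<in> {p<..p + n}" "i - p \<in> {1..n}" using i by auto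
        have "edrop p n w \<in> U" using w by (simp add: cylinder_def)
        from Ck_on_has_derivative[OF Suc.prems this i'(2)]
        show ?thesis unfolding e2[OF i'(1)] by blast
      qed
    qed
  }
qed

text \<open>Differentiation takes place in the last \<open>n\<close> coordinates only, so
  \<open>\<phi>\<close> acts as a continuous parameter.\<close>

lemma has_derivative_integral_simplex_econcat:
  assumes \<phi>: "continuous_map (RT q) (RT p) \<phi>" and U: "openin (RT n) U"
    and g: "Ck_on (p + n) (Suc r) (cylinder p n U) g"
    and v: "v \<in> U" and i: "i \<in> {1..n}"
  shows "((\<lambda>s. integral_simplex q (\<lambda>t. g (econcat p n (\<phi> t) (v(i := s))))) has_real_derivative
    integral_simplex q (\<lambda>t. partial (p + i) g (econcat p n (\<phi> t) v))) (at (v i))"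
proof -
  have pi: "p + i \<in> {1..p + n}" using i by auto
  have UR: "U \<subseteq> RR n" by (rule openin_RT_subset[OF U])
  \<comment> \<open>The parameter is confined to the values for which the moved point stays in
    \<open>U\<close>, because \<open>g\<close> is controlled only over \<open>U\<close>.\<close>
  define J where "J = {s. v(i := s) \<in> U}"
  have J: "open J" "v i \<in> J"
    using open_line_preimage[OF U _ i, of v] v UR by (auto simp: J_def)
  note C = continuous_map_econcat_cylinder[OF \<phi> UR]
  have cg: "continuous_map (prod_topology (RT q) (subtopology (RT n) U)) euclideanreal
      (\<lambda>(t, v). h (econcat p n (\<phi> t) v))" if "Ck_on (p + n) r' (cylinder p n U) h" for h r'
    using continuous_map_compose[OF C Ck_on_continuous[OF that]] by (simp add: o_def case_prod_unfold)
  have line: "continuous_map (prod_topology (RT q) (top_of_set J)) (prod_topology (RT q) (subtopology (RT n) U))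
      (\<lambda>z. (fst z, v(i := snd z)))"
  proof (intro continuous_map_pairedI continuous_map_fst)
    have vR: "v \<in> RR n" using v UR by blast
    have "continuous_map euclideanreal (RT n) (\<lambda>s. v(i := s))"
      unfolding RT_def by (rule continuous_map_line[OF vR i])
    then have "continuous_map (top_of_set J) (subtopology (RT n) U) (\<lambda>s. v(i := s))"
      by (auto simp: continuous_map_in_subtopology J_def intro: continuous_map_from_subtopology)
    from continuous_map_compose[OF continuous_map_snd this]
    show "continuous_map (prod_topology (RT q) (top_of_set J)) (subtopology (RT n) U) (\<lambda>z. v(i := snd z))"
      by (simp add: o_def)
  qed
  have "((\<lambda>s. simplex_integral {1..q} (\<lambda>t. g (econcat p n (\<phi> t) (v(i := s))))) has_real_derivative
    simplex_integral {1..q} (\<lambda>t. partial (p + i) g (econcat p n (\<phi> t) (v(i := v i))))) (at (v i))"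
  proof (rule has_real_derivative_simplex_integral[OF _ J])
    fix s assume "s \<in> J"
    then have "v(i := s) \<in> topspace (subtopology (RT n) U)" using UR by (auto simp: J_def)
    from continuous_map_section[OF cg[OF g] this]
    show "continuous_map (coord_top {1..q}) euclideanreal (\<lambda>t. g (econcat p n (\<phi> t) (v(i := s))))"
      by (simp add: RT_def)
  next
    show "continuous_map (prod_topology (coord_top {1..q}) (top_of_set J)) euclideanreal
        (\<lambda>(t, s). partial (p + i) g (econcat p n (\<phi> t) (v(i := s))))"
      using continuous_map_compose[OF line cg[OF Ck_on_partial[OF g pi]]]
      by (simp add: o_def case_prod_unfold RT_def)
  next
    fix t s assume "s \<in> J"
    then have "econcat p n (\<phi> t) (v(i := s)) \<in> cylinder p n U"
      using UR by (intro econcat_in_cylinder) (auto simp: J_def)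
    from Ck_on_has_derivative[OF g this pi]
    show "((\<lambda>s. g (econcat p n (\<phi> t) (v(i := s)))) has_real_derivative
        partial (p + i) g (econcat p n (\<phi> t) (v(i := s)))) (at s)"
      using i by (simp add: econcat_fun_upd_snd) (simp add: econcat_def)
  qed simp
  then show ?thesis by (simp add: integral_simplex_eq)
qed

text \<open>Each partial derivative is again an integral of the same shape, with an integrand of one
  order of differentiability less; this drives the induction on \<open>r\<close>.\<close>

lemma Ck_on_integral_simplex_econcat:
  assumes \<phi>: "continuous_map (RT q) (RT p) \<phi>" and U: "openin (RT n) U"
    and g: "Ck_on (p + n) r (cylinder p n U) g"
  shows "Ck_on n r U (\<lambda>v. integral_simplex q (\<lambda>t. g (econcat p n (\<phi> t) v)))"
  using g
proof (induction r arbitrary: g)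
  have UR: "U \<subseteq> RR n" by (rule openin_RT_subset[OF U])
  note C = continuous_map_econcat_cylinder[OF \<phi> UR]
  have c: "continuous_map (subtopology (RT n) U) euclideanreal
      (\<lambda>v. integral_simplex q (\<lambda>t. g (econcat p n (\<phi> t) v)))"
    if "Ck_on (p + n) r' (cylinder p n U) g" for g r'
  proof -
    have "continuous_map (prod_topology (coord_top {1..q}) (subtopology (RT n) U)) euclideanreal
        (\<lambda>(t, v). g (econcat p n (\<phi> t) v))"
      using continuous_map_compose[OF C Ck_on_continuous[OF that]]
      by (simp add: o_def case_prod_unfold RT_def)
    from continuous_map_simplex_integral[OF _ this] show ?thesis
      by (simp add: integral_simplex_eq)
  qed
  {
    case 0
    then show ?case using c by (metis Ck_on.simps(1))
  next
    case (Suc r)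
    note d = has_derivative_integral_simplex_econcat[OF \<phi> U Suc.prems]
    show ?case
    proof (rule Ck_on_Suc_intro)
      fix i assume i: "i \<in> {1..n}"
      then have pi: "p + i \<in> {1..p + n}" by auto
      show "Ck_on n r U (partial i (\<lambda>v. integral_simplex q (\<lambda>t. g (econcat p n (\<phi> t) v))))"
        by (rule Ck_on_cong[OF U Suc.IH[OF Ck_on_partial[OF Suc.prems pi]]])
           (rule partial_eqI[OF d[OF _ i], symmetric])
    qed (use c[OF Suc.prems] d in blast)+
  }
qed

section \<open>Smooth functions on the product of a coordinate space and a manifold\<close>

lemma smooth_manifold_chart:
  assumes "smooth_manifold M" "i \<in> charts M"
  shows "cdom M i \<subseteq> pts M" "openin (mtop M) (cdom M i)"
    "openin (RT (mdim M)) (chart M i ` cdom M i)" "inj_on (chart M i) (cdom M i)"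
    "\<And>x. x \<in> cdom M i \<Longrightarrow> chart M i x \<in> RR (mdim M)"
    "\<And>W. openin (mtop M) W \<Longrightarrow> openin (RT (mdim M)) (chart M i ` (cdom M i \<inter> W))"
proof -
  have o: "openin (mtop M) (cdom M i)" and o': "openin (RT (mdim M)) (chart M i ` cdom M i)"
    and h: "homeomorphic_map (subtopology (mtop M) (cdom M i))
          (subtopology (RT (mdim M)) (chart M i ` cdom M i)) (chart M i)"
    using assms by (auto simp: smooth_manifold_def)
  show sub: "cdom M i \<subseteq> pts M" using o openin_subset by blast
  show "openin (mtop M) (cdom M i)" "openin (RT (mdim M)) (chart M i ` cdom M i)" by fact+
  show "inj_on (chart M i) (cdom M i)"
    using homeomorphic_imp_injective_map[OF h] sub by (simp add: Int_absorb1)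
  show "\<And>x. x \<in> cdom M i \<Longrightarrow> chart M i x \<in> RR (mdim M)"
    using openin_RT_subset[OF o'] by blast
  fix W assume W: "openin (mtop M) W"
  have "openin (subtopology (mtop M) (cdom M i)) (cdom M i \<inter> W)"
    using W by (metis Int_commute openin_subtopology)
  then have "openin (subtopology (RT (mdim M)) (chart M i ` cdom M i)) (chart M i ` (cdom M i \<inter> W))"
    using homeomorphic_imp_open_map[OF h] by (simp add: open_map_def)
  then show "openin (RT (mdim M)) (chart M i ` (cdom M i \<inter> W))"
    using o' openin_trans_full by blast
qed

lemma charts_at_nonempty:
  assumes "smooth_manifold M" "x \<in> pts M"
  shows "(SOME i. i \<in> charts_at M x) \<in> charts_at M x"
proof -
  have "x \<in> (\<Union>i\<in>charts M. cdom M i)" using assms by (simp add: smooth_manifold_def)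
  then have "\<exists>i. i \<in> charts_at M x" by (auto simp: charts_at_def)
  then show ?thesis by (rule someI_ex)
qed

lemma in_chart_apply:
  assumes "smooth_manifold M" "i \<in> charts M" "x \<in> cdom M i"
  shows "in_chart M i f (chart M i x) = f x"
  using smooth_manifold_chart(4)[OF assms(1,2)] assms(3) by (simp add: in_chart_def)

section \<open>Charts of the product manifold\<close>

lemma pts_Rtimes [simp]: "pts (Rtimes p M) = RR p \<times> pts M"
  by (simp add: Rtimes_def)

lemma mdim_Rtimes [simp]: "mdim (Rtimes p M) = p + mdim M"
  by (simp add: Rtimes_def)

lemma charts_Rtimes [simp]: "charts (Rtimes p M) = charts M"
  by (simp add: Rtimes_def)

lemma charts_at_Rtimes [simp]: "t \<in> RR p \<Longrightarrow> charts_at (Rtimes p M) (t, x) = charts_at M x"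
  by (simp add: charts_at_def Rtimes_def)

lemma chart_Rtimes [simp]: "chart (Rtimes p M) i (t, x) = econcat p (mdim M) t (chart M i x)"
  by (simp add: Rtimes_def)

lemma cdom_Rtimes [simp]: "cdom (Rtimes p M) i = RR p \<times> cdom M i"
  by (simp add: Rtimes_def)

lemma chart_image_Rtimes:
  assumes "smooth_manifold M" "i \<in> charts M"
  shows "chart (Rtimes p M) i ` (cdom (Rtimes p M) i \<inter> RR p \<times> W) =
    cylinder p (mdim M) (chart M i ` (cdom M i \<inter> W))"
proof -
  have "chart M i ` (cdom M i \<inter> W) \<subseteq> RR (mdim M)"
    using smooth_manifold_chart(5)[OF assms] by blast
  from cylinder_eq_image[OF this, of p] show ?thesis
    by (auto simp: Rtimes_def image_iff)
qed

lemma in_chart_Rtimes: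
  assumes "smooth_manifold M" "i \<in> charts M" "t \<in> RR p" "x \<in> cdom M i"
  shows "in_chart (Rtimes p M) i F (econcat p (mdim M) t (chart M i x)) = F (t, x)"
proof -
  have "inj_on (chart (Rtimes p M) i) (cdom (Rtimes p M) i)"
  proof (rule inj_onI, clarsimp)
    fix t t' x x'
    assume t: "t \<in> RR p" "t' \<in> RR p" and x: "x \<in> cdom M i" "x' \<in> cdom M i"
      and eq: "econcat p (mdim M) t (chart M i x) = econcat p (mdim M) t' (chart M i x')"
    have "t = t' \<and> chart M i x = chart M i x'"
      by (rule econcat_inject[OF t _ _ eq]) (rule smooth_manifold_chart(5)[OF assms(1,2)] x)+
    then show "t = t' \<and> x = x'"
      using inj_onD[OF smooth_manifold_chart(4)[OF assms(1,2)] _ x] by blast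
  qed
  then have "inv_into (cdom (Rtimes p M) i) (chart (Rtimes p M) i) (chart (Rtimes p M) i (t, x)) = (t, x)"
    using assms by (intro inv_into_f_f) auto
  then show ?thesis by (simp add: in_chart_def)
qed

lemma smooth_fun_on_RtimesD:
  assumes M: "smooth_manifold M" and i: "i \<in> charts M" and F: "F \<in> C_inf (Rtimes p M)"
  shows "Ck_on (p + mdim M) r (cylinder p (mdim M) (chart M i ` cdom M i)) (in_chart (Rtimes p M) i F)"
proof -
  have "smooth_on (p + mdim M) (chart (Rtimes p M) i ` (cdom (Rtimes p M) i \<inter> RR p \<times> pts M))
      (in_chart (Rtimes p M) i F)"
    using F i by (auto simp: C_inf_def smooth_fun_on_def)
  then show ?thesis
    unfolding chart_image_Rtimes[OF M i] smooth_on_def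
    using smooth_manifold_chart(1)[OF M i] by (simp add: Int_absorb2)
qed

section \<open>Smooth functions and their integrals along the simplex\<close>

lemma C_inf_zero_off: "f \<in> C_inf M \<Longrightarrow> x \<notin> pts M \<Longrightarrow> f x = 0"
  by (simp add: C_inf_def)

lemma zero_in_C_inf: "(\<lambda>_. 0) \<in> C_inf M"
  by (auto simp: C_inf_def smooth_fun_on_def smooth_on_def in_chart_def o_def Ck_on_const)

lemma smooth_fun_on_lincomb:
  assumes M: "smooth_manifold M" and W: "openin (mtop M) W"
    and "smooth_fun_on M W f" "smooth_fun_on M W g"
  shows "smooth_fun_on M W (\<lambda>x. c * f x + g x)"
proof -
  have "Ck_on (mdim M) r (chart M i ` (cdom M i \<inter> W)) (in_chart M i (\<lambda>x. c * f x + g x))"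
    if i: "i \<in> charts M" for i r
    using Ck_on_lincomb[OF smooth_manifold_chart(6)[OF M i W], of r "in_chart M i f" "in_chart M i g" c]
      assms(3,4) i
    by (simp add: smooth_fun_on_def smooth_on_def in_chart_def o_def)
  then show ?thesis by (simp add: smooth_fun_on_def smooth_on_def)
qed

lemma C_inf_lincomb:
  assumes "smooth_manifold M" "f \<in> C_inf M" "g \<in> C_inf M"
  shows "(\<lambda>x. c * f x + g x) \<in> C_inf M"
  using assms smooth_fun_on_lincomb[OF assms(1) openin_topspace] by (simp add: C_inf_def)

lemma C_inf_sum:
  assumes M: "smooth_manifold M" and "finite K" "\<And>k. k \<in> K \<Longrightarrow> f k \<in> C_inf M"
  shows "(\<lambda>x. \<Sum>k\<in>K. c k * f k x) \<in> C_inf M"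
  using assms(2,3)
proof (induction K rule: finite_induct)
  case (insert k K)
  then show ?case using C_inf_lincomb[OF M, of "f k" "\<lambda>x. \<Sum>k\<in>K. c k * f k x" "c k"] by simp
qed (simp add: zero_in_C_inf)

text \<open>The factor R^p has a single chart, so one chart of \<open>M\<close> around x serves all
  values of t at once, and passing to coordinates commutes with the integral.\<close>

lemma in_chart_integral_simplex:
  assumes M: "smooth_manifold M" and i: "i \<in> charts M" and \<phi>: "continuous_map (RT q) (RT p) \<phi>"
    and v: "v \<in> chart M i ` cdom M i"
  shows "in_chart M i (\<lambda>x. integral_simplex q (\<lambda>t. F (\<phi> t, x))) v =
    integral_simplex q (\<lambda>t. in_chart (Rtimes p M) i F (econcat p (mdim M) (\<phi> t) v))"
proof -
  obtain x where x: "x \<in> cdom M i" "v = chart M i x" using v by blast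
  have "\<phi> t \<in> RR p" if "t \<in> simplex_on {1..q}" for t
    using \<phi> that by (auto simp: continuous_map_def simplex_on_def)
  then show ?thesis
    unfolding x(2) in_chart_apply[OF M i x(1)] integral_simplex_eq
    using x(1) by (intro simplex_integral_cong) (simp add: in_chart_Rtimes[OF M i])
qed

lemma C_inf_integral_simplex:
  assumes M: "smooth_manifold M" and \<phi>: "continuous_map (RT q) (RT p) \<phi>" and F: "F \<in> C_inf (Rtimes p M)"
  shows "(\<lambda>x. integral_simplex q (\<lambda>t. F (\<phi> t, x))) \<in> C_inf M"
proof -
  have "Ck_on (mdim M) r (chart M i ` cdom M i) (in_chart M i (\<lambda>x. integral_simplex q (\<lambda>t. F (\<phi> t, x))))"
    if i: "i \<in> charts M" for i r
    by (rule Ck_on_cong[OF smooth_manifold_chart(3)[OF M i]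
          Ck_on_integral_simplex_econcat[OF \<phi> smooth_manifold_chart(3)[OF M i] smooth_fun_on_RtimesD[OF M i F]]])
       (rule in_chart_integral_simplex[OF M i \<phi>, symmetric])
  moreover have "F (t, x) = 0" if "x \<notin> pts M" for t x
    using C_inf_zero_off[OF F, of "(t, x)"] that by simp
  ultimately show ?thesis
    using smooth_manifold_chart(1)[OF M]
    by (simp add: C_inf_def smooth_fun_on_def smooth_on_def integral_simplex_eq Int_absorb2)
qed

text \<open>\<open>tangent_apply\<close> computes in a chart picked by \<open>SOME\<close>. The
  charts at (t, x) and those at x have the same index set, so the same index is picked for both and
  the coordinates can be compared directly.\<close>

lemma tangent_apply_Rtimes:
  assumes M: "smooth_manifold M" and x: "x \<in> pts M" and t: "t \<in> RR p"
    and i: "i = (SOME i. i \<in> charts_at M x)"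
  shows "tangent_apply (Rtimes p M) (t, x) (\<lambda>i\<in>charts_at M x. econcat p (mdim M) a (u i)) F =
    (\<Sum>m\<in>{1..p}. a m * partial m (in_chart (Rtimes p M) i F) (econcat p (mdim M) t (chart M i x))) +
    (\<Sum>m\<in>{1..mdim M}. u i m * partial (p + m) (in_chart (Rtimes p M) i F) (econcat p (mdim M) t (chart M i x)))"
proof -
  have i_in: "i \<in> charts_at M x" unfolding i by (rule charts_at_nonempty[OF M x])
  let ?h = "\<lambda>m. econcat p (mdim M) a (u i) m *
      partial m (in_chart (Rtimes p M) i F) (econcat p (mdim M) t (chart M i x))"
  have "tangent_apply (Rtimes p M) (t, x) (\<lambda>i\<in>charts_at M x. econcat p (mdim M) a (u i)) F = sum ?h {1..p + mdim M}"
    using i_in t by (simp add: tangent_apply_def i[symmetric])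
  also have "\<dots> = sum ?h {1..p} + (\<Sum>m\<in>{1..mdim M}. ?h (p + m))"
    by (rule sum_1_split)
  also have "(\<Sum>m\<in>{1..mdim M}. ?h (p + m)) = (\<Sum>m\<in>{1..mdim M}. u i m *
      partial (p + m) (in_chart (Rtimes p M) i F) (econcat p (mdim M) t (chart M i x)))"
    by (intro sum.cong refl arg_cong2[where f = "(*)"]) (simp add: econcat_def)
  also have "sum ?h {1..p} = (\<Sum>m\<in>{1..p}. a m *
      partial m (in_chart (Rtimes p M) i F) (econcat p (mdim M) t (chart M i x)))"
    by (intro sum.cong refl arg_cong2[where f = "(*)"]) (simp add: econcat_def)
  finally show ?thesis .
qed

lemma continuous_map_vertical:
  assumes M: "smooth_manifold M" and i: "i \<in> charts M" and x: "x \<in> cdom M i"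
    and \<phi>: "continuous_map (RT q) (RT p) \<phi>"
    and g: "Ck_on (p + mdim M) r (cylinder p (mdim M) (chart M i ` cdom M i)) g"
  shows "continuous_map (RT q) euclideanreal (\<lambda>t. g (econcat p (mdim M) (\<phi> t) (chart M i x)))"
proof -
  have "chart M i ` cdom M i \<subseteq> RR (mdim M)" using smooth_manifold_chart(5)[OF M i] by blast
  from continuous_map_compose[OF continuous_map_econcat_cylinder[OF \<phi> this] Ck_on_continuous[OF g]]
  have "continuous_map (prod_topology (RT q) (subtopology (RT (mdim M)) (chart M i ` cdom M i))) euclideanreal
      (\<lambda>(t, v). g (econcat p (mdim M) (\<phi> t) v))"
    by (simp add: o_def case_prod_unfold)
  from continuous_map_section[OF this, of "chart M i x"] show ?thesis
    using x smooth_manifold_chart(5)[OF M i x] by simp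
qed

lemma continuous_map_C_inf_vertical:
  assumes M: "smooth_manifold M" and F: "F \<in> C_inf (Rtimes p M)" and \<phi>: "continuous_map (RT q) (RT p) \<phi>"
  shows "continuous_map (RT q) euclideanreal (\<lambda>t. F (\<phi> t, x))"
proof (cases "x \<in> pts M")
  case True
  define i where "i = (SOME i. i \<in> charts_at M x)"
  have i: "i \<in> charts M" "x \<in> cdom M i"
    using charts_at_nonempty[OF M True] by (auto simp: i_def charts_at_def)
  have "continuous_map (RT q) euclideanreal
      (\<lambda>t. in_chart (Rtimes p M) i F (econcat p (mdim M) (\<phi> t) (chart M i x)))"
    by (rule continuous_map_vertical[OF M i \<phi> smooth_fun_on_RtimesD[OF M i(1) F, of 0]])
  moreover have "\<phi> t \<in> RR p" if "t \<in> RR q" for t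
    using \<phi> that by (auto simp: continuous_map_def)
  ultimately show ?thesis
    by (elim continuous_map_eq) (use i in_chart_Rtimes[OF M i(1) _ i(2)] in auto)
next
  case False
  then have "F (t, x) = 0" for t using C_inf_zero_off[OF F, of "(t, x)"] by simp
  then show ?thesis by simp
qed

text \<open>Identifies the action of a coordinate field, computed through a chart of
  \<open>M\<close>, with an ordinary partial derivative in t. The chart does not vary with t, which
  also yields continuity of \<open>D\<close>.\<close>

lemma vertical_derivative:
  assumes M: "smooth_manifold M" and F: "F \<in> C_inf (Rtimes p M)" and x: "x \<in> pts M" and j: "j \<in> {1..p}"
  defines "D \<equiv> \<lambda>t. tangent_apply (Rtimes p M) (t, x)
    (\<lambda>i\<in>charts_at M x. econcat p (mdim M) (eunit p j) (ezero (mdim M))) F"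
  shows "t \<in> RR p \<Longrightarrow> ((\<lambda>s. F (t(j := s), x)) has_real_derivative D t) (at (t j))"
    and "continuous_map (RT p) euclideanreal D"
proof -
  define i where "i = (SOME i. i \<in> charts_at M x)"
  have i: "i \<in> charts M" "x \<in> cdom M i"
    using charts_at_nonempty[OF M x] by (auto simp: i_def charts_at_def)
  let ?g = "in_chart (Rtimes p M) i F"
  have j': "j \<in> {1..p + mdim M}" using j by auto
  have D: "D t = partial j ?g (econcat p (mdim M) t (chart M i x))" if "t \<in> RR p" for t
  proof -
    have "(\<Sum>m\<in>{1..p}. eunit p j m * h m) = (\<Sum>m\<in>{1..p}. if m = j then h m else 0)" for h
      by (intro sum.cong) (auto simp: eunit_def)
    moreover have "(\<Sum>m\<in>{1..n}. ezero n m * h m) = 0" for n h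
      by (intro sum.neutral) (simp add: ezero_def)
    ultimately show ?thesis
      unfolding D_def tangent_apply_Rtimes[OF M x that i_def] using j by simp
  qed
  \<comment> \<open>One order of differentiability provides the derivative, and the remaining order
    0 provides its continuity.\<close>
  note g = smooth_fun_on_RtimesD[OF M i(1) F, of "Suc 0"]
  show "((\<lambda>s. F (t(j := s), x)) has_real_derivative D t) (at (t j))" if t: "t \<in> RR p"
  proof -
    have "econcat p (mdim M) t (chart M i x) \<in> cylinder p (mdim M) (chart M i ` cdom M i)"
      using i smooth_manifold_chart(5)[OF M i(1)] by (intro econcat_in_cylinder) auto
    from Ck_on_has_derivative[OF g this j']
    have "((\<lambda>s. ?g (econcat p (mdim M) (t(j := s)) (chart M i x))) has_real_derivative D t) (at (t j))"
      using j t by (simp add: econcat_fun_upd_fst D) (simp add: econcat_def)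
    moreover have "t(j := s) \<in> RR p" for s using t j by (auto simp: PiE_iff extensional_def)
    ultimately show ?thesis by (simp add: in_chart_Rtimes[OF M i(1) _ i(2)])
  qed
  show "continuous_map (RT p) euclideanreal D"
    using continuous_map_vertical[OF M i continuous_map_id Ck_on_partial[OF g j']]
    by (elim continuous_map_eq) (simp add: D)
qed

text \<open>A vector with zero component along R^p differentiates only in the chart coordinates of
  \<open>M\<close>, so its action can be exchanged with the integral over t. This is what matches
  the anchor terms of the two differentials.\<close>

lemma tangent_apply_integral_simplex:
  assumes M: "smooth_manifold M" and F: "F \<in> C_inf (Rtimes p M)" and x: "x \<in> pts M"
  shows "tangent_apply M x u (\<lambda>y. integral_simplex p (\<lambda>t. F (t, y))) =
    integral_simplex p (\<lambda>t. tangent_apply (Rtimes p M) (t, x)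
      (\<lambda>i\<in>charts_at M x. econcat p (mdim M) (ezero p) (u i)) F)"
    and "continuous_map (RT p) euclideanreal (\<lambda>t. tangent_apply (Rtimes p M) (t, x)
      (\<lambda>i\<in>charts_at M x. econcat p (mdim M) (ezero p) (u i)) F)"
proof -
  define i where "i = (SOME i. i \<in> charts_at M x)"
  have i: "i \<in> charts M" "x \<in> cdom M i"
    using charts_at_nonempty[OF M x] by (auto simp: i_def charts_at_def)
  let ?g = "in_chart (Rtimes p M) i F" and ?v = "chart M i x"
  note g = smooth_fun_on_RtimesD[OF M i(1) F, of "Suc 0"]
  note U = smooth_manifold_chart(3)[OF M i(1)]
  have v: "?v \<in> chart M i ` cdom M i" using i by blast
  have id: "continuous_map (RT p) (RT p) (\<lambda>t. t)" using continuous_map_id by (simp add: id_def)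
  let ?T = "\<lambda>t. tangent_apply (Rtimes p M) (t, x)
      (\<lambda>i\<in>charts_at M x. econcat p (mdim M) (ezero p) (u i)) F"
  have T: "?T t = (\<Sum>m\<in>{1..mdim M}. u i m * partial (p + m) ?g (econcat p (mdim M) t ?v))"
    if "t \<in> RR p" for t
    unfolding tangent_apply_Rtimes[OF M x that i_def] by (simp add: ezero_def)
  have c: "continuous_map (RT p) euclideanreal (\<lambda>t. u i m * partial (p + m) ?g (econcat p (mdim M) t ?v))"
    if m: "m \<in> {1..mdim M}" for m
  proof -
    have "p + m \<in> {1..p + mdim M}" using m by auto
    from continuous_map_vertical[OF M i id Ck_on_partial[OF g this]]
    show ?thesis by (rule continuous_map_real_mult_left)
  qed
  have "continuous_map (RT p) euclideanreal
      (\<lambda>t. \<Sum>m\<in>{1..mdim M}. u i m * partial (p + m) ?g (econcat p (mdim M) t ?v))"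
    using c by (intro continuous_map_sum) auto
  then show "continuous_map (RT p) euclideanreal ?T"
    by (elim continuous_map_eq) (simp add: T)
  have "partial m (in_chart M i (\<lambda>y. integral_simplex p (\<lambda>t. F (t, y)))) ?v =
      integral_simplex p (\<lambda>t. partial (p + m) ?g (econcat p (mdim M) t ?v))" if m: "m \<in> {1..mdim M}" for m
  proof -
    have "partial m (in_chart M i (\<lambda>y. integral_simplex p (\<lambda>t. F (t, y)))) ?v =
        partial m (\<lambda>v. integral_simplex p (\<lambda>t. ?g (econcat p (mdim M) t v))) ?v"
      by (rule partial_cong[OF U v m in_chart_integral_simplex[OF M i(1) id]])
    also have "\<dots> = integral_simplex p (\<lambda>t. partial (p + m) ?g (econcat p (mdim M) t ?v))"
      by (rule partial_eqI[OF has_derivative_integral_simplex_econcat[OF id U g v m]])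
    finally show ?thesis .
  qed
  then have "tangent_apply M x u (\<lambda>y. integral_simplex p (\<lambda>t. F (t, y))) =
      (\<Sum>m\<in>{1..mdim M}. u i m * integral_simplex p (\<lambda>t. partial (p + m) ?g (econcat p (mdim M) t ?v)))"
    by (simp add: tangent_apply_def i_def[symmetric])
  also have "\<dots> = integral_simplex p (\<lambda>t. \<Sum>m\<in>{1..mdim M}. u i m * partial (p + m) ?g (econcat p (mdim M) t ?v))"
    unfolding integral_simplex_eq using c
    by (subst simplex_integral_sum) (simp_all add: RT_def simplex_integral_cmult)
  also have "\<dots> = integral_simplex p ?T"
    unfolding integral_simplex_eq by (rule simplex_integral_cong_RR) (simp add: T)
  finally show "tangent_apply M x u (\<lambda>y. integral_simplex p (\<lambda>t. F (t, y))) = integral_simplex p ?T" .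
qed

section \<open>Sections and brackets of the product Lie algebroid\<close>

lemma openin_cylinder: "openin (RT n) U \<Longrightarrow> openin (RT (p + n)) (cylinder p n U)"
  using openin_continuous_map_preimage[OF continuous_map_edrop] by (simp add: cylinder_def)

lemma smooth_fun_on_const: "smooth_fun_on M W (\<lambda>_. c)"
  by (simp add: smooth_fun_on_def smooth_on_def in_chart_def o_def Ck_on_const)

lemma smooth_fun_on_cong:
  assumes M: "smooth_manifold M" and W: "openin (mtop M) W"
    and f: "smooth_fun_on M W f" and eq: "\<And>x. x \<in> W \<Longrightarrow> f x = g x"
  shows "smooth_fun_on M W g"
  unfolding smooth_fun_on_def smooth_on_def
proof (intro ballI allI)
  fix i r assume i: "i \<in> charts M"
  have "Ck_on (mdim M) r (chart M i ` (cdom M i \<inter> W)) (in_chart M i f)"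
    using f i by (simp add: smooth_fun_on_def smooth_on_def)
  then show "Ck_on (mdim M) r (chart M i ` (cdom M i \<inter> W)) (in_chart M i g)"
    by (rule Ck_on_cong[OF smooth_manifold_chart(6)[OF M i W]])
       (auto simp: in_chart_apply[OF M i] eq)
qed

lemma smooth_fun_on_Rtimes:
  assumes M: "smooth_manifold M" and W: "openin (mtop M) W"
    and f: "smooth_fun_on M W f" and eq: "\<And>t x. t \<in> RR p \<Longrightarrow> x \<in> W \<Longrightarrow> F (t, x) = f x"
  shows "smooth_fun_on (Rtimes p M) (RR p \<times> W) F"
  unfolding smooth_fun_on_def smooth_on_def mdim_Rtimes charts_Rtimes
proof (intro ballI allI)
  fix i r assume i: "i \<in> charts M"
  let ?U = "chart M i ` (cdom M i \<inter> W)"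
  have U: "openin (RT (mdim M)) ?U" by (rule smooth_manifold_chart(6)[OF M i W])
  have "Ck_on (mdim M) r ?U (in_chart M i f)"
    using f i by (simp add: smooth_fun_on_def smooth_on_def)
  from Ck_on_edrop[OF this]
  have "Ck_on (p + mdim M) r (cylinder p (mdim M) ?U) (\<lambda>w. in_chart M i f (edrop p (mdim M) w))" .
  then have "Ck_on (p + mdim M) r (cylinder p (mdim M) ?U) (in_chart (Rtimes p M) i F)"
  proof (rule Ck_on_cong[OF openin_cylinder[OF U]])
    fix w assume "w \<in> cylinder p (mdim M) ?U"
    then obtain t x where w: "t \<in> RR p" "x \<in> cdom M i" "x \<in> W" "w = econcat p (mdim M) t (chart M i x)"
      unfolding cylinder_eq_image[OF openin_RT_subset[OF U]] by auto
    show "in_chart M i f (edrop p (mdim M) w) = in_chart (Rtimes p M) i F w"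
      using w smooth_manifold_chart(5)[OF M i w(2)]
      by (simp add: in_chart_Rtimes[OF M i] in_chart_apply[OF M i] eq)
  qed
  then show "Ck_on (p + mdim M) r (chart (Rtimes p M) i ` (cdom (Rtimes p M) i \<inter> RR p \<times> W))
      (in_chart (Rtimes p M) i F)"
    unfolding chart_image_Rtimes[OF M i] .
qed

text \<open>Constancy is asked for only on the carrier, since the components of an extensional
  section are unspecified off it.\<close>

lemma tangent_apply_const:
  assumes M: "smooth_manifold M" and x: "x \<in> pts M" and f: "\<And>y. y \<in> pts M \<Longrightarrow> f y = c"
  shows "tangent_apply M x v f = 0"
proof -
  define i where "i = (SOME i. i \<in> charts_at M x)"
  have i: "i \<in> charts M" "x \<in> cdom M i"
    using charts_at_nonempty[OF M x] by (auto simp: i_def charts_at_def)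
  have "in_chart M i f w = c" if "w \<in> chart M i ` cdom M i" for w
    using that smooth_manifold_chart(1)[OF M i(1)] by (auto simp: in_chart_apply[OF M i(1)] f)
  then have "partial m (in_chart M i f) (chart M i x) = 0" if "m \<in> {1..mdim M}" for m
    using partial_cong[OF smooth_manifold_chart(3)[OF M i(1)] _ that, of "chart M i x" "in_chart M i f" "\<lambda>_. c"] i
    by simp
  then show ?thesis by (simp add: tangent_apply_def i_def[symmetric])
qed

lemma dir_deriv_const:
  assumes "t \<in> RR k" "\<And>s. s \<in> RR k \<Longrightarrow> f s = c"
  shows "dir_deriv k f t u = 0"
proof -
  have "partial m f t = 0" if "m \<in> {1..k}" for m
  proof -
    have "t(m := r) \<in> RR k" for r using that assms(1) by (auto simp: PiE_iff extensional_def)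
    then show ?thesis by (simp add: partial_def assms(2))
  qed
  then show ?thesis by (simp add: dir_deriv_def)
qed

lemma eadd_ezero [simp]: "v \<in> RR n \<Longrightarrow> eadd n v (ezero n) = v" "v \<in> RR n \<Longrightarrow> eadd n (ezero n) v = v"
  by (auto simp: eadd_def ezero_def fun_eq_iff PiE_iff extensional_def)

lemma escale_simps [simp]: "escale n c (ezero n) = ezero n" "escale n 0 v = ezero n"
  by (auto simp: escale_def ezero_def fun_eq_iff)

lemma evec_in_RR [simp]: "ezero n \<in> RR n" "eunit n i \<in> RR n" "eadd n u v \<in> RR n" "escale n c u \<in> RR n"
  by (simp_all add: ezero_def eunit_def eadd_def escale_def)

lemma TR_times_sel [simp]:
  "base (TR_times k A) = Rtimes k (base A)"
  "rank (TR_times k A) = k + rank A"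
  "fib (TR_times k A) (t, x) = RR k \<times> fib A x"
  "vadd (TR_times k A) (t, x) (u, e) (u', e') = (eadd k u u', vadd A x e e')"
  "vscale (TR_times k A) (t, x) c (u, e) = (escale k c u, vscale A x c e)"
  "vzero (TR_times k A) (t, x) = (ezero k, vzero A x)"
  "trivs (TR_times k A) = trivs A"
  "tdom (TR_times k A) j = RR k \<times> tdom A j"
  "triv (TR_times k A) j (t, x) (u, e) = econcat k (rank A) u (triv A j x e)"
  "anchor (TR_times k A) (t, x) (u, e) =
     (\<lambda>i\<in>charts_at (base A) x. econcat k (mdim (base A)) u (anchor A x e i))"
  by (simp_all add: TR_times_def)

text \<open>The common form of \<open>const_sec\<close>, where \<open>a\<close> is the zero section,
  and \<open>lift_sec\<close>, where \<open>u\<close> is zero; a single bracket computation then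
  covers all pairs of them.\<close>

definition prod_sec ::
    "nat \<Rightarrow> ('m, 'i, 'e, 'j) algebroid \<Rightarrow> (nat \<Rightarrow> real) \<Rightarrow> ('m \<Rightarrow> 'e) \<Rightarrow> (nat \<Rightarrow> real) \<times> 'm \<Rightarrow> (nat \<Rightarrow> real) \<times> 'e"
  where "prod_sec k A u a = (\<lambda>(t, x)\<in>pts (Rtimes k (base A)). (u, a x))"

lemma prod_sec_apply [simp]: "t \<in> RR k \<Longrightarrow> x \<in> pts (base A) \<Longrightarrow> prod_sec k A u a (t, x) = (u, a x)"
  by (simp add: prod_sec_def)

lemma const_sec_eq: "const_sec k A u = prod_sec k A u (sec_zero A)"
  by (auto simp: const_sec_def prod_sec_def sec_zero_def fun_eq_iff)

lemma lift_sec_eq: "lift_sec k A = prod_sec k A (ezero k)"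
  by (auto simp: lift_sec_def prod_sec_def fun_eq_iff)

context
  fixes A :: "('m, 'i, 'e, 'j) algebroid"
  assumes A: "lie_algebroid A"
begin

lemma vector_bundle_A: "vector_bundle A"
  using A by (simp add: lie_algebroid_def)

lemma smooth_base: "smooth_manifold (base A)"
  using vector_bundle_A by (simp add: vector_bundle_def)

lemma fib_closed:
  assumes "x \<in> pts (base A)"
  shows "vzero A x \<in> fib A x" "u \<in> fib A x \<Longrightarrow> v \<in> fib A x \<Longrightarrow> vadd A x u v \<in> fib A x"
    "u \<in> fib A x \<Longrightarrow> vscale A x c u \<in> fib A x"
  using assms vector_bundle_A by (simp_all add: vector_bundle_def)

lemma tdom_exists: "x \<in> pts (base A) \<Longrightarrow> \<exists>j\<in>trivs A. x \<in> tdom A j"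
  using vector_bundle_A by (auto simp: vector_bundle_def)

lemma tdom_open: "j \<in> trivs A \<Longrightarrow> openin (mtop (base A)) (tdom A j)"
  using vector_bundle_A by (simp add: vector_bundle_def)

lemma triv_simps:
  assumes "j \<in> trivs A" "x \<in> tdom A j"
  shows "bij_betw (triv A j x) (fib A x) (RR (rank A))"
    "triv A j x (vzero A x) = ezero (rank A)"
    "u \<in> fib A x \<Longrightarrow> v \<in> fib A x \<Longrightarrow> triv A j x (vadd A x u v) = eadd (rank A) (triv A j x u) (triv A j x v)"
    "u \<in> fib A x \<Longrightarrow> triv A j x (vscale A x c u) = escale (rank A) c (triv A j x u)"
  using assms vector_bundle_A by (simp_all add: vector_bundle_def)

lemma triv_in_RR: "j \<in> trivs A \<Longrightarrow> x \<in> tdom A j \<Longrightarrow> u \<in> fib A x \<Longrightarrow> triv A j x u \<in> RR (rank A)"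
  by (rule bij_betw_apply[OF triv_simps(1)])

lemma triv_eqD:
  "j \<in> trivs A \<Longrightarrow> x \<in> tdom A j \<Longrightarrow> u \<in> fib A x \<Longrightarrow> v \<in> fib A x \<Longrightarrow> triv A j x u = triv A j x v \<Longrightarrow> u = v"
  by (rule inj_onD[OF bij_betw_imp_inj_on[OF triv_simps(1)]])

text \<open>The vector space laws of a fibre are not axioms of the bundle. Each one is pulled back
  from R^r along a local trivialisation, which is linear and injective on the fibre.\<close>

lemma fib_zero_laws:
  assumes x: "x \<in> pts (base A)"
  shows "vscale A x c (vzero A x) = vzero A x"
    and "u \<in> fib A x \<Longrightarrow> vadd A x u (vzero A x) = u"
    and "u \<in> fib A x \<Longrightarrow> vadd A x (vzero A x) u = u"
    and "u \<in> fib A x \<Longrightarrow> vscale A x 0 u = vzero A x"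
proof -
  obtain j where j: "j \<in> trivs A" "x \<in> tdom A j" using tdom_exists[OF x] by blast
  note f = fib_closed[OF x] and t = triv_simps[OF j] and e = triv_eqD[OF j] and r = triv_in_RR[OF j]
  show "vscale A x c (vzero A x) = vzero A x" by (rule e) (simp_all add: f t)
  assume u: "u \<in> fib A x"
  show "vadd A x u (vzero A x) = u" using r[OF u] by (intro e) (simp_all add: f t u)
  show "vadd A x (vzero A x) u = u" using r[OF u] by (intro e) (simp_all add: f t u)
  show "vscale A x 0 u = vzero A x" by (intro e) (simp_all add: f t u)
qed

lemma sections_fib: "a \<in> sections A \<Longrightarrow> x \<in> pts (base A) \<Longrightarrow> a x \<in> fib A x"
  by (auto simp: sections_def PiE_iff)

lemma sections_restrict: "a \<in> sections A \<Longrightarrow> restrict a (pts (base A)) = a"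
  using PiE_restrict[of a "pts (base A)" "fib A"] by (simp add: sections_def)

lemma bracket_section: "a \<in> sections A \<Longrightarrow> b \<in> sections A \<Longrightarrow> bracket A a b \<in> sections A"
  using A by (simp add: lie_algebroid_def)

lemma sec_zero_section: "sec_zero A \<in> sections A"
proof -
  have "smooth_fun_on (base A) (tdom A j) (\<lambda>x. triv A j x (sec_zero A x) l)"
    if j: "j \<in> trivs A" and l: "l \<in> {1..rank A}" for j l
  proof (rule smooth_fun_on_cong[OF smooth_base tdom_open[OF j] smooth_fun_on_const])
    fix x assume x: "x \<in> tdom A j"
    then have "x \<in> pts (base A)" using tdom_open[OF j] openin_subset by blast
    then show "0 = triv A j x (sec_zero A x) l"
      using l by (simp add: sec_zero_def triv_simps(2)[OF j x] ezero_def)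
  qed
  then show ?thesis using fib_closed(1) by (auto simp: sections_def sec_zero_def)
qed

lemma sec_add_section:
  assumes a: "a \<in> sections A" and b: "b \<in> sections A"
  shows "sec_add A a b \<in> sections A"
proof -
  have "smooth_fun_on (base A) (tdom A j) (\<lambda>x. triv A j x (sec_add A a b x) l)"
    if j: "j \<in> trivs A" and l: "l \<in> {1..rank A}" for j l
  proof (rule smooth_fun_on_cong[OF smooth_base tdom_open[OF j]])
    show "smooth_fun_on (base A) (tdom A j) (\<lambda>x. 1 * triv A j x (a x) l + triv A j x (b x) l)"
      using a b j l by (intro smooth_fun_on_lincomb[OF smooth_base tdom_open[OF j]]) (auto simp: sections_def)
    fix x assume x: "x \<in> tdom A j"
    then have "x \<in> pts (base A)" using tdom_open[OF j] openin_subset by blast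
    then show "1 * triv A j x (a x) l + triv A j x (b x) l = triv A j x (sec_add A a b x) l"
      using l a b by (simp add: sec_add_def triv_simps(3)[OF j x] sections_fib eadd_def)
  qed
  then show ?thesis
    using fib_closed(2) sections_fib[OF a] sections_fib[OF b] by (auto simp: sections_def sec_add_def)
qed

lemma sec_scale_section:
  assumes a: "a \<in> sections A"
  shows "sec_scale A c a \<in> sections A"
proof -
  have "smooth_fun_on (base A) (tdom A j) (\<lambda>x. triv A j x (sec_scale A c a x) l)"
    if j: "j \<in> trivs A" and l: "l \<in> {1..rank A}" for j l
  proof (rule smooth_fun_on_cong[OF smooth_base tdom_open[OF j]])
    show "smooth_fun_on (base A) (tdom A j) (\<lambda>x. c * triv A j x (a x) l + 0)"
      using a j l smooth_fun_on_const[of "base A" _ 0]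
      by (intro smooth_fun_on_lincomb[OF smooth_base tdom_open[OF j]]) (auto simp: sections_def)
    fix x assume x: "x \<in> tdom A j"
    then have "x \<in> pts (base A)" using tdom_open[OF j] openin_subset by blast
    then show "c * triv A j x (a x) l + 0 = triv A j x (sec_scale A c a x) l"
      using l a by (simp add: sec_mult_def triv_simps(4)[OF j x] sections_fib escale_def)
  qed
  then show ?thesis
    using fib_closed(3) sections_fib[OF a] by (auto simp: sections_def sec_mult_def)
qed

lemma sec_scale_0: "a \<in> sections A \<Longrightarrow> sec_scale A 0 a = sec_zero A"
  by (auto simp: sec_mult_def sec_zero_def fun_eq_iff restrict_def fib_zero_laws(4) sections_fib)

lemma bracket_zero_left:
  assumes "a \<in> sections A"
  shows "bracket A (sec_zero A) a = sec_zero A"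
proof -
  have "bracket A (sec_scale A 0 (sec_zero A)) a = sec_scale A 0 (bracket A (sec_zero A) a)"
    using A assms sec_zero_section by (simp add: lie_algebroid_def)
  then show ?thesis using assms sec_zero_section by (simp add: sec_scale_0 bracket_section)
qed

lemma anchor_vzero:
  assumes x: "x \<in> pts (base A)" and i: "i \<in> charts_at (base A) x"
  shows "anchor A x (vzero A x) i = ezero (mdim (base A))"
proof -
  have "anchor A x (vscale A x 0 (vzero A x)) =
      vscale (tangent_bundle (base A)) x 0 (anchor A x (vzero A x))"
    using A x fib_closed(1)[OF x] by (simp add: lie_algebroid_def bundle_hom_def)
  then have "anchor A x (vzero A x) = (\<lambda>i\<in>charts_at (base A) x. ezero (mdim (base A)))"
    by (simp add: fib_zero_laws(1)[OF x] tangent_bundle_def)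
  then show ?thesis using i by simp
qed

section \<open>Sections that do not depend on the point of R^k\<close>

lemma prod_sec_section:
  assumes a: "a \<in> sections A" and u: "u \<in> RR k"
  shows "prod_sec k A u a \<in> sections (TR_times k A)"
proof -
  have "smooth_fun_on (Rtimes k (base A)) (RR k \<times> tdom A j) (\<lambda>p. triv (TR_times k A) j p (prod_sec k A u a p) l)"
    if j: "j \<in> trivs A" and l: "l \<in> {1..k + rank A}" for j l
  proof (rule smooth_fun_on_Rtimes[OF smooth_base tdom_open[OF j]])
    show "smooth_fun_on (base A) (tdom A j) (\<lambda>x. if l \<le> k then u l else triv A j x (a x) (l - k))"
    proof (cases "l \<le> k")
      case False
      then have "l - k \<in> {1..rank A}" using l by auto
      then show ?thesis using a j False by (simp add: sections_def)
    qed (simp add: smooth_fun_on_const)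
    fix t x assume t: "t \<in> RR k" and x: "x \<in> tdom A j"
    then have "x \<in> pts (base A)" using tdom_open[OF j] openin_subset by blast
    then show "triv (TR_times k A) j (t, x) (prod_sec k A u a (t, x)) l =
        (if l \<le> k then u l else triv A j x (a x) (l - k))"
      using t l by (simp add: econcat_def)
  qed
  then show ?thesis
    using u sections_fib[OF a] by (auto simp: sections_def prod_sec_def)
qed

text \<open>All coordinate derivatives are 0, so the zero vector fits the definite description in
  \<open>fib_deriv\<close>; injectivity of one trivialisation around \<open>x\<close> makes it the
  only candidate.\<close>

lemma fib_deriv_const:
  assumes x: "x \<in> pts (base A)" and t: "t \<in> RR k" and h: "\<And>s. s \<in> RR k \<Longrightarrow> h s = e"
  shows "fib_deriv k A x h t u = vzero A x"
proof -
  have d: "dir_deriv k (\<lambda>s. triv A j x (h s) l) t u = 0" for j l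
    by (rule dir_deriv_const[OF t]) (simp add: h)
  show ?thesis unfolding fib_deriv_def d
  proof (rule the_equality)
    show "vzero A x \<in> fib A x \<and>
        (\<forall>j\<in>trivs A. x \<in> tdom A j \<longrightarrow> (\<forall>l\<in>{1..rank A}. triv A j x (vzero A x) l = 0))"
      by (auto simp: fib_closed(1)[OF x] triv_simps(2) ezero_def)
    fix w assume w: "w \<in> fib A x \<and>
        (\<forall>j\<in>trivs A. x \<in> tdom A j \<longrightarrow> (\<forall>l\<in>{1..rank A}. triv A j x w l = 0))"
    obtain j where j: "j \<in> trivs A" "x \<in> tdom A j" using tdom_exists[OF x] by blast
    show "w = vzero A x"
    proof (rule triv_eqD[OF j])
      show "triv A j x w = triv A j x (vzero A x)"
        unfolding triv_simps(2)[OF j]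
      proof (rule PiE_ext[OF triv_in_RR[OF j] evec_in_RR(1)])
        show "w \<in> fib A x" using w by blast
        show "triv A j x w l = ezero (rank A) l" if "l \<in> {1..rank A}" for l
          using w j that by (simp add: ezero_def)
      qed
    qed (use w fib_closed(1)[OF x] in auto)
  qed
qed

text \<open>Every derivative in the two bracket components is taken of a constant: the vector parts
  are constant on the whole product, and the fibre parts do not move with t. Only the bracket of
  \<open>A\<close> survives, and \<open>u\<close> and \<open>v\<close> disappear.\<close>

lemma bracket_prod_sec:
  assumes a: "a \<in> sections A" and b: "b \<in> sections A"
  shows "bracket (TR_times k A) (prod_sec k A u a) (prod_sec k A v b) = lift_sec k A (bracket A a b)"
proof -
  let ?s = "prod_sec k A u a" and ?r = "prod_sec k A v b"
  have "(TR_bracket_fst k A ?s ?r t x, TR_bracket_snd k A ?s ?r t x) = (ezero k, bracket A a b x)"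
    if t: "t \<in> RR k" and x: "x \<in> pts (base A)" for t x
  proof -
    have 1: "dir_deriv k (\<lambda>s. fst (prod_sec k A w c (s, x)) l) t w' = 0" for w c w' l
      by (rule dir_deriv_const[OF t, where c = "w l"]) (simp add: x)
    have 2: "tangent_apply (base A) x w' (\<lambda>y. fst (prod_sec k A w c (t, y)) l) = 0" for w c w' l
      by (rule tangent_apply_const[OF smooth_base x, where c = "w l"]) (simp add: t)
    have 3: "fib_deriv k A x (\<lambda>s. snd (prod_sec k A w c (s, x))) t w' = vzero A x" for w c w'
      by (rule fib_deriv_const[OF x t, where e = "c x"]) (simp add: x)
    \<comment> \<open>Freezing t returns the section of \<open>A\<close> itself, not just a function
      that agrees with it on the carrier, because sections are extensional.\<close>
    have 4: "(\<lambda>y\<in>pts (base A). snd (prod_sec k A w c (t, y))) = c" if "c \<in> sections A" for w c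
    proof -
      have "(\<lambda>y\<in>pts (base A). snd (prod_sec k A w c (t, y))) = restrict c (pts (base A))"
        by (rule restrict_ext) (simp add: t)
      then show ?thesis by (simp add: sections_restrict[OF that])
    qed
    have "bracket A a b x \<in> fib A x" by (rule sections_fib[OF bracket_section[OF a b] x])
    then show ?thesis
      unfolding TR_bracket_fst_def TR_bracket_snd_def 1 2 3 4[OF a] 4[OF b]
      using fib_closed(1)[OF x] by (simp add: fib_zero_laws[OF x] ezero_def)
  qed
  then show ?thesis by (auto simp: TR_times_def lift_sec_def fun_eq_iff)
qed

lemma const_sec_section: "u \<in> RR k \<Longrightarrow> const_sec k A u \<in> sections (TR_times k A)"
  by (simp add: const_sec_eq prod_sec_section sec_zero_section)

lemma lift_sec_section: "a \<in> sections A \<Longrightarrow> lift_sec k A a \<in> sections (TR_times k A)"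
  by (simp add: lift_sec_eq prod_sec_section)

lemma bracket_const_const: "bracket (TR_times k A) (const_sec k A u) (const_sec k A v) = lift_sec k A (sec_zero A)"
  by (simp add: const_sec_eq bracket_prod_sec sec_zero_section bracket_zero_left)

lemma bracket_const_lift:
  "a \<in> sections A \<Longrightarrow> bracket (TR_times k A) (const_sec k A u) (lift_sec k A a) = lift_sec k A (sec_zero A)"
  by (simp add: const_sec_eq lift_sec_eq[of k A] bracket_prod_sec sec_zero_section bracket_zero_left)

lemma bracket_lift_lift:
  "a \<in> sections A \<Longrightarrow> b \<in> sections A \<Longrightarrow>
    bracket (TR_times k A) (lift_sec k A a) (lift_sec k A b) = lift_sec k A (bracket A a b)"
  using bracket_prod_sec[of a b k "ezero k" "ezero k"] by (simp add: lift_sec_eq)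

text \<open>The vector on the left is shaped like \<open>face_vec\<close> for the slanted face. The
  identity lets a form be expanded there by its additivity and real homogeneity.\<close>

lemma const_sec_diff:
  "const_sec k A (eadd k (escale k (-1) u) v) =
    sec_add (TR_times k A) (sec_scale (TR_times k A) (-1) (const_sec k A u)) (const_sec k A v)"
  using fib_closed(1) by (auto simp: const_sec_def sec_add_def sec_mult_def fun_eq_iff fib_zero_laws)

lemma lift_sec_add:
  "lift_sec k A (sec_add A a b) = sec_add (TR_times k A) (lift_sec k A a) (lift_sec k A b)"
  by (auto simp: lift_sec_def sec_add_def fun_eq_iff)

lemma lift_sec_scale:
  "lift_sec k A (sec_scale A c a) = sec_scale (TR_times k A) c (lift_sec k A a)"
  by (auto simp: lift_sec_def sec_mult_def fun_eq_iff)

section \<open>The anchor on coordinate fields and lifts\<close>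

lemma act_const_sec:
  assumes "t \<in> RR k" "x \<in> pts (base A)"
  shows "act (TR_times k A) (const_sec k A u) F (t, x) = tangent_apply (Rtimes k (base A)) (t, x)
    (\<lambda>i\<in>charts_at (base A) x. econcat k (mdim (base A)) u (ezero (mdim (base A)))) F"
proof -
  have "(\<lambda>i\<in>charts_at (base A) x. econcat k (mdim (base A)) u (anchor A x (vzero A x) i)) =
      (\<lambda>i\<in>charts_at (base A) x. econcat k (mdim (base A)) u (ezero (mdim (base A))))"
    by (rule restrict_ext) (simp add: anchor_vzero[OF assms(2)])
  then show ?thesis using assms by (simp add: act_def const_sec_def)
qed

lemma act_lift_sec:
  assumes "t \<in> RR k" "x \<in> pts (base A)"
  shows "act (TR_times k A) (lift_sec k A a) F (t, x) = tangent_apply (Rtimes k (base A)) (t, x)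
    (\<lambda>i\<in>charts_at (base A) x. econcat k (mdim (base A)) (ezero k) (anchor A x (a x) i)) F"
  using assms by (simp add: act_def lift_sec_def)

end

section \<open>Alternating forms\<close>

text \<open>Models a form evaluated at one fixed point. Only the exchange of neighbours is assumed,
  which fits induction over a list of arguments.\<close>

locale alternating =
  fixes S :: "'a set" and f :: "'a list \<Rightarrow> real"
  assumes swap: "us \<in> lists S \<Longrightarrow> vs \<in> lists S \<Longrightarrow> a \<in> S \<Longrightarrow> b \<in> S \<Longrightarrow>
    f (us @ a # b # vs) = - f (us @ b # a # vs)"
begin

lemma move:
  assumes "us \<in> lists S" "cs \<in> lists S" "vs \<in> lists S" "b \<in> S"
  shows "f (us @ b # cs @ vs) = (-1) ^ length cs * f (us @ cs @ b # vs)"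
  using assms
proof (induction cs arbitrary: us)
  case (Cons c cs)
  then have "f (us @ b # c # cs @ vs) = - f ((us @ [c]) @ b # cs @ vs)"
    using swap[of us "cs @ vs" b c] by simp
  also have "f ((us @ [c]) @ b # cs @ vs) = (-1) ^ length cs * f ((us @ [c]) @ cs @ b # vs)"
    using Cons.prems by (intro Cons.IH) auto
  finally show ?case by simp
qed simp

text \<open>Once the equal entries are adjacent, exchanging them shows that the value equals its own
  negative.\<close>

lemma repeated:
  assumes "us \<in> lists S" "cs \<in> lists S" "vs \<in> lists S" "b \<in> S"
  shows "f (us @ b # cs @ b # vs) = 0"
proof -
  have "f (us @ b # cs @ b # vs) = (-1) ^ length cs * f ((us @ cs) @ b # b # vs)"
    using move[of us cs "b # vs" b] assms by simp
  moreover have "f ((us @ cs) @ b # b # vs) = 0"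
    using swap[of "us @ cs" vs b b] assms by simp
  ultimately show ?thesis by simp
qed

context
  fixes u :: 'a and d :: "'a \<Rightarrow> 'a" and T :: "'a set"
  assumes u: "u \<in> S" and T: "T \<subseteq> S"
    and d: "\<And>v. v \<in> T \<Longrightarrow> d v \<in> S"
    and diff: "\<And>us v vs. us \<in> lists S \<Longrightarrow> vs \<in> lists S \<Longrightarrow> v \<in> T \<Longrightarrow>
      f (us @ d v # vs) = f (us @ v # vs) - f (us @ u # vs)"
begin

text \<open>
  The assumption on \<open>f\<close> says that \<open>d v\<close> behaves like \<open>v - u\<close>. A term of the multilinear expansion
  that takes \<open>u\<close> twice vanishes.
\<close>

lemma differences_collapse:
  assumes "u \<in> set us" "us \<in> lists S" "vs \<in> lists T" "as \<in> lists S"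
  shows "f (us @ map d vs @ as) = f (us @ vs @ as)"
  using assms
proof (induction vs arbitrary: us)
  case (Cons v vs)
  have m: "map d vs \<in> lists S" using Cons.prems d by auto
  obtain us1 us2 where us: "us = us1 @ u # us2" using Cons.prems(1) by (auto simp: in_set_conv_decomp)
  have "f (us @ d v # map d vs @ as) = f (us @ v # map d vs @ as) - f (us @ u # map d vs @ as)"
    using Cons.prems m by (intro diff) auto
  also have "f (us @ u # map d vs @ as) = 0"
    using repeated[of us1 us2 "map d vs @ as" u] Cons.prems m us u by auto
  also have "f (us @ v # map d vs @ as) = f ((us @ [v]) @ vs @ as)"
    using Cons.IH[of "us @ [v]"] Cons.prems T by auto
  finally show ?case by simp
qed simp

text \<open>The expansion proceeds from the left. In the branch that takes \<open>u\<close>,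
  \<open>differences_collapse\<close> removes all further choices, so one term per position remains
  instead of exponentially many.\<close>

lemma differences_expand:
  assumes "us \<in> lists S" "vs \<in> lists T" "as \<in> lists S"
  shows "f (us @ map d vs @ as) = f (us @ vs @ as) - (\<Sum>p<length vs. f (us @ vs[p := u] @ as))"
  using assms
proof (induction vs arbitrary: us)
  case (Cons v vs)
  have m: "map d vs \<in> lists S" using Cons.prems d by auto
  have "f (us @ d v # map d vs @ as) = f ((us @ [v]) @ map d vs @ as) - f ((us @ [u]) @ map d vs @ as)"
    using Cons.prems m diff[of us "map d vs @ as" v] by auto
  also have "f ((us @ [v]) @ map d vs @ as) =
      f ((us @ [v]) @ vs @ as) - (\<Sum>p<length vs. f ((us @ [v]) @ vs[p := u] @ as))"
    using Cons.prems T by (intro Cons.IH) auto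
  also have "f ((us @ [u]) @ map d vs @ as) = f ((us @ [u]) @ vs @ as)"
    using Cons.prems u by (intro differences_collapse) auto
  finally show ?case by (simp add: sum.lessThan_Suc_shift del: sum.lessThan_Suc)
qed simp

text \<open>Replacing an entry of \<open>E 2\<close>, ..., \<open>E (n + 1)\<close> by
  \<open>u = E 1\<close> and moving it to the front gives the full list of fields with that entry
  omitted. The transpositions and the minus sign of the expansion produce the alternating sign; the
  term \<open>i = 1\<close> is the one that never takes \<open>u\<close>.\<close>

lemma differences_omit:
  assumes E: "\<And>i. E i \<in> T" and u_eq: "u = E 1" and as: "as \<in> lists S"
  shows "f (map (\<lambda>s. d (E (s + 1))) [1..<Suc n] @ as) =
    (\<Sum>i\<in>{1..Suc n}. (-1) ^ (i + 1) * f (omit i (map E [1..<Suc (Suc n)]) @ as))"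
proof -
  define vs where "vs = map (\<lambda>s. E (s + 1)) [1..<Suc n]"
  have vs: "vs \<in> lists T" "length vs = n" using E by (auto simp: vs_def)
  then have vsS: "set vs \<subseteq> S" using T by auto
  have L: "map E [1..<Suc (Suc n)] = E 1 # vs"
    by (rule nth_equalityI) (auto simp: vs_def nth_Cons One_nat_def simp del: upt_Suc split: nat.split)
  \<comment> \<open>Entry \<open>p\<close> of \<open>vs\<close>, counted from 0, is
    \<open>E (p + 2)\<close>, and \<open>omit\<close> counts from 1 in a list headed by
    \<open>E 1\<close>. Thus \<open>i = p + 2\<close>, and the sign exponent \<open>i + 1\<close> is
    \<open>p + 3\<close>.\<close>
  have t: "(-1) ^ (p + 3) * f (omit (p + 2) (E 1 # vs) @ as) = - f (vs[p := u] @ as)" if p: "p < n" for p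
  proof -
    have upd: "vs[p := u] = take p vs @ u # drop (Suc p) vs"
      using p vs(2) by (intro upd_conv_take_nth_drop) simp
    have om: "omit (p + 2) (E 1 # vs) = u # take p vs @ drop (Suc p) vs"
      by (simp add: omit_def u_eq)
    have "f ([] @ u # take p vs @ (drop (Suc p) vs @ as)) =
        (-1) ^ length (take p vs) * f ([] @ take p vs @ u # (drop (Suc p) vs @ as))"
      using vsS as u by (intro move) (auto dest: in_set_takeD in_set_dropD)
    then have "f (omit (p + 2) (E 1 # vs) @ as) = (-1) ^ p * f (vs[p := u] @ as)"
      unfolding om upd using p vs(2) by simp
    then show ?thesis by (simp add: power_add flip: power_mult_distrib)
  qed
  have "(\<Sum>i\<in>{1..Suc n}. (-1) ^ (i + 1) * f (omit i (E 1 # vs) @ as)) =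
      (\<Sum>i<Suc n. (-1) ^ (i + 2) * f (omit (i + 1) (E 1 # vs) @ as))"
    by (rule sum.reindex_bij_witness[where j = "\<lambda>i. i - 1" and i = Suc]) (auto simp: power_add)
  also have "\<dots> = f (omit 1 (E 1 # vs) @ as) +
      (\<Sum>p<n. (-1) ^ (p + 3) * f (omit (p + 2) (E 1 # vs) @ as))"
    by (subst sum.lessThan_Suc_shift) (simp add: numeral_eq_Suc One_nat_def)
  also have "\<dots> = f (vs @ as) - (\<Sum>p<n. f (vs[p := u] @ as))"
    using t by (simp add: sum_negf omit_def One_nat_def)
  also have "\<dots> = f (map d vs @ as)"
    using differences_expand[of "[]" vs as] vs as by simp
  also have "map d vs = map (\<lambda>s. d (E (s + 1))) [1..<Suc n]"
    by (simp add: vs_def)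
  finally show ?thesis unfolding L by simp
qed

end

end

section \<open>Real multilinear alternating forms of an algebroid\<close>

lemma Alt_forms_off:
  "\<eta> \<in> Alt_forms B n \<Longrightarrow> as \<notin> lists (sections B) \<or> int (length as) \<noteq> n \<Longrightarrow> \<eta> as = (\<lambda>x. 0)"
  unfolding Alt_forms_def by blast

lemma Alt_forms_C_inf:
  assumes "\<eta> \<in> Alt_forms B n"
  shows "\<eta> as \<in> C_inf (base B)"
proof (cases "as \<in> lists (sections B) \<and> int (length as) = n")
  case False
  then show ?thesis using Alt_forms_off[OF assms, of as] zero_in_C_inf by auto
qed (use assms in \<open>auto simp: Alt_forms_def\<close>)

text \<open>Valid for lists of sections of every length, since away from degree \<open>n\<close> all
  terms are zero. Later computations can thus ignore degrees.\<close>

lemma Alt_forms_update: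
  assumes \<eta>: "\<eta> \<in> Alt_forms B n" and as: "as \<in> lists (sections B)" and p: "p < length as"
  shows "a \<in> sections B \<Longrightarrow> b \<in> sections B \<Longrightarrow>
      \<eta> (as[p := sec_add B a b]) x = \<eta> (as[p := a]) x + \<eta> (as[p := b]) x"
    and "a \<in> sections B \<Longrightarrow> \<eta> (as[p := sec_scale B c a]) x = c * \<eta> (as[p := a]) x"
    and "q < length as \<Longrightarrow> p \<noteq> q \<Longrightarrow> \<eta> (as[p := as ! q, q := as ! p]) x = - \<eta> as x"
proof -
  have z: "\<eta> bs = (\<lambda>x. 0)" if "length bs = length as" "int (length as) \<noteq> n" for bs
    using Alt_forms_off[OF \<eta>] that by simp
  have m: "\<forall>p<length as. \<forall>a\<in>sections B. \<forall>b\<in>sections B.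
           \<eta> (as[p := sec_add B a b]) = (\<lambda>x. \<eta> (as[p := a]) x + \<eta> (as[p := b]) x)"
    "\<forall>p<length as. \<forall>c. \<forall>a\<in>sections B.
           \<eta> (as[p := sec_scale B c a]) = (\<lambda>x. c * \<eta> (as[p := a]) x)"
    "\<forall>p<length as. \<forall>q<length as. p \<noteq> q \<longrightarrow>
           \<eta> (as[p := as ! q, q := as ! p]) = (\<lambda>x. - \<eta> as x)" if "int (length as) = n"
    using \<eta> as that unfolding Alt_forms_def by blast+
  show "\<eta> (as[p := sec_add B a b]) x = \<eta> (as[p := a]) x + \<eta> (as[p := b]) x"
    if "a \<in> sections B" "b \<in> sections B"
    using that p m(1) z by (cases "int (length as) = n") simp_all
  show "\<eta> (as[p := sec_scale B c a]) x = c * \<eta> (as[p := a]) x" if "a \<in> sections B"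
    using that p m(2) z by (cases "int (length as) = n") simp_all
  show "\<eta> (as[p := as ! q, q := as ! p]) x = - \<eta> as x" if "q < length as" "p \<noteq> q"
    using that p m(3) z by (cases "int (length as) = n") simp_all
qed

lemma Alt_forms_append:
  assumes \<eta>: "\<eta> \<in> Alt_forms B n" and us: "us \<in> lists (sections B)" and vs: "vs \<in> lists (sections B)"
  shows "a \<in> sections B \<Longrightarrow> b \<in> sections B \<Longrightarrow>
      \<eta> (us @ sec_add B a b # vs) x = \<eta> (us @ a # vs) x + \<eta> (us @ b # vs) x"
    and "a \<in> sections B \<Longrightarrow> \<eta> (us @ sec_scale B c a # vs) x = c * \<eta> (us @ a # vs) x"
    and "a \<in> sections B \<Longrightarrow> b \<in> sections B \<Longrightarrow> \<eta> (us @ a # b # vs) x = - \<eta> (us @ b # a # vs) x"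
proof -
  assume a: "a \<in> sections B"
  have l: "us @ a # vs \<in> lists (sections B)" using us vs a by auto
  note U = Alt_forms_update[OF \<eta> l, of "length us"]
  show "\<eta> (us @ sec_scale B c a # vs) x = c * \<eta> (us @ a # vs) x"
    using U(2)[of a] a by simp
  assume b: "b \<in> sections B"
  show "\<eta> (us @ sec_add B a b # vs) x = \<eta> (us @ a # vs) x + \<eta> (us @ b # vs) x"
    using U(1)[of a b] a b by simp
  have l': "us @ b # a # vs \<in> lists (sections B)" using us vs a b by auto
  from Alt_forms_update(3)[OF \<eta> l', of "length us" "Suc (length us)" x]
  show "\<eta> (us @ a # b # vs) x = - \<eta> (us @ b # a # vs) x"
    by (simp add: list_update_append nth_append)
qed

lemma Alt_forms_alternating:
  assumes "\<eta> \<in> Alt_forms B n"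
  shows "alternating (sections B) (\<lambda>as. \<eta> as x)"
  by standard (rule Alt_forms_append(3)[OF assms])

lemma Alt_forms_sum:
  assumes M: "smooth_manifold (base B)" and K: "finite K" and \<eta>: "\<And>j. j \<in> K \<Longrightarrow> \<eta> j \<in> Alt_forms B n"
  shows "(\<lambda>as x. \<Sum>j\<in>K. c j * \<eta> j as x) \<in> Alt_forms B n"
proof -
  note off = Alt_forms_off[OF \<eta>] and upd = Alt_forms_update[OF \<eta>]
  show ?thesis
    unfolding Alt_forms_def
  proof (intro CollectI conjI allI impI ballI)
    fix as assume "\<not> (as \<in> lists (sections B) \<and> int (length as) = n)"
    then show "(\<lambda>x. \<Sum>j\<in>K. c j * \<eta> j as x) = (\<lambda>x. 0)" using off[of _ as] by auto
  next
    fix as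
    show "(\<lambda>x. \<Sum>j\<in>K. c j * \<eta> j as x) \<in> C_inf (base B)"
      by (rule C_inf_sum[OF M K Alt_forms_C_inf[OF \<eta>]])
  next
    fix as p a b assume "as \<in> lists (sections B)" "p < length as" "a \<in> sections B" "b \<in> sections B"
    then show "(\<lambda>x. \<Sum>j\<in>K. c j * \<eta> j (as[p := sec_add B a b]) x) =
        (\<lambda>x. (\<Sum>j\<in>K. c j * \<eta> j (as[p := a]) x) + (\<Sum>j\<in>K. c j * \<eta> j (as[p := b]) x))"
      by (simp add: upd(1) distrib_left sum.distrib)
  next
    fix as p r a assume "as \<in> lists (sections B)" "p < length as" "a \<in> sections B"
    then show "(\<lambda>x. \<Sum>j\<in>K. c j * \<eta> j (as[p := sec_scale B r a]) x) =
        (\<lambda>x. r * (\<Sum>j\<in>K. c j * \<eta> j (as[p := a]) x))"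
      by (simp add: upd(2) sum_distrib_left mult.left_commute)
  next
    fix as p q assume "as \<in> lists (sections B)" "p < length as" "q < length as" "p \<noteq> q"
    then show "(\<lambda>x. \<Sum>j\<in>K. c j * \<eta> j (as[p := as ! q, q := as ! p]) x) =
        (\<lambda>x. - (\<Sum>j\<in>K. c j * \<eta> j as x))"
      by (simp add: upd(3) sum_negf)
  qed
qed

text \<open>The \<open>k\<close> fixed fields in front shift every position by \<open>k\<close>, so
  the laws of \<open>\<omega>\<close> transfer slot by slot and the degree drops by
  \<open>k\<close>. Additivity in a slot also uses that each integrand is continuous.\<close>

lemma int_face_Alt_forms:
  fixes A :: "('m, 'i, 'e, 'j) algebroid"
  assumes A: "lie_algebroid A" and \<omega>: "\<omega> \<in> Alt_forms (TR_times (Suc k) A) n" and j: "j \<le> Suc k"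
  shows "int_face k j A \<omega> \<in> Alt_forms A (n - int k)"
proof -
  let ?B = "TR_times (Suc k) A"
  define C where "C = map (\<lambda>s. const_sec (Suc k) A (face_vec k j s)) [1..<Suc k]"
  define L where "L = (\<lambda>as. C @ map (lift_sec (Suc k) A) as)"
  have C: "C \<in> lists (sections ?B)" "length C = k"
  proof -
    have "face_vec k j s \<in> RR (Suc k)" for s
      by (simp add: face_vec_def flip: Suc_eq_plus1)
    then show "C \<in> lists (sections ?B)" "length C = k"
      using const_sec_section[OF A] by (auto simp: C_def simp del: upt_Suc)
  qed
  have L: "L as \<in> lists (sections ?B)" if "as \<in> lists (sections A)" for as
    using C(1) lift_sec_section[OF A] that by (auto simp: L_def)
  have L_update: "L (as[p := a]) = (L as)[k + p := lift_sec (Suc k) A a]" for as p a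
    by (simp add: L_def map_update list_update_append C(2))
  have L_nth: "lift_sec (Suc k) A (as ! p) = L as ! (k + p)" if "p < length as" for as p
    using that by (simp add: L_def nth_append C(2))
  have len: "length (L as) = k + length as" for as by (simp add: L_def C(2))
  have eq: "int_face k j A \<omega> as = (\<lambda>x. integral_simplex k (\<lambda>t. \<omega> (L as) (face_map k j t, x)))"
    if "as \<in> lists (sections A)" for as
    using that by (simp add: int_face_def fun_eq_iff L_def C_def del: upt_Suc flip: Suc_eq_plus1)
  have cont: "continuous_map (coord_top {1..k}) euclideanreal (\<lambda>t. \<omega> as (face_map k j t, x))" for as x
    using continuous_map_C_inf_vertical[OF smooth_base[OF A] _ continuous_map_face_map[OF j]]
      Alt_forms_C_inf[OF \<omega>] by (simp add: RT_def)
  have upd_lists: "as[p := a] \<in> lists (sections A)" if "as \<in> lists (sections A)" "a \<in> sections A" for as p a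
    using that by (auto dest!: set_update_subset_insert[THEN subsetD])
  note U = Alt_forms_update[OF \<omega> L]
  show ?thesis
    unfolding Alt_forms_def
  proof (intro CollectI conjI allI impI ballI)
    fix as assume "\<not> (as \<in> lists (sections A) \<and> int (length as) = n - int k)"
    then consider "as \<notin> lists (sections A)" | "as \<in> lists (sections A)" "\<omega> (L as) = (\<lambda>x. 0)"
      using Alt_forms_off[OF \<omega>, of "L as"] by (force simp: len)
    then show "int_face k j A \<omega> as = (\<lambda>x. 0)"
    proof cases
      case 1
      then show ?thesis by (simp add: int_face_def fun_eq_iff)
    qed (simp add: eq integral_simplex_eq)
  next
    fix as assume as: "as \<in> lists (sections A)"
    show "int_face k j A \<omega> as \<in> C_inf (base A)"
      unfolding eq[OF as]
      using C_inf_integral_simplex[OF smooth_base[OF A] continuous_map_face_map[OF j]]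
        Alt_forms_C_inf[OF \<omega>] by simp
    fix p assume p: "p < length as"
    show "int_face k j A \<omega> (as[p := sec_add A a b]) =
        (\<lambda>x. int_face k j A \<omega> (as[p := a]) x + int_face k j A \<omega> (as[p := b]) x)"
      if ab: "a \<in> sections A" "b \<in> sections A" for a b
    proof -
      have l: "as[p := sec_add A a b] \<in> lists (sections A)"
        by (rule upd_lists[OF as sec_add_section[OF A ab]])
      show ?thesis
        unfolding eq[OF upd_lists[OF as ab(1)]] eq[OF upd_lists[OF as ab(2)]] eq[OF l] L_update
          integral_simplex_eq lift_sec_add[OF A]
        using U(1)[OF as, of "k + p"] p ab lift_sec_section[OF A]
        by (simp add: len simplex_integral_add cont)
    qed
    show "int_face k j A \<omega> (as[p := sec_scale A c a]) = (\<lambda>x. c * int_face k j A \<omega> (as[p := a]) x)"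
      if a: "a \<in> sections A" for a c
    proof -
      have l: "as[p := sec_scale A c a] \<in> lists (sections A)"
        by (rule upd_lists[OF as sec_scale_section[OF A a]])
      show ?thesis
        unfolding eq[OF upd_lists[OF as a]] eq[OF l] L_update integral_simplex_eq lift_sec_scale[OF A]
        using U(2)[OF as, of "k + p"] p a lift_sec_section[OF A]
        by (simp add: len simplex_integral_cmult)
    qed
    show "int_face k j A \<omega> (as[p := as ! q, q := as ! p]) = (\<lambda>x. - int_face k j A \<omega> as x)"
      if q: "q < length as" "p \<noteq> q" for q
    proof -
      have l: "as[p := as ! q, q := as ! p] \<in> lists (sections A)"
        using as p q by (intro upd_lists) (auto dest: nth_mem)
      show ?thesis
        unfolding eq[OF l] eq[OF as] integral_simplex_eq L_update
        using U(3)[OF as, of "k + p" "k + q"] p q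
        by (simp add: L_nth len simplex_integral_uminus)
    qed
  qed
qed

section \<open>The homotopy formula\<close>

lemma omit_lists: "as \<in> lists S \<Longrightarrow> omit i as \<in> lists S"
  by (auto simp: omit_def dest: in_set_takeD in_set_dropD)

lemma omit_append1: "i \<le> length us \<Longrightarrow> omit i (us @ vs) = omit i us @ vs"
  by (simp add: omit_def)

lemma omit_append2: "1 \<le> l \<Longrightarrow> omit (length us + l) (us @ vs) = us @ omit l vs"
  by (simp add: omit_def)

lemma omit_map: "omit i (map f as) = map f (omit i as)"
  by (simp add: omit_def take_map drop_map)

section \<open>The differential on coordinate fields followed by lifts\<close>

definition coord_secs :: "nat \<Rightarrow> ('m, 'i, 'e, 'j) algebroid \<Rightarrow> ((nat \<Rightarrow> real) \<times> 'm \<Rightarrow> (nat \<Rightarrow> real) \<times> 'e) list"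
  where "coord_secs k A = map (\<lambda>s. const_sec k A (eunit k s)) [1..<k + 1]"

lemma length_coord_secs [simp]: "length (coord_secs k A) = k"
  by (simp add: coord_secs_def)

lemma coord_secs_nth: "i \<in> {1..k} \<Longrightarrow> coord_secs k A ! (i - 1) = const_sec k A (eunit k i)"
proof -
  assume "i \<in> {1..k}"
  then have "i - 1 < k" "1 + (i - 1) = i" by auto
  then show ?thesis by (simp add: coord_secs_def del: upt_Suc)
qed

context
  fixes A :: "('m, 'i, 'e, 'j) algebroid"
  assumes A: "lie_algebroid A"
begin

lemma coord_secs_lists: "coord_secs k A \<in> lists (sections (TR_times k A))"
  using const_sec_section[OF A] by (auto simp: coord_secs_def)

lemma map_lift_sec_lists: "as \<in> lists (sections A) \<Longrightarrow> map (lift_sec k A) as \<in> lists (sections (TR_times k A))"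
  using lift_sec_section[OF A] by auto

text \<open>The zero section is 0 times itself, so homogeneity forces the value 0. This removes
  every bracket term that involves a coordinate field.\<close>

lemma Alt_forms_lift_zero:
  assumes \<omega>: "\<omega> \<in> Alt_forms (TR_times k A) n" and vs: "vs \<in> lists (sections (TR_times k A))"
  shows "\<omega> (lift_sec k A (sec_zero A) # vs) x = 0"
proof -
  have "lift_sec k A (sec_zero A) = sec_scale (TR_times k A) 0 (lift_sec k A (sec_zero A))"
    using sec_scale_0[OF A sec_zero_section[OF A]] by (simp flip: lift_sec_scale[OF A])
  then show ?thesis
    using Alt_forms_append(2)[OF \<omega> _ vs, of "[]" "lift_sec k A (sec_zero A)" 0 x]
      lift_sec_section[OF A sec_zero_section[OF A]] by simp
qed

text \<open>The common factor (-1)^k has two origins. In the single sum, the index of a lift is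
  shifted by \<open>k\<close>. In the double sum, the two index shifts cancel, and the sign comes
  from moving the bracket from the head of the list past the \<open>k\<close> coordinate
  fields.\<close>

lemma dR_TR_times:
  assumes \<omega>: "\<omega> \<in> Alt_forms (TR_times k A) n" and as: "as \<in> lists (sections A)"
  defines "B \<equiv> TR_times k A" and "Es \<equiv> coord_secs k A" and "lf \<equiv> lift_sec k A" and "m \<equiv> length as"
  shows "dR B \<omega> (Es @ map lf as) p =
    (\<Sum>i\<in>{1..k}. (-1) ^ (i + 1) * act B (const_sec k A (eunit k i)) (\<omega> (omit i Es @ map lf as)) p) +
    (-1) ^ k *
      ((\<Sum>l\<in>{1..m}. (-1) ^ (l + 1) * act B (lf (as ! (l - 1))) (\<omega> (Es @ map lf (omit l as))) p) +
       (\<Sum>l\<in>{1..m}. \<Sum>l'\<in>{l<..m}. (-1) ^ (l + l') *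
          \<omega> (Es @ map lf (bracket A (as ! (l - 1)) (as ! (l' - 1)) # omit l (omit l' as))) p))"
proof -
  define L where "L = Es @ map lf as"
  have Es: "Es \<in> lists (sections B)" "length Es = k"
    using coord_secs_lists by (simp_all add: Es_def B_def)
  have L: "L \<in> lists (sections B)" "length L = k + m"
    using Es map_lift_sec_lists[OF as] by (simp_all add: L_def B_def lf_def m_def)
  have as_nth: "as ! (l - 1) \<in> sections A" if "l \<in> {1..m}" for l
    using as that nth_mem[of "l - 1" as] by (auto simp: m_def)
  have L1: "L ! (i - 1) = const_sec k A (eunit k i)" if "i \<in> {1..k}" for i
    using that by (auto simp: L_def nth_append Es(2)) (simp add: Es_def coord_secs_nth)
  have L2: "L ! (k + l - 1) = lf (as ! (l - 1))" if "l \<in> {1..m}" for l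
    using that by (auto simp: L_def nth_append Es(2) m_def)
  let ?h = "\<lambda>i. (-1) ^ (i + 1) * act B (L ! (i - 1)) (\<omega> (omit i L)) p"
  let ?g = "\<lambda>i j. (-1) ^ (i + j) * \<omega> (bracket B (L ! (i - 1)) (L ! (j - 1)) # omit i (omit j L)) p"
  have "dR B \<omega> L p = sum ?h {1..k + m} + (\<Sum>i\<in>{1..k + m}. \<Sum>j\<in>{i<..k + m}. ?g i j)"
    using L by (simp add: dR_def)
  also have "sum ?h {1..k + m} = sum ?h {1..k} + (\<Sum>l\<in>{1..m}. ?h (k + l))"
    by (rule sum_1_split)
  also have "(\<Sum>i\<in>{1..k + m}. \<Sum>j\<in>{i<..k + m}. ?g i j) =
      (\<Sum>i\<in>{1..k}. \<Sum>j\<in>{i<..k + m}. ?g i j) + (\<Sum>l\<in>{1..m}. \<Sum>j\<in>{k + l<..k + m}. ?g (k + l) j)"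
    by (rule sum_1_split)
  also have "sum ?h {1..k} =
      (\<Sum>i\<in>{1..k}. (-1) ^ (i + 1) * act B (const_sec k A (eunit k i)) (\<omega> (omit i Es @ map lf as)) p)"
  proof (intro sum.cong refl)
    fix i assume i: "i \<in> {1..k}"
    then have "omit i L = omit i Es @ map lf as" by (simp add: L_def omit_append1 Es(2))
    then show "?h i = (-1) ^ (i + 1) * act B (const_sec k A (eunit k i)) (\<omega> (omit i Es @ map lf as)) p"
      by (simp only: L1[OF i])
  qed
  also have "(\<Sum>l\<in>{1..m}. ?h (k + l)) = (-1) ^ k *
      (\<Sum>l\<in>{1..m}. (-1) ^ (l + 1) * act B (lf (as ! (l - 1))) (\<omega> (Es @ map lf (omit l as))) p)"
    unfolding sum_distrib_left
  proof (intro sum.cong refl)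
    fix l assume l: "l \<in> {1..m}"
    then have "omit (k + l) L = Es @ map lf (omit l as)"
      using omit_append2[of l Es "map lf as"] by (simp add: L_def Es(2) omit_map)
    then show "?h (k + l) = (-1) ^ k *
        ((-1) ^ (l + 1) * act B (lf (as ! (l - 1))) (\<omega> (Es @ map lf (omit l as))) p)"
      by (simp add: L2[OF l] power_add del: One_nat_def)
  qed
  also have "(\<Sum>i\<in>{1..k}. \<Sum>j\<in>{i<..k + m}. ?g i j) = 0"
  proof (intro sum.neutral ballI)
    fix i j assume i: "i \<in> {1..k}" and j: "j \<in> {i<..k + m}"
    have "bracket B (L ! (i - 1)) (L ! (j - 1)) = lf (sec_zero A)"
    proof (cases "j \<le> k")
      case True
      then have "j \<in> {1..k}" using j by auto
      then show ?thesis by (simp only: L1[OF i] L1[of j] B_def lf_def bracket_const_const[OF A])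
    next
      case False
      define l where "l = j - k"
      have l: "j = k + l" "l \<in> {1..m}" using False j by (auto simp: l_def)
      show ?thesis
        unfolding l(1) L1[OF i] L2[OF l(2)] B_def lf_def by (rule bracket_const_lift[OF A as_nth[OF l(2)]])
    qed
    then show "?g i j = 0"
      using Alt_forms_lift_zero[OF \<omega>] omit_lists[OF omit_lists[OF L(1)]] by (simp add: lf_def B_def)
  qed
  also have "(\<Sum>l\<in>{1..m}. \<Sum>j\<in>{k + l<..k + m}. ?g (k + l) j) = (-1) ^ k *
      (\<Sum>l\<in>{1..m}. \<Sum>l'\<in>{l<..m}. (-1) ^ (l + l') *
          \<omega> (Es @ map lf (bracket A (as ! (l - 1)) (as ! (l' - 1)) # omit l (omit l' as))) p)"
    unfolding sum_distrib_left
  proof (rule sum.cong[OF refl])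
    fix l assume l: "l \<in> {1..m}"
    have "(\<Sum>j\<in>{k + l<..k + m}. ?g (k + l) j) = (\<Sum>l'\<in>{l<..m}. ?g (k + l) (k + l'))"
      by (rule sum.reindex_bij_witness[where i = "\<lambda>l'. k + l'" and j = "\<lambda>j. j - k"]) auto
    also have "\<dots> = (\<Sum>l'\<in>{l<..m}. (-1) ^ k * ((-1) ^ (l + l') *
          \<omega> (Es @ map lf (bracket A (as ! (l - 1)) (as ! (l' - 1)) # omit l (omit l' as))) p))"
    proof (rule sum.cong[OF refl])
      fix l' assume "l' \<in> {l<..m}"
      then have l': "l' \<in> {1..m}" using l by auto
      have br: "bracket B (L ! (k + l - 1)) (L ! (k + l' - 1)) = lf (bracket A (as ! (l - 1)) (as ! (l' - 1)))"
        unfolding L2[OF l] L2[OF l'] B_def lf_def by (rule bracket_lift_lift[OF A as_nth[OF l] as_nth[OF l']])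
      have om: "omit (k + l) (omit (k + l') L) = Es @ map lf (omit l (omit l' as))"
        using omit_append2[of l' Es "map lf as"] omit_append2[of l Es "map lf (omit l' as)"] l l'
        by (simp add: L_def Es(2) omit_map)
      interpret alternating "sections B" "\<lambda>as. \<omega> as p"
        unfolding B_def by (rule Alt_forms_alternating[OF \<omega>])
      have "\<omega> ([] @ lf (bracket A (as ! (l - 1)) (as ! (l' - 1))) # Es @ map lf (omit l (omit l' as))) p =
          (-1) ^ length Es *
          \<omega> ([] @ Es @ lf (bracket A (as ! (l - 1)) (as ! (l' - 1))) # map lf (omit l (omit l' as))) p"
        using Es(1) map_lift_sec_lists[OF omit_lists[OF omit_lists[OF as]]]
          lift_sec_section[OF A bracket_section[OF A as_nth[OF l] as_nth[OF l']]]
        by (intro move) (simp_all add: B_def lf_def)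
      then show "?g (k + l) (k + l') = (-1) ^ k * ((-1) ^ (l + l') *
          \<omega> (Es @ map lf (bracket A (as ! (l - 1)) (as ! (l' - 1)) # omit l (omit l' as))) p)"
        unfolding br om by (simp add: Es(2) power_add)
    qed
    finally show "(\<Sum>j\<in>{k + l<..k + m}. ?g (k + l) j) = (\<Sum>l'\<in>{l<..m}. (-1) ^ k * ((-1) ^ (l + l') *
          \<omega> (Es @ map lf (bracket A (as ! (l - 1)) (as ! (l' - 1)) # omit l (omit l' as))) p))" .
  qed
  finally show ?thesis by (simp add: L_def distrib_left)
qed

lemma int_simplex_eq:
  "as \<in> lists (sections A) \<Longrightarrow> int_simplex k A \<omega> as =
    (\<lambda>x. integral_simplex k (\<lambda>t. \<omega> (coord_secs k A @ map (lift_sec k A) as) (t, x)))"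
  by (simp add: int_simplex_def coord_secs_def fun_eq_iff)

lemma int_simplex_dR:
  assumes \<omega>: "\<omega> \<in> Alt_forms (TR_times (Suc k) A) n" and as: "as \<in> lists (sections A)"
    and x: "x \<in> pts (base A)"
  defines "G \<equiv> \<lambda>i t. \<omega> (omit i (coord_secs (Suc k) A) @ map (lift_sec (Suc k) A) as) (t, x)"
  shows "int_simplex (Suc k) A (dR (TR_times (Suc k) A) \<omega>) as x =
    (\<Sum>i\<in>{1..Suc k}. (-1) ^ (i + 1) *
      (integral_simplex k (\<lambda>t. G i (face_map k 0 t)) - integral_simplex k (\<lambda>t. G i (face_map k i t)))) +
    (-1) ^ Suc k * dR A (int_simplex (Suc k) A \<omega>) as x"
proof -
  define K where "K = Suc k"
  define B where "B = TR_times K A"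
  define Es where "Es = coord_secs K A"
  define lf where "lf = lift_sec K A"
  define m where "m = length as"
  \<comment> \<open>\<open>D\<close> holds the actions of the coordinate fields, \<open>T\<close>
    those of the lifts, and \<open>W\<close> the brackets of lifts. Each is continuous in t, which
    is what permits splitting the integral of their sum.\<close>
  define D where "D = (\<lambda>i t. act B (const_sec K A (eunit K i)) (\<omega> (omit i Es @ map lf as)) (t, x))"
  define T where "T = (\<lambda>l t. act B (lf (as ! (l - 1))) (\<omega> (Es @ map lf (omit l as))) (t, x))"
  define br where "br = (\<lambda>l l'. bracket A (as ! (l - 1)) (as ! (l' - 1)) # omit l (omit l' as))"
  define W where "W = (\<lambda>l l' t. \<omega> (Es @ map lf (br l l')) (t, x))"
  note M = smooth_base[OF A]
  have C: "\<omega> bs \<in> C_inf (Rtimes K (base A))" for bs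
    using Alt_forms_C_inf[OF \<omega>] by (simp add: K_def)
  have id: "continuous_map (RT K) (RT K) (\<lambda>t. t)" using continuous_map_id by (simp add: id_def)
  have as_nth: "as ! (l - 1) \<in> sections A" if "l \<in> {1..m}" for l
    using as that nth_mem[of "l - 1" as] by (auto simp: m_def)
  have br: "br l l' \<in> lists (sections A)" if "l \<in> {1..m}" "l' \<in> {l<..m}" for l l'
  proof -
    have "l' \<in> {1..m}" using that by auto
    then show ?thesis
      using bracket_section[OF A as_nth[OF that(1)] as_nth] omit_lists[OF omit_lists[OF as]]
      by (simp add: br_def)
  qed
  have cW: "continuous_map (coord_top {1..K}) euclideanreal (W l l')" for l l'
    using continuous_map_C_inf_vertical[OF M C id] by (simp add: W_def RT_def)
  have "continuous_map (RT K) euclideanreal (T l)" for l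
    by (rule continuous_map_eq[OF tangent_apply_integral_simplex(2)[OF M C x]])
       (simp add: T_def B_def lf_def act_lift_sec[OF A _ x])
  then have cT: "continuous_map (coord_top {1..K}) euclideanreal (T l)" for l
    by (simp add: RT_def)
  have cD': "continuous_map (RT K) euclideanreal (D i)" if "i \<in> {1..K}" for i
    by (rule continuous_map_eq[OF vertical_derivative(2)[OF M C x that]])
       (simp add: D_def B_def act_const_sec[OF A _ x])
  then have cD: "continuous_map (coord_top {1..K}) euclideanreal (D i)" if "i \<in> {1..K}" for i
    using that by (simp add: RT_def)
  have iD: "integral_simplex K (D i) =
      integral_simplex k (\<lambda>t. G i (face_map k 0 t)) - integral_simplex k (\<lambda>t. G i (face_map k i t))"
    if i: "i \<in> {1..K}" for i
    unfolding K_def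
  proof (rule integral_simplex_partial)
    show "continuous_map (RT (Suc k)) euclideanreal (G i)"
      using continuous_map_C_inf_vertical[OF M C id] by (simp add: G_def K_def)
    fix t assume t: "t \<in> RR (Suc k)"
    then have t': "t \<in> RR K" by (simp add: K_def)
    show "((\<lambda>s. G i (t(i := s))) has_real_derivative D i t) (at (t i))"
      using vertical_derivative(1)[OF M C x i t', of "omit i Es @ map lf as"]
      by (simp add: D_def B_def act_const_sec[OF A t x] G_def Es_def lf_def K_def)
  qed (use i cD' in \<open>simp_all add: K_def\<close>)
  have iT: "integral_simplex K (T l) = act A (as ! (l - 1)) (int_simplex K A \<omega> (omit l as)) x" for l
  proof -
    have "act A (as ! (l - 1)) (int_simplex K A \<omega> (omit l as)) x =
        integral_simplex K (\<lambda>t. tangent_apply (Rtimes K (base A)) (t, x)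
          (\<lambda>i\<in>charts_at (base A) x. econcat K (mdim (base A)) (ezero K) (anchor A x ((as ! (l - 1)) x) i))
          (\<omega> (Es @ map lf (omit l as))))"
      unfolding int_simplex_eq[OF omit_lists[OF as]] Es_def lf_def
      using x by (simp add: act_def tangent_apply_integral_simplex(1)[OF M C x])
    also have "\<dots> = integral_simplex K (T l)"
      unfolding integral_simplex_eq
      by (rule simplex_integral_cong_RR) (simp add: T_def B_def lf_def act_lift_sec[OF A _ x])
    finally show ?thesis by simp
  qed
  have iW: "integral_simplex K (W l l') = int_simplex K A \<omega> (br l l') x"
    if "l \<in> {1..m}" "l' \<in> {l<..m}" for l l'
    by (simp add: int_simplex_eq[OF br[OF that]] W_def Es_def lf_def)
  have "int_simplex K A (dR B \<omega>) as x = simplex_integral {1..K} (\<lambda>t. (\<Sum>i\<in>{1..K}. (-1) ^ (i + 1) * D i t) +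
      (-1) ^ K * ((\<Sum>l\<in>{1..m}. (-1) ^ (l + 1) * T l t) +
        (\<Sum>l\<in>{1..m}. \<Sum>l'\<in>{l<..m}. (-1) ^ (l + l') * W l l' t)))"
    unfolding int_simplex_eq[OF as] integral_simplex_eq
    using dR_TR_times[OF \<omega> as]
    by (simp add: B_def K_def D_def T_def W_def Es_def lf_def m_def br_def)
  also have "\<dots> = (\<Sum>i\<in>{1..K}. (-1) ^ (i + 1) * simplex_integral {1..K} (D i)) +
      (-1) ^ K * ((\<Sum>l\<in>{1..m}. (-1) ^ (l + 1) * simplex_integral {1..K} (T l)) +
        (\<Sum>l\<in>{1..m}. \<Sum>l'\<in>{l<..m}. (-1) ^ (l + l') * simplex_integral {1..K} (W l l')))"
  proof -
    note c = continuous_map_sum continuous_map_real_mult_left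
    have 1: "continuous_map (coord_top {1..K}) euclideanreal (\<lambda>t. \<Sum>i\<in>{1..K}. (-1) ^ (i + 1) * D i t)"
      by (intro c cD) auto
    have 2: "continuous_map (coord_top {1..K}) euclideanreal (\<lambda>t. \<Sum>l\<in>{1..m}. (-1) ^ (l + 1) * T l t)"
      by (intro c cT) auto
    have 3: "continuous_map (coord_top {1..K}) euclideanreal
        (\<lambda>t. \<Sum>l'\<in>{l<..m}. (-1) ^ (l + l') * W l l' t)" for l
      by (intro c cW) auto
    have 4: "continuous_map (coord_top {1..K}) euclideanreal
        (\<lambda>t. \<Sum>l\<in>{1..m}. \<Sum>l'\<in>{l<..m}. (-1) ^ (l + l') * W l l' t)"
      by (intro continuous_map_sum 3) auto
    note cc = continuous_map_real_mult_left[OF cD] continuous_map_real_mult_left[OF cT]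
      continuous_map_real_mult_left[OF cW]
    show ?thesis
      by (simp only: simplex_integral_add[OF _ 1 continuous_map_real_mult_left[OF continuous_map_add[OF 2 4]]]
          simplex_integral_add[OF _ 2 4] finite_atLeastAtMost finite_greaterThanAtMost
          simplex_integral_sum[OF _ _ 3] simplex_integral_sum[OF _ _ cc(1)] simplex_integral_sum[OF _ _ cc(2)]
          simplex_integral_sum[OF _ _ cc(3)] simplex_integral_cmult)
  qed
  also have "\<dots> = (\<Sum>i\<in>{1..K}. (-1) ^ (i + 1) *
      (integral_simplex k (\<lambda>t. G i (face_map k 0 t)) - integral_simplex k (\<lambda>t. G i (face_map k i t)))) +
      (-1) ^ K * ((\<Sum>l\<in>{1..m}. (-1) ^ (l + 1) * act A (as ! (l - 1)) (int_simplex K A \<omega> (omit l as)) x) +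
        (\<Sum>l\<in>{1..m}. \<Sum>l'\<in>{l<..m}. (-1) ^ (l + l') * int_simplex K A \<omega> (br l l') x))"
    unfolding integral_simplex_eq[of K, symmetric]
    by (intro arg_cong2[where f = "(+)"] arg_cong2[where f = "(*)"] sum.cong refl) (simp_all only: iD iT iW)
  also have "((\<Sum>l\<in>{1..m}. (-1) ^ (l + 1) * act A (as ! (l - 1)) (int_simplex K A \<omega> (omit l as)) x) +
        (\<Sum>l\<in>{1..m}. \<Sum>l'\<in>{l<..m}. (-1) ^ (l + l') * int_simplex K A \<omega> (br l l') x)) =
      dR A (int_simplex K A \<omega>) as x"
    using as by (simp add: dR_def m_def br_def)
  finally show ?thesis by (simp add: K_def B_def)
qed

section \<open>Face terms and comparison of the two sides\<close>

lemma int_face_pos: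
  assumes as: "as \<in> lists (sections A)" and j: "j \<in> {1..Suc k}"
  shows "int_face k j A \<omega> as x = integral_simplex k (\<lambda>t.
    \<omega> (omit j (coord_secs (Suc k) A) @ map (lift_sec (Suc k) A) as) (face_map k j t, x))"
proof -
  \<comment> \<open>For a coordinate face the differential of the face map merely skips the index
    \<open>j\<close>, so its fields are the coordinate fields without the
    \<open>j\<close>-th.\<close>
  have "map (\<lambda>s. const_sec (Suc k) A (face_vec k j s)) [1..<k + 1] = omit j (coord_secs (Suc k) A)"
    by (rule nth_equalityI)
       (use j in \<open>auto simp: omit_def coord_secs_def face_vec_def nth_append min_def simp del: upt_Suc
        simp flip: Suc_eq_plus1\<close>)
  then show ?thesis using as by (simp add: int_face_def flip: Suc_eq_plus1)
qed

text \<open>The fields on the slanted face are differences from the first coordinate field. Their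
  multilinear expansion is exactly the alternating sum of the upper endpoint terms left by the
  fundamental theorem of calculus.\<close>

lemma int_face_0:
  assumes \<omega>: "\<omega> \<in> Alt_forms (TR_times (Suc k) A) n" and as: "as \<in> lists (sections A)"
  shows "int_face k 0 A \<omega> as x = (\<Sum>i\<in>{1..Suc k}. (-1) ^ (i + 1) * integral_simplex k (\<lambda>t.
    \<omega> (omit i (coord_secs (Suc k) A) @ map (lift_sec (Suc k) A) as) (face_map k 0 t, x)))"
proof -
  let ?B = "TR_times (Suc k) A"
  define E where "E = (\<lambda>i. const_sec (Suc k) A (eunit (Suc k) i))"
  define d where "d = (\<lambda>v. sec_add ?B (sec_scale ?B (-1) (E 1)) v)"
  \<comment> \<open>For a constant field \<open>v\<close> the difference \<open>d v\<close> is again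
    a constant field and hence a section, so closure of arbitrary sections of the product under
    addition is not invoked.\<close>
  define T where "T = const_sec (Suc k) A ` RR (Suc k)"
  have dT: "d (const_sec (Suc k) A v) =
      const_sec (Suc k) A (eadd (Suc k) (escale (Suc k) (-1) (eunit (Suc k) 1)) v)" for v
    by (simp add: d_def E_def const_sec_diff[OF A])
  have T: "T \<subseteq> sections ?B" using const_sec_section[OF A] by (auto simp: T_def)
  have E: "E i \<in> T" for i by (simp add: E_def T_def)
  have face: "map (\<lambda>s. const_sec (Suc k) A (face_vec k 0 s)) [1..<Suc k] = map (\<lambda>s. d (E (s + 1))) [1..<Suc k]"
    by (simp add: E_def dT face_vec_def del: upt_Suc flip: Suc_eq_plus1)
  have coord: "coord_secs (Suc k) A = map E [1..<Suc (Suc k)]"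
    by (simp add: coord_secs_def E_def del: upt_Suc flip: Suc_eq_plus1)
  have scaled: "sec_scale ?B (-1) (E 1) \<in> sections ?B"
  proof -
    have "sec_scale ?B (-1) (E 1) = const_sec (Suc k) A (escale (Suc k) (-1) (eunit (Suc k) 1))"
      using fib_zero_laws(1)[OF A]
      by (auto simp: E_def const_sec_def sec_mult_def fun_eq_iff)
    then show ?thesis by (simp add: const_sec_section[OF A])
  qed
  have pt: "\<omega> (map (\<lambda>s. const_sec (Suc k) A (face_vec k 0 s)) [1..<Suc k] @ map (lift_sec (Suc k) A) as) p =
      (\<Sum>i\<in>{1..Suc k}. (-1) ^ (i + 1) *
        \<omega> (omit i (coord_secs (Suc k) A) @ map (lift_sec (Suc k) A) as) p)" for p
  proof -
    interpret alternating "sections ?B" "\<lambda>as. \<omega> as p"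
      by (rule Alt_forms_alternating[OF \<omega>])
    show ?thesis
      unfolding face coord
    proof (rule differences_omit[where u = "E 1" and T = T])
      show "E 1 \<in> sections ?B" using E T by blast
      show "d v \<in> sections ?B" if "v \<in> T" for v
        using that const_sec_section[OF A] by (auto simp: T_def dT)
      show "\<omega> (us @ d v # vs) p = \<omega> (us @ v # vs) p - \<omega> (us @ E 1 # vs) p"
        if us: "us \<in> lists (sections ?B)" "vs \<in> lists (sections ?B)" and v: "v \<in> T" for us v vs
        using Alt_forms_append(1)[OF \<omega> us scaled, of v p] Alt_forms_append(2)[OF \<omega> us, of "E 1" "-1" p]
          subsetD[OF T E] subsetD[OF T v] by (simp add: d_def)
      show "map (lift_sec (Suc k) A) as \<in> lists (sections ?B)" by (rule map_lift_sec_lists[OF as])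
    qed (use E T in auto)
  qed
  have c: "continuous_map (coord_top {1..k}) euclideanreal (\<lambda>t. \<omega> bs (face_map k 0 t, x))" for bs
    using continuous_map_C_inf_vertical[OF smooth_base[OF A] _ continuous_map_face_map[of 0 k]]
      Alt_forms_C_inf[OF \<omega>] by (simp add: RT_def)
  have "int_face k 0 A \<omega> as x = integral_simplex k (\<lambda>t. \<Sum>i\<in>{1..Suc k}. (-1) ^ (i + 1) *
        \<omega> (omit i (coord_secs (Suc k) A) @ map (lift_sec (Suc k) A) as) (face_map k 0 t, x))"
    using as by (simp only: int_face_def if_True Suc_eq_plus1[symmetric] pt)
  also have "\<dots> = (\<Sum>i\<in>{1..Suc k}. (-1) ^ (i + 1) * integral_simplex k (\<lambda>t.
    \<omega> (omit i (coord_secs (Suc k) A) @ map (lift_sec (Suc k) A) as) (face_map k 0 t, x)))"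
    unfolding integral_simplex_eq
    by (subst simplex_integral_sum)
       (simp_all add: continuous_map_real_mult_left c simplex_integral_cmult del: sum.cl_ivl_Suc)
  finally show ?thesis .
qed

lemma simplex_homotopy_formula:
  assumes \<omega>: "\<omega> \<in> Alt_forms (TR_times (Suc k) A) n"
  shows "int_simplex (Suc k) A (dR (TR_times (Suc k) A) \<omega>) as x +
      (-1) ^ (Suc k + 1) * dR A (int_simplex (Suc k) A \<omega>) as x =
    (\<Sum>j\<in>{0..Suc k}. (-1) ^ j * int_face k j A \<omega> as x)"
proof -
  \<comment> \<open>Equality of forms as functions includes argument lists that do not consist of
    sections and points off the manifold; in both cases everything vanishes by convention.\<close>
  consider "as \<notin> lists (sections A)" | "as \<in> lists (sections A)" "x \<notin> pts (base A)"
    | "as \<in> lists (sections A)" "x \<in> pts (base A)" by blast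
  then show ?thesis
  proof cases
    case 1
    then show ?thesis by (simp add: int_simplex_def dR_def int_face_def)
  next
    case 2
    have z: "\<omega> bs (t, x) = 0" for bs t
      using C_inf_zero_off[OF Alt_forms_C_inf[OF \<omega>, of bs], of "(t, x)"] 2(2) by simp
    have a: "act (TR_times (Suc k) A) a F (t, x) = 0" "act A b F' x = 0" for a F t b F'
      using 2(2) by (simp_all add: act_def)
    have "dR (TR_times (Suc k) A) \<omega> bs (t, x) = 0" for bs t
      by (simp add: dR_def a z)
    then have "int_simplex (Suc k) A (dR (TR_times (Suc k) A) \<omega>) as x = 0"
      by (simp add: int_simplex_def integral_simplex_eq)
    moreover have "int_simplex (Suc k) A \<omega> bs x = 0" for bs
      by (simp add: int_simplex_def integral_simplex_eq z)
    then have "dR A (int_simplex (Suc k) A \<omega>) as x = 0"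
      by (simp add: dR_def a)
    ultimately show ?thesis
      by (simp add: int_face_def z integral_simplex_eq)
  next
    case 3
    let ?G = "\<lambda>i t. \<omega> (omit i (coord_secs (Suc k) A) @ map (lift_sec (Suc k) A) as) (t, x)"
    have "(\<Sum>j\<in>{0..Suc k}. (-1) ^ j * int_face k j A \<omega> as x) =
        int_face k 0 A \<omega> as x + (\<Sum>j\<in>{1..Suc k}. (-1) ^ j * int_face k j A \<omega> as x)"
      by (subst sum.atLeast_Suc_atMost) (simp_all add: One_nat_def)
    also have "(\<Sum>j\<in>{1..Suc k}. (-1) ^ j * int_face k j A \<omega> as x) =
        (\<Sum>j\<in>{1..Suc k}. (-1) ^ j * integral_simplex k (\<lambda>t. ?G j (face_map k j t)))"
      by (intro sum.cong refl) (simp only: int_face_pos[OF 3(1)])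
    finally have rhs: "(\<Sum>j\<in>{0..Suc k}. (-1) ^ j * int_face k j A \<omega> as x) = int_face k 0 A \<omega> as x +
        (\<Sum>j\<in>{1..Suc k}. (-1) ^ j * integral_simplex k (\<lambda>t. ?G j (face_map k j t)))" .
    \<comment> \<open>Subtracting the lower endpoint turns the sign of the \<open>i\<close>-th term
      of the differential into the sign of the \<open>i\<close>-th face; the upper endpoints
      together form face 0.\<close>
    have "(\<Sum>i\<in>I. (-1) ^ (i + 1) * (a i - b i)) = (\<Sum>i\<in>I. (-1) ^ (i + 1) * a i) + (\<Sum>i\<in>I. (-1) ^ i * b i)"
      for I and a b :: "nat \<Rightarrow> real"
      unfolding sum.distrib[symmetric] by (intro sum.cong refl) (simp add: algebra_simps power_add)
    then show ?thesis
      unfolding int_simplex_dR[OF \<omega> 3] rhs int_face_0[OF \<omega> 3(1)] by (simp add: power_add del: sum.cl_ivl_Suc)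
  qed
qed

end

theorem theorem8:
  fixes A :: "('m, 'i, 'e, 'j) algebroid" and k :: nat
  assumes "lie_algebroid A" and "k \<ge> 1"
  shows "\<forall>n::int. \<forall>\<omega>\<in>Alt_forms (TR_times k A) n.
    (let lhs = (\<lambda>as x. int_simplex k A (dR (TR_times k A) \<omega>) as x
                  + (-1) ^ (k + 1) * dR A (int_simplex k A \<omega>) as x);
         rhs = (\<lambda>as x. \<Sum>j\<in>{0..k}. (-1) ^ j * int_face (k - 1) j A \<omega> as x)
     in lhs \<in> Alt_forms A (n - int k + 1) \<and> rhs \<in> Alt_forms A (n - int k + 1) \<and> lhs = rhs)"
proof (intro allI ballI)
  fix n :: int and \<omega> assume \<omega>: "\<omega> \<in> Alt_forms (TR_times k A) n"
  obtain q where q: "k = Suc q" using assms(2) by (cases k) auto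
  have \<omega>': "\<omega> \<in> Alt_forms (TR_times (Suc q) A) n" using \<omega> by (simp add: q)
  \<comment> \<open>Faces have dimension \<open>q = k - 1\<close>, so their integrals lower the
    degree by \<open>q\<close>, which is the required degree \<open>n - k + 1\<close>.\<close>
  have "(\<lambda>as x. \<Sum>j\<in>{0..Suc q}. (-1) ^ j * int_face q j A \<omega> as x) \<in> Alt_forms A (n - int q)"
    by (rule Alt_forms_sum[OF smooth_base[OF assms(1)] _ int_face_Alt_forms[OF assms(1) \<omega>']]) auto
  moreover have "n - int k + 1 = n - int q" by (simp add: q)
  ultimately show "let lhs = (\<lambda>as x. int_simplex k A (dR (TR_times k A) \<omega>) as x
                  + (-1) ^ (k + 1) * dR A (int_simplex k A \<omega>) as x);
         rhs = (\<lambda>as x. \<Sum>j\<in>{0..k}. (-1) ^ j * int_face (k - 1) j A \<omega> as x)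
     in lhs \<in> Alt_forms A (n - int k + 1) \<and> rhs \<in> Alt_forms A (n - int k + 1) \<and> lhs = rhs"
    using simplex_homotopy_formula[OF assms(1) \<omega>'] by (simp only: Let_def q diff_Suc_1 simp_thms)
qed

end
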